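(* Let $g\in(0,1)$, let $\lambda=\frac{1+\sqrt{g(2-g)}}{1-g}>1$ (so that $g=\frac{\lambda+\lambda^{-1}-2}{\lambda+\lambda^{-1}}=\frac{(\lambda-1)^2}{\lambda^2+1}$), and let $\mathbf{M}=\mathbf{W}+\lambda\mathbf{U}\mathbf{U}^\top$, where $\mathbf{W}\sim\mathrm{GOE}(d)$ and $\mathbf{U}$ uniform on $\mathrm{Stief}(d,r)$ are independent. For $\gamma\in(0,1)$ define the event $$\mathcal{E}_{\mathrm{good}}(\gamma):=\left\{\|\mathbf{W}\|_{\mathrm{op}}+(1-\gamma)(\lambda+\lambda^{-1}-2)\le\lambda_r(\mathbf{M})\right\}\cap\left\{\lambda_1(\mathbf{M})\le(1+\gamma)(\lambda+\lambda^{-1})\right\}.$$ There exists a polynomially bounded function $\mathfrak{q}$ (i.e. a function of five arguments bounded by a fixed polynomial in them) such that for all $\gamma,\delta\in(0,1/10)$ and all $d\ge\mathfrak{q}\big(g^{-1},(1-g)^{-1},\gamma^{-1},r,\log(1/\delta)\big)$, $$\Pr[\mathcal{E}_{\mathrm{good}}(\gamma)]\ge 1-\delta .$$ Moreover, on $\mathcal{E}_{\mathrm{good}}(\gamma)$, $\mathrm{gap}_r(\mathbf{M})=\mathrm{gap}_r(\mathrm{abs}(\mathbf{M}))\ge\frac{1-\gamma}{1+\gamma}\cdot g$.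
   Context: $\mathrm{GOE}(d)$: random symmetric $\mathbf{W}\in\mathbb{R}^{d\times d}$ with independent entries $\{\mathbf{W}_{ij}\}_{i\le j}$, $\mathbf{W}_{ij}\sim\mathcal{N}(0,1/d)$ for $i<j$, $\mathbf{W}_{ii}\sim\mathcal{N}(0,2/d)$. $\mathrm{Stief}(d,r)=\{V\in\mathbb{R}^{d\times r}:V^\top V=I_r\}$; uniform means the rotation-invariant probability measure. For symmetric $M$, $\lambda_1(M)\ge\dots\ge\lambda_d(M)$ are the eigenvalues, $\mathrm{abs}(M)=(M^2)^{1/2}$, $\sigma_i(M)=\lambda_i(M^2)^{1/2}$, $\mathrm{gap}_r(M)=\frac{\sigma_r(M)-\sigma_{r+1}(M)}{\sigma_r(M)}$. The function $\mathfrak q$ does not depend on $g,\gamma,r,\delta,d$ other than through its arguments. *)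

theory Defs
  imports
    "HOL-Probability.Probability"
    "HOL-Computational_Algebra.Computational_Algebra"
    "Jordan_Normal_Form.Char_Poly"
begin

text \<open>
  The dimension \<open>d\<close> varies inside the theorem, so matrices are those of the AFP entry
  Jordan_Normal_Form, whose dimensions are values rather than types.
\<close>

subsection \<open>Spectral notions\<close>

definition symmetric_mats :: "nat \<Rightarrow> real mat set" where
  "symmetric_mats d = {A \<in> carrier_mat d d. transpose_mat A = A}"

text \<open>
  The real roots of the characteristic polynomial with multiplicity, in decreasing order;
  for a symmetric \<open>d \<times> d\<close> matrix there are exactly \<open>d\<close> of them. The index is 1-based:
  \<open>eigval i A\<close> is meaningful for \<open>1 \<le> i \<le> d\<close>.
\<close>
definition eigval :: "nat \<Rightarrow> real mat \<Rightarrow> real" where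
  "eigval i A = rev (sorted_list_of_multiset (proots (char_poly A))) ! (i - 1)"

text \<open>
  Singular values with index beyond the dimension are \<open>0\<close>, so that the relative gap below
  also makes sense for \<open>r = d\<close>.
\<close>
definition singval :: "nat \<Rightarrow> real mat \<Rightarrow> real" where
  "singval i A = (if i \<le> dim_row A then sqrt (eigval i (A * A)) else 0)"

definition gap :: "nat \<Rightarrow> real mat \<Rightarrow> real" where
  "gap r A = (singval r A - singval (r + 1) A) / singval r A"

definition psd_mats :: "nat \<Rightarrow> real mat set" where
  "psd_mats d = {A \<in> symmetric_mats d. \<forall>v \<in> carrier_vec d. 0 \<le> v \<bullet> (A *\<^sub>v v)}"

definition psd_sqrt :: "real mat \<Rightarrow> real mat" where
  "psd_sqrt A = (THE B. B \<in> psd_mats (dim_row A) \<and> B * B = A)"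

definition mat_abs :: "real mat \<Rightarrow> real mat" where
  "mat_abs A = psd_sqrt (A * A)"

definition op_norm :: "real mat \<Rightarrow> real" where
  "op_norm A = (SUP v \<in> {v \<in> carrier_vec (dim_col A). v \<bullet> v \<le> 1}.
     sqrt ((A *\<^sub>v v) \<bullet> (A *\<^sub>v v)))"

subsection \<open>Random matrices\<close>

text \<open>The Borel sigma-algebra on real \<open>m \<times> n\<close> matrices, identified with arrays of entries.\<close>
definition mat_borel :: "nat \<Rightarrow> nat \<Rightarrow> real mat measure" where
  "mat_borel m n = vimage_algebra (carrier_mat m n)
     (\<lambda>A. \<lambda>p \<in> {..<m} \<times> {..<n}. A $$ p) (Pi\<^sub>M ({..<m} \<times> {..<n}) (\<lambda>_. borel))"

text \<open>
  The law of a \<open>GOE(d)\<close> matrix: the image of independent entries \<open>W\<^sub>i\<^sub>j\<close>, \<open>i \<le> j\<close>, under symmetric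
  completion. The second argument of \<open>normal_density\<close> is the standard deviation.
\<close>
definition goe :: "nat \<Rightarrow> real mat measure" where
  "goe d = distr
     (Pi\<^sub>M {(i, j). i \<le> j \<and> j < d} (\<lambda>(i, j). density lborel
        (\<lambda>x. ennreal (normal_density 0 (if i = j then sqrt (2 / real d) else sqrt (1 / real d)) x))))
     (mat_borel d d)
     (\<lambda>w. mat d d (\<lambda>(i, j). w (min i j, max i j)))"

definition stiefel :: "nat \<Rightarrow> nat \<Rightarrow> real mat set" where
  "stiefel d r = {V \<in> carrier_mat d r. transpose_mat V * V = 1\<^sub>m r}"

text \<open>
  \<open>\<nu>\<close> is the rotation-invariant probability measure on the Stiefel manifold. Note that
  \<open>stiefel d d\<close> is the orthogonal group, and that existence of \<open>\<nu>\<close> forces \<open>r \<le> d\<close>.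
\<close>
definition uniform_stiefel :: "nat \<Rightarrow> nat \<Rightarrow> real mat measure \<Rightarrow> bool" where
  "uniform_stiefel d r \<nu> \<longleftrightarrow>
     prob_space \<nu> \<and>
     sets \<nu> = sets (restrict_space (mat_borel d r) (stiefel d r)) \<and>
     (\<forall>Q \<in> stiefel d d. distr \<nu> \<nu> (\<lambda>V. Q * V) = \<nu>)"

subsection \<open>The spiked model\<close>

definition spike :: "real \<Rightarrow> real" where
  "spike g = (1 + sqrt (g * (2 - g))) / (1 - g)"

definition spiked_mat :: "real \<Rightarrow> real mat \<Rightarrow> real mat \<Rightarrow> real mat" where
  "spiked_mat l W U = W + l \<cdot>\<^sub>m (U * transpose_mat U)"

text \<open>
  The event as a set of pairs \<open>(W, U)\<close>. As \<open>W\<close> and \<open>U\<close> are independent, their joint law is the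
  product \<open>goe d \<Otimes>\<^sub>M \<nu>\<close>, where \<open>\<nu>\<close> is the uniform law on the Stiefel manifold.
\<close>
definition good_event :: "nat \<Rightarrow> nat \<Rightarrow> real \<Rightarrow> real \<Rightarrow> (real mat \<times> real mat) set" where
  "good_event d r g \<gamma> = {(W, U) \<in> symmetric_mats d \<times> stiefel d r.
     let l = spike g; M = spiked_mat l W U in
       op_norm W + (1 - \<gamma>) * (l + inverse l - 2) \<le> eigval r M \<and>
       eigval 1 M \<le> (1 + \<gamma>) * (l + inverse l)}"

text \<open>Domination by a polynomial in five variables, on nonnegative arguments.\<close>
definition polynomially_bounded :: "(real \<Rightarrow> real \<Rightarrow> real \<Rightarrow> real \<Rightarrow> real \<Rightarrow> real) \<Rightarrow> bool" where
  "polynomially_bounded q \<longleftrightarrow>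
     (\<exists>N (c :: nat \<Rightarrow> nat \<Rightarrow> nat \<Rightarrow> nat \<Rightarrow> nat \<Rightarrow> real).
       \<forall>v\<ge>0. \<forall>w\<ge>0. \<forall>x\<ge>0. \<forall>y\<ge>0. \<forall>z\<ge>0.
         \<bar>q v w x y z\<bar> \<le> (\<Sum>i\<le>N. \<Sum>j\<le>N. \<Sum>k\<le>N. \<Sum>l\<le>N. \<Sum>m\<le>N.
           c i j k l m * v ^ i * w ^ j * x ^ k * y ^ l * z ^ m))"

end

theory Submission
  imports Defs
begin

text \<open>
  Let \<open>z = \<lambda> + 1/\<lambda>\<close>. If \<open>|W| < z\<close> and the compression \<open>U\<^sup>T (z - W)\<^sup>-\<^sup>1 U\<close> of the resolvent is close to
  \<open>1/\<lambda>\<close>, then the vectors \<open>(z - W)\<^sup>-\<^sup>1 U x\<close> are approximate eigenvectors of \<open>M\<close> for the eigenvalue \<open>z\<close>,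
  and \<open>M\<close> has no eigenvalue much larger than \<open>z\<close>. By polarisation it suffices to control
  \<open>u\<^sup>T (z - W)\<^sup>-\<^sup>1 u\<close> for about \<open>r\<^sup>2\<close> fixed vectors \<open>u\<close>. By rotation invariance \<open>u\<close> may be taken to be
  the last coordinate vector, and then the Schur complement formula expresses this quantity as
  \<open>1 / (z - a - b\<^sup>T (z - W')\<^sup>-\<^sup>1 b)\<close>, where the smaller corner \<open>W'\<close> is independent of the border \<open>(a, b)\<close>.
  As \<open>a\<close> is small and \<open>|b|\<close> is close to \<open>1\<close>, induction over the size of the corner reduces everything to
  the contraction \<open>t \<mapsto> 1 / (z - t)\<close> with fixed point \<open>1/\<lambda>\<close>. The same argument at \<open>2 + \<eta>\<close> in place of
  \<open>z\<close>, with supersolution \<open>t = 1\<close>, bounds \<open>|W|\<close>. Only Chernoff bounds for sums of squares of Gaussians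
  enter, so that all failure probabilities are exponentially small in \<open>d\<close>.
\<close>

subsection \<open>Linear algebra on functions\<close>

text \<open>Vectors and matrices are functions on all of \<open>nat\<close>, with the size as a
  parameter: the induction compares corners of different sizes, and passing to a smaller corner then
  changes only this parameter. The entries of every corner keep the variance scale 1/d, so a border
  of length \<open>n\<close> has squared norm about n/d. This makes the two inductions different.
  The upper bound on the resolvent needs only |b|^2 \<le> 1 + h, and a single supersolution survives
  all sizes n \<le> d. The lower bound needs |b|^2 close to 1, hence \<open>n\<close> close to
  \<open>d\<close>; it starts from the trivial value 0 at size about d (1 - h) and climbs to 1/l -
  \<epsilon> during the last d h sizes. The climb is possible because the two fixed points l and 1/l
  have distance at least 2 g. A new border can point in any direction, so the induction hypothesis
  must hold for every direction with one bound; this is why rotation invariance is used at every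
  size. It is proved for a matrix \<open>G\<close> with independent entries and for plane rotations
  only, and passes to W = (G + G^T) / sqrt (2 d) because only quadratic forms are observed.\<close>

definition ip :: "nat \<Rightarrow> (nat \<Rightarrow> real) \<Rightarrow> (nat \<Rightarrow> real) \<Rightarrow> real" where
  "ip n u v = (\<Sum>i<n. u i * v i)"

definition mv :: "nat \<Rightarrow> (nat \<times> nat \<Rightarrow> real) \<Rightarrow> (nat \<Rightarrow> real) \<Rightarrow> nat \<Rightarrow> real" where
  "mv n A v = (\<lambda>i. \<Sum>j<n. A (i, j) * v j)"

definition lc :: "nat \<Rightarrow> (nat \<Rightarrow> nat \<Rightarrow> real) \<Rightarrow> (nat \<Rightarrow> real) \<Rightarrow> nat \<Rightarrow> real" where
  "lc r y x = (\<lambda>i. \<Sum>j<r. x j * y j i)"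

definition symf :: "nat \<Rightarrow> (nat \<times> nat \<Rightarrow> real) \<Rightarrow> bool" where
  "symf n A \<longleftrightarrow> (\<forall>i<n. \<forall>j<n. A (i, j) = A (j, i))"

lemma ip_commute: "ip n u v = ip n v u"
  by (simp add: ip_def mult.commute)

lemma ip_cong: "(\<And>i. i < n \<Longrightarrow> u i = u' i) \<Longrightarrow> (\<And>i. i < n \<Longrightarrow> v i = v' i) \<Longrightarrow> ip n u v = ip n u' v'"
  by (simp add: ip_def)

lemma mv_cong: "(\<And>j. j < n \<Longrightarrow> A (i, j) = A' (i, j)) \<Longrightarrow> (\<And>i. i < n \<Longrightarrow> v i = v' i) \<Longrightarrow> mv n A v i = mv n A' v' i"
  by (simp add: mv_def)

lemma ip_comb_left: "ip n (\<lambda>i. a * u i + b * v i) w = a * ip n u w + b * ip n v w"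
  by (simp add: ip_def algebra_simps sum.distrib sum_distrib_left)

lemma ip_comb_right: "ip n w (\<lambda>i. a * u i + b * v i) = a * ip n w u + b * ip n w v"
  by (simp add: ip_def algebra_simps sum.distrib sum_distrib_left)

lemma ip_scale_left: "ip n (\<lambda>i. a * u i) w = a * ip n u w"
  by (simp add: ip_def algebra_simps sum_distrib_left)

lemma ip_scale_right: "ip n w (\<lambda>i. a * u i) = a * ip n w u"
  by (simp add: ip_def algebra_simps sum_distrib_left)

lemma mv_comb: "mv n A (\<lambda>i. a * u i + b * v i) = (\<lambda>i. a * mv n A u i + b * mv n A v i)"
  by (simp add: mv_def algebra_simps sum.distrib sum_distrib_left)

lemma mv_scale: "mv n A (\<lambda>i. a * u i) = (\<lambda>i. a * mv n A u i)"
  by (simp add: mv_def algebra_simps sum_distrib_left)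

lemma ip_lc_left: "ip n (lc r y x) v = (\<Sum>j<r. x j * ip n (y j) v)"
  unfolding ip_def lc_def sum_distrib_right sum_distrib_left mult.assoc by (rule sum.swap)

lemma ip_lc_right: "ip n v (lc r y x) = (\<Sum>j<r. x j * ip n v (y j))"
  by (subst (1 2) ip_commute) (rule ip_lc_left)

lemma mv_lc: "mv n A (lc r y x) = lc r (\<lambda>j. mv n A (y j)) x"
  unfolding mv_def lc_def sum_distrib_left by (subst sum.swap) (simp add: mult.left_commute)

lemma ip_mv_sym:
  assumes "symf n A"
  shows "ip n u (mv n A v) = ip n (mv n A u) v"
proof -
  have "ip n u (mv n A v) = (\<Sum>i<n. \<Sum>j<n. u i * (A (i, j) * v j))"
    by (simp add: ip_def mv_def sum_distrib_left)
  also have "\<dots> = (\<Sum>j<n. \<Sum>i<n. u i * (A (i, j) * v j))" by (rule sum.swap)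
  also have "\<dots> = ip n (mv n A u) v"
    using assms by (auto simp: ip_def mv_def sum_distrib_right symf_def intro!: sum.cong)
  finally show ?thesis .
qed

lemma ip_self_nonneg: "0 \<le> ip n v v"
  by (simp add: ip_def sum_nonneg)

lemma ip_self_eq_0_iff: "ip n v v = 0 \<longleftrightarrow> (\<forall>i<n. v i = 0)"
  by (auto simp: ip_def sum_nonneg_eq_0_iff)

lemma ip_self_pos_iff: "0 < ip n v v \<longleftrightarrow> (\<exists>i<n. v i \<noteq> 0)"
  using ip_self_nonneg[of n v] ip_self_eq_0_iff[of n v] by fastforce

lemma ip_cauchy_schwarz: "(ip n u v)\<^sup>2 \<le> ip n u u * ip n v v"
  using Cauchy_Schwarz_ineq_sum[of u v "{..<n}"] by (simp add: ip_def power2_eq_square)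

text \<open>Padding with zero rows gives a square matrix whose transpose kills the unit vector
  \<open>k\<close>, so its determinant vanishes. All dimension counts below (Courant-Fischer,
  \<open>r \<le> d\<close> on the Stiefel manifold) rest on this.\<close>

lemma underdetermined_nontrivial:
  fixes H :: "nat \<Rightarrow> nat \<Rightarrow> real"
  assumes "k < m"
  obtains x where "\<exists>j<m. x j \<noteq> 0" "\<And>i. i < k \<Longrightarrow> (\<Sum>j<m. H i j * x j) = 0"
proof -
  define A where "A = mat m m (\<lambda>(i, j). if i < k then H i j else 0)"
  have A: "A \<in> carrier_mat m m" by (simp add: A_def)
  let ?u = "unit_vec m k :: real vec"
  have "transpose_mat A *\<^sub>v ?u = 0\<^sub>v m"
    using assms by (auto intro!: eq_vecI simp: A_def scalar_prod_def unit_vec_def intro!: sum.neutral)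
  moreover have "?u \<in> carrier_vec m" "?u \<noteq> 0\<^sub>v m" using assms by auto
  ultimately have "det (transpose_mat A) = 0"
    using det_0_iff_vec_prod_zero[of "transpose_mat A" m] A by (metis transpose_carrier_mat)
  hence "det A = 0" using det_transpose[OF A] by simp
  then obtain v where v: "v \<in> carrier_vec m" "v \<noteq> 0\<^sub>v m" "A *\<^sub>v v = 0\<^sub>v m"
    using det_0_iff_vec_prod_zero[OF A] by auto
  show thesis
  proof (rule that[of "\<lambda>j. v $ j"])
    show "\<exists>j<m. v $ j \<noteq> 0" using v(1,2) by (auto simp: vec_eq_iff)
    fix i assume "i < k"
    with assms have i: "i < m" by simp
    have "(A *\<^sub>v v) $ i = 0" using v(3) i by simp
    thus "(\<Sum>j<m. H i j * v $ j) = 0"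
      using i \<open>i < k\<close> v(1) by (simp add: A_def scalar_prod_def atLeast0LessThan)
  qed
qed

section \<open>Eigenvectors by constrained maximisation\<close>

definition unit_sphere_in_complement :: "nat \<Rightarrow> nat \<Rightarrow> (nat \<Rightarrow> nat \<Rightarrow> real) \<Rightarrow> (nat \<Rightarrow> real) set" where
  "unit_sphere_in_complement n k f =
     {v. (\<forall>i\<ge>n. v i = 0) \<and> ip n v v = 1 \<and> (\<forall>j<k. ip n (f j) v = 0)}"

lemma continuous_on_ip [continuous_intros]:
  assumes "\<And>i. continuous_on S (\<lambda>x. u x i)" "\<And>i. continuous_on S (\<lambda>x. v x i)"
  shows "continuous_on S (\<lambda>x. ip n (u x) (v x))"
  unfolding ip_def by (intro continuous_intros assms)

text \<open>Pinning the entries from \<open>n\<close> on to 0 makes the set a closed subset of a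
  Tychonoff cube in \<open>nat \<Rightarrow> real\<close>; with free entries it would not be
  compact.\<close>

lemma compact_unit_sphere_in_complement: "compact (unit_sphere_in_complement n k f)"
proof -
  have c: "continuous_on UNIV (\<lambda>v :: nat \<Rightarrow> real. v i)" for i
    by (rule continuous_on_product_coordinates)
  have "closed (unit_sphere_in_complement n k f)"
    unfolding unit_sphere_in_complement_def
    by (intro closed_Collect_conj closed_Collect_all closed_Collect_imp closed_Collect_eq
        open_Collect_const continuous_intros c)
  moreover have "unit_sphere_in_complement n k f \<subseteq> PiE UNIV (\<lambda>_. {-1..1})"
  proof
    fix v assume v: "v \<in> unit_sphere_in_complement n k f"
    have "\<bar>v i\<bar> \<le> 1" for i
    proof (cases "i < n")
      case True
      have "(v i)\<^sup>2 \<le> (\<Sum>i<n. (v i)\<^sup>2)" using True by (intro member_le_sum) auto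
      hence "(v i)\<^sup>2 \<le> 1" using v by (simp add: unit_sphere_in_complement_def ip_def power2_eq_square)
      thus ?thesis by (simp add: abs_square_le_1)
    next
      case False
      thus ?thesis using v by (simp add: unit_sphere_in_complement_def)
    qed
    thus "v \<in> PiE UNIV (\<lambda>_. {-1..1})" by (force simp: abs_le_iff minus_le_iff)
  qed
  moreover have "compact (PiE UNIV (\<lambda>_. {-1..1}) :: (nat \<Rightarrow> real) set)"
    using compactin_PiE[of "\<lambda>_. euclidean :: real topology" "UNIV :: nat set" "\<lambda>_. {-1..1}"]
    by (simp add: euclidean_product_topology)
  ultimately show ?thesis by (metis closed_Int_compact inf.absorb_iff1)
qed

text \<open>The first-order condition at an extremum: near t = 0 the linear term dominates, and
  \<open>t\<close> runs over both signs. The choice t = a / (2 c) with c > |b| makes the quadratic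
  term at most half of the linear one.\<close>

lemma quadratic_le_imp_linear_zero:
  fixes a b :: real
  assumes "\<And>t. t * a \<le> t\<^sup>2 * b"
  shows "a = 0"
proof (rule ccontr)
  assume "a \<noteq> 0"
  define c where "c = \<bar>b\<bar> + 1"
  define t where "t = a / (2 * c)"
  have c: "0 < c" "b \<le> c" by (auto simp: c_def)
  hence a: "a = 2 * c * t" by (simp add: t_def)
  have "t * a \<le> t\<^sup>2 * b" by (rule assms)
  also have "\<dots> \<le> t\<^sup>2 * c" using c by (intro mult_left_mono) auto
  also have "\<dots> = t * a / 2" by (simp add: a power2_eq_square)
  finally have "t * a \<le> 0" by linarith
  moreover have "0 < t * a" using \<open>a \<noteq> 0\<close> c by (auto simp: t_def zero_less_divide_iff zero_less_mult_iff)
  ultimately show False by simp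
qed

text \<open>A maximiser \<open>v\<close> of the Rayleigh quotient on the orthogonal complement of
  the eigenvectors found so far is an eigenvector: its residual h = A v - \<mu> v again lies in that
  complement, because \<open>A\<close> is symmetric and the \<open>f j\<close> are eigenvectors, so
  v + t h competes and the first variation forces h = 0.\<close>

lemma constrained_eigenvector:
  assumes sym: "symf n A" and "k < n"
    and eig: "\<forall>j<k. \<forall>i<n. mv n A (f j) i = e j * f j i"
  shows "\<exists>v \<mu>. ip n v v = 1 \<and> (\<forall>j<k. ip n (f j) v = 0) \<and> (\<forall>i<n. mv n A v i = \<mu> * v i) \<and>
    (\<forall>w. (\<forall>j<k. ip n (f j) w = 0) \<longrightarrow> ip n w (mv n A w) \<le> \<mu> * ip n w w)"
proof -
  let ?K = "unit_sphere_in_complement n k f"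
  let ?trunc = "\<lambda>w c i. if i < n then c * w i else 0"
  have inK: "?trunc w (1 / sqrt (ip n w w)) \<in> ?K"
    if pos: "0 < ip n w w" and orth: "\<And>j. j < k \<Longrightarrow> ip n (f j) w = 0" for w
  proof -
    let ?c = "1 / sqrt (ip n w w)"
    have "ip n (?trunc w ?c) (?trunc w ?c) = ip n (\<lambda>i. ?c * w i) (\<lambda>i. ?c * w i)"
      by (rule ip_cong) auto
    also have "\<dots> = 1"
      using pos unfolding ip_scale_left ip_scale_right by simp
    finally have "ip n (?trunc w ?c) (?trunc w ?c) = 1" .
    moreover have "ip n (f j) (?trunc w ?c) = 0" if "j < k" for j
    proof -
      have "ip n (f j) (?trunc w ?c) = ip n (f j) (\<lambda>i. ?c * w i)" by (rule ip_cong) auto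
      thus ?thesis using orth[OF that] by (simp only: ip_scale_right mult_zero_right)
    qed
    ultimately show ?thesis by (simp add: unit_sphere_in_complement_def)
  qed
  obtain x where x: "\<exists>j<n. x j \<noteq> 0" "\<And>i. i < k \<Longrightarrow> (\<Sum>j<n. f i j * x j) = 0"
    using underdetermined_nontrivial[OF \<open>k < n\<close>, of f] by blast
  have "0 < ip n x x" using x(1) by (simp only: ip_self_pos_iff)
  moreover have "ip n (f j) x = 0" if "j < k" for j using x(2)[OF that] by (simp only: ip_def)
  ultimately have ne: "?K \<noteq> {}" using inK[of x] by blast
  have "continuous_on ?K (\<lambda>v. ip n v (mv n A v))"
    unfolding mv_def
    by (intro continuous_intros continuous_on_subset[OF continuous_on_product_coordinates]) auto
  hence "\<exists>v\<in>?K. \<forall>w\<in>?K. ip n w (mv n A w) \<le> ip n v (mv n A v)"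
    by (intro continuous_attains_sup compact_unit_sphere_in_complement ne)
  then obtain v where v: "v \<in> ?K"
    and vmax: "\<And>w. w \<in> ?K \<Longrightarrow> ip n w (mv n A w) \<le> ip n v (mv n A v)"
    by blast
  define \<mu> where "\<mu> = ip n v (mv n A v)"
  have v1: "ip n v v = 1" and vf: "\<And>j. j < k \<Longrightarrow> ip n (f j) v = 0"
    using v by (auto simp: unit_sphere_in_complement_def)
  have max: "ip n w (mv n A w) \<le> \<mu> * ip n w w" if "\<And>j. j < k \<Longrightarrow> ip n (f j) w = 0" for w
  proof (cases "0 < ip n w w")
    case True
    let ?c = "1 / sqrt (ip n w w)"
    let ?w = "?trunc w ?c"
    have "ip n ?w (mv n A ?w) \<le> \<mu>" unfolding \<mu>_def by (rule vmax[OF inK[OF True that]])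
    moreover have "ip n ?w (mv n A ?w) = ip n (\<lambda>i. ?c * w i) (mv n A (\<lambda>i. ?c * w i))"
      by (intro ip_cong mv_cong) auto
    moreover have "\<dots> = ip n w (mv n A w) / ip n w w"
      using True unfolding mv_scale ip_scale_left ip_scale_right by simp
    ultimately have "ip n w (mv n A w) / ip n w w \<le> \<mu>" by linarith
    thus ?thesis using True by (simp only: pos_divide_le_eq)
  next
    case False
    hence "\<forall>i<n. w i = 0" using ip_self_pos_iff by blast
    thus ?thesis by (simp add: ip_def)
  qed
  define h where "h = (\<lambda>i. 1 * mv n A v i + (- \<mu>) * v i)"
  have hf: "ip n (f j) h = 0" if "j < k" for j
  proof -
    have "ip n (f j) (mv n A v) = ip n (\<lambda>i. e j * f j i) v"
      unfolding ip_mv_sym[OF sym] using eig that by (intro ip_cong) auto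
    thus ?thesis using vf[OF that] unfolding h_def ip_comb_right ip_scale_left by simp
  qed
  \<comment> \<open>Twice the squared residual is the derivative at t = 0 of the form of A - \<mu>
    along v + t h, which attains its maximum 0 at \<open>v\<close>.\<close>
  have "t * (2 * ip n h h) \<le> t\<^sup>2 * (\<mu> * ip n h h - ip n h (mv n A h))" for t
  proof -
    let ?w = "\<lambda>i. 1 * v i + t * h i"
    have "ip n (f j) ?w = 0" if "j < k" for j
      using vf[OF that] hf[OF that] unfolding ip_comb_right by simp
    hence le: "ip n ?w (mv n A ?w) \<le> \<mu> * ip n ?w ?w" by (rule max)
    have Av: "ip n v (mv n A h) = ip n (mv n A v) h" by (rule ip_mv_sym[OF sym])
    have "ip n h h = 1 * ip n (mv n A v) h + (- \<mu>) * ip n v h"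
      unfolding ip_comb_left[symmetric] h_def ..
    hence Avh: "ip n (mv n A v) h = ip n h h + \<mu> * ip n v h" by simp
    show ?thesis
      using le unfolding mv_comb ip_comb_left ip_comb_right \<mu>_def[symmetric] v1 Av
        ip_commute[of n h "mv n A v"] ip_commute[of n h v] Avh
      by (simp add: algebra_simps power2_eq_square)
  qed
  hence "ip n h h = 0" using quadratic_le_imp_linear_zero[of "2 * ip n h h"] by auto
  hence "mv n A v i = \<mu> * v i" if "i < n" for i using that by (simp add: ip_self_eq_0_iff h_def)
  thus ?thesis using v1 vf max by blast
qed

text \<open>\<open>e 0 \<ge> e 1 \<ge> \<dots>\<close> are the eigenvalues of \<open>A\<close>; the last clause is the variational
  characterisation of \<open>e j\<close>.\<close>
definition eigensystem :: "nat \<Rightarrow> (nat \<times> nat \<Rightarrow> real) \<Rightarrow> nat \<Rightarrow> (nat \<Rightarrow> nat \<Rightarrow> real) \<Rightarrow> (nat \<Rightarrow> real) \<Rightarrow> bool" where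
  "eigensystem n A k f e \<longleftrightarrow>
     (\<forall>i<k. \<forall>j<k. ip n (f i) (f j) = (if i = j then 1 else 0)) \<and>
     (\<forall>j<k. \<forall>i<n. mv n A (f j) i = e j * f j i) \<and>
     (\<forall>j<k. \<forall>w. (\<forall>i<j. ip n (f i) w = 0) \<longrightarrow> ip n w (mv n A w) \<le> e j * ip n w w)"

lemma eigensystem_exists:
  assumes "symf n A" "k \<le> n"
  shows "\<exists>f e. eigensystem n A k f e"
  using assms(2)
proof (induction k)
  case 0
  show ?case by (simp add: eigensystem_def)
next
  case (Suc k)
  then obtain f e where E: "eigensystem n A k f e" by auto
  have eig: "\<forall>j<k. \<forall>i<n. mv n A (f j) i = e j * f j i"
    using E by (auto simp: eigensystem_def)
  have "k < n" using Suc by simp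
  obtain v \<mu> where v: "ip n v v = 1" "\<forall>j<k. ip n (f j) v = 0" "\<forall>i<n. mv n A v i = \<mu> * v i"
    "\<forall>w. (\<forall>j<k. ip n (f j) w = 0) \<longrightarrow> ip n w (mv n A w) \<le> \<mu> * ip n w w"
    using constrained_eigenvector[where f = f and e = e, OF assms(1) \<open>k < n\<close> eig] by (elim exE conjE) (rule that)
  have v': "\<forall>j<k. ip n v (f j) = 0" using v(2) by (metis ip_commute)
  let ?f = "f(k := v)" and ?e = "e(k := \<mu>)"
  have "ip n (?f i) (?f j) = (if i = j then 1 else 0)" if "i < Suc k" "j < Suc k" for i j
    using that v(1,2) v' E by (auto simp: eigensystem_def less_Suc_eq)
  moreover have "mv n A (?f j) i = ?e j * ?f j i" if "j < Suc k" "i < n" for i j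
    using that v(3) eig by (auto simp: less_Suc_eq)
  moreover have "ip n w (mv n A w) \<le> ?e j * ip n w w"
    if "j < Suc k" "\<forall>i<j. ip n (?f i) w = 0" for j w
  proof (cases "j = k")
    case True
    with that v(4) show ?thesis by simp
  next
    case False
    with that have "j < k" "\<forall>i<j. ip n (f i) w = 0" by auto
    with E show ?thesis by (simp add: eigensystem_def)
  qed
  ultimately have "eigensystem n A (Suc k) ?f ?e" unfolding eigensystem_def by blast
  thus ?case by blast
qed

lemma eigensystem_antimono:
  assumes "eigensystem n A k f e" "i \<le> j" "j < k"
  shows "e j \<le> e i"
proof -
  have "ip n (f j) (mv n A (f j)) = ip n (f j) (\<lambda>i. e j * f j i)"
    using assms by (intro ip_cong) (auto simp: eigensystem_def)
  also have "\<dots> = e j" using assms by (simp add: ip_scale_right eigensystem_def)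
  finally have 1: "ip n (f j) (mv n A (f j)) = e j" .
  have "ip n (f l) (f j) = 0" if "l < i" for l
  proof -
    have "l < k" "l \<noteq> j" using that assms by auto
    thus ?thesis using assms by (simp add: eigensystem_def)
  qed
  moreover have "i < k" using assms by simp
  ultimately have "ip n (f j) (mv n A (f j)) \<le> e i * ip n (f j) (f j)"
    using assms(1) unfolding eigensystem_def by blast
  thus ?thesis using assms 1 by (simp add: eigensystem_def)
qed

subsection \<open>Eigenvalues and their variational characterisation\<close>

lemma eigensystem_orthogonal_matrix:
  assumes E: "eigensystem n A n f e"
  shows "transpose_mat (mat n n (\<lambda>(i, j). f j i)) * mat n n (\<lambda>(i, j). f j i) = 1\<^sub>m n"
    (is "transpose_mat ?P * ?P = _")
proof (rule eq_matI)
  fix i j assume ij: "i < dim_row (1\<^sub>m n :: real mat)" "j < dim_col (1\<^sub>m n :: real mat)"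
  hence "(transpose_mat ?P * ?P) $$ (i, j) = ip n (f i) (f j)"
    by (simp add: scalar_prod_def ip_def atLeast0LessThan)
  thus "(transpose_mat ?P * ?P) $$ (i, j) = 1\<^sub>m n $$ (i, j)"
    using E ij by (auto simp: eigensystem_def)
qed auto

text \<open>Diagonalisation by the orthogonal matrix of eigenvectors. It connects
  \<open>eigval\<close>, defined through the roots of the characteristic polynomial, with the
  Rayleigh quotients used everywhere else.\<close>

lemma char_poly_eigensystem:
  assumes E: "eigensystem n A n f e"
  shows "char_poly (mat n n A) = (\<Prod>a\<leftarrow>map e [0..<n]. [:- a, 1:])"
proof -
  define P where "P = mat n n (\<lambda>(i, j). f j i)"
  define D where "D = mat n n (\<lambda>(i, j). if i = j then e i else 0)"
  let ?A = "mat n n A"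
  have carr: "P \<in> carrier_mat n n" "D \<in> carrier_mat n n" "?A \<in> carrier_mat n n"
    "transpose_mat P \<in> carrier_mat n n" by (auto simp: P_def D_def)
  have tPP: "transpose_mat P * P = 1\<^sub>m n"
    unfolding P_def by (rule eigensystem_orthogonal_matrix[OF E])
  hence PtP: "P * transpose_mat P = 1\<^sub>m n" using mat_mult_left_right_inverse carr by blast
  have AP: "?A * P = P * D"
  proof (rule eq_matI)
    fix i j assume "i < dim_row (P * D)" "j < dim_col (P * D)"
    hence ij: "i < n" "j < n" by (auto simp: P_def D_def)
    have "(?A * P) $$ (i, j) = mv n A (f j) i"
      using ij by (simp add: P_def scalar_prod_def mv_def atLeast0LessThan)
    also have "\<dots> = f j i * e j" using E ij by (auto simp: eigensystem_def mult.commute)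
    also have "\<dots> = (\<Sum>k<n. f k i * (if k = j then e k else 0))" using ij by (simp add: if_distrib cong: if_cong)
    also have "\<dots> = (P * D) $$ (i, j)"
      using ij by (simp add: P_def D_def scalar_prod_def atLeast0LessThan)
    finally show "(?A * P) $$ (i, j) = (P * D) $$ (i, j)" .
  qed (auto simp: P_def D_def)
  have "?A = ?A * (P * transpose_mat P)" using carr PtP by (metis right_mult_one_mat)
  also have "\<dots> = P * D * transpose_mat P"
    using carr AP by (metis assoc_mult_mat)
  finally have "similar_mat ?A D"
    by (intro similar_matI[of _ _ P "transpose_mat P" n]) (use carr PtP tPP in auto)
  hence "char_poly ?A = char_poly D" by (rule char_poly_similar)
  also have "\<dots> = (\<Prod>a\<leftarrow>diag_mat D. [:- a, 1:])"
    by (rule char_poly_upper_triangular[OF carr(2)]) (auto simp: D_def)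
  also have "diag_mat D = map e [0..<n]" by (auto simp: diag_mat_def D_def)
  finally show ?thesis .
qed

text \<open>An eigensystem is already in decreasing order, so reversing it sorts the roots;
  \<open>e\<close> counts from 0 and \<open>eigval\<close> from 1.\<close>

lemma eigval_eigensystem:
  assumes E: "eigensystem n A n f e" and k: "k < n"
  shows "eigval (Suc k) (mat n n A) = e k"
proof -
  have nz: "(\<Prod>a\<leftarrow>xs. [:- a, 1:]) \<noteq> 0" for xs :: "real list"
    by (auto simp: prod_list_zero_iff)
  have "proots (\<Prod>a\<leftarrow>xs. [:- a, 1:]) = mset xs" for xs :: "real list"
    by (induction xs) (simp_all add: proots_mult[OF _ nz] proots_linear_factor del: mult_pCons_left)
  hence pr: "proots (char_poly (mat n n A)) = mset (map e [0..<n])"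
    unfolding char_poly_eigensystem[OF E] .
  have "sort (map e [0..<n]) = rev (map e [0..<n])"
  proof (rule properties_for_sort)
    show "sorted (rev (map e [0..<n]))"
      unfolding sorted_wrt_rev sorted_wrt_map
      by (rule sorted_wrt_mono_rel[OF _ sorted_wrt_upt[of 0 n]]) (use eigensystem_antimono[OF E] in auto)
  qed simp
  hence "rev (sorted_list_of_multiset (proots (char_poly (mat n n A)))) = map e [0..<n]"
    unfolding pr sorted_list_of_multiset_mset by simp
  thus ?thesis using k by (simp add: eigval_def)
qed

text \<open>Courant-Fischer from below: the span of the \<open>y j\<close> meets the orthogonal
  complement of the top \<open>r - 1\<close> eigenvectors, where the form is at most
  \<open>e (r - 1)\<close>. The hypothesis \<open>pos\<close> expresses the linear independence of
  the \<open>y j\<close>.\<close>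

lemma eigval_ge:
  assumes sym: "symf n A" and r: "0 < r" "r \<le> n"
    and pos: "\<And>x. \<exists>j<r. x j \<noteq> 0 \<Longrightarrow> 0 < ip n (lc r y x) (lc r y x)"
    and ge: "\<And>x. c * ip n (lc r y x) (lc r y x) \<le> ip n (lc r y x) (mv n A (lc r y x))"
  shows "c \<le> eigval r (mat n n A)"
proof -
  obtain f e where E: "eigensystem n A n f e" using eigensystem_exists[OF sym] by blast
  have "r - 1 < r" using r by simp
  then obtain x where x: "\<exists>j<r. x j \<noteq> 0" "\<And>i. i < r - 1 \<Longrightarrow> (\<Sum>j<r. ip n (f i) (y j) * x j) = 0"
    using underdetermined_nontrivial[of "r - 1" r "\<lambda>i j. ip n (f i) (y j)"] by metis
  let ?v = "lc r y x"
  have "c * ip n ?v ?v \<le> ip n ?v (mv n A ?v)" by (rule ge)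
  also have "\<dots> \<le> e (r - 1) * ip n ?v ?v"
  proof -
    have "\<forall>i<r - 1. ip n (f i) ?v = 0" using x(2) by (simp add: ip_lc_right mult.commute)
    moreover have "r - 1 < n" using r by simp
    ultimately show ?thesis using E unfolding eigensystem_def by blast
  qed
  finally have "c \<le> e (r - 1)" using pos[OF x(1)] by simp
  also have "e (r - 1) = eigval r (mat n n A)"
    using eigval_eigensystem[OF E, of "r - 1"] r by simp
  finally show ?thesis .
qed

lemma eigenvector_combinations:
  assumes E: "eigensystem n A n f e" and "r \<le> n"
  shows "ip n (lc r f x) (lc r f x) = (\<Sum>j<r. (x j)\<^sup>2)"
    and "ip n (lc r f x) (mv n A (lc r f x)) = (\<Sum>j<r. e j * (x j)\<^sup>2)"
    and "ip n (mv n A (lc r f x)) (mv n A (lc r f x)) = (\<Sum>j<r. (e j * x j)\<^sup>2)"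
proof -
  have *: "ip n (lc r f x) (lc r f x') = (\<Sum>j<r. x j * x' j)" for x x'
  proof -
    have f: "ip n (f i) (f j) = (if i = j then 1 else 0)" if "i < r" "j < r" for i j
      using E that \<open>r \<le> n\<close> by (simp add: eigensystem_def)
    have "(\<Sum>j<r. x j * ip n (f j) (f i)) = x i" if "i < r" for i
    proof -
      have "(\<Sum>j<r. x j * ip n (f j) (f i)) = (\<Sum>j<r. if i = j then x j else 0)"
        using that by (intro sum.cong) (auto simp: f)
      thus ?thesis using that by simp
    qed
    thus ?thesis unfolding ip_lc_left ip_lc_right by (simp add: mult.commute)
  qed
  have A: "mv n A (lc r f x) i = lc r f (\<lambda>j. e j * x j) i" if "i < n" for i
    unfolding mv_lc unfolding lc_def using E \<open>r \<le> n\<close> that by (auto simp: eigensystem_def mult_ac)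
  show "ip n (lc r f x) (lc r f x) = (\<Sum>j<r. (x j)\<^sup>2)"
    by (simp add: * power2_eq_square)
  have "ip n (lc r f x) (mv n A (lc r f x)) = ip n (lc r f x) (lc r f (\<lambda>j. e j * x j))"
    by (rule ip_cong) (auto simp: A)
  thus "ip n (lc r f x) (mv n A (lc r f x)) = (\<Sum>j<r. e j * (x j)\<^sup>2)"
    by (simp add: * power2_eq_square mult_ac)
  have "ip n (mv n A (lc r f x)) (mv n A (lc r f x)) = ip n (lc r f (\<lambda>j. e j * x j)) (lc r f (\<lambda>j. e j * x j))"
    by (rule ip_cong) (auto simp: A)
  thus "ip n (mv n A (lc r f x)) (mv n A (lc r f x)) = (\<Sum>j<r. (e j * x j)\<^sup>2)"
    by (simp add: * power2_eq_square mult_ac)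
qed

text \<open>Courant-Fischer from above: among the combinations of the top \<open>r + 1\<close>
  eigenvectors, where the form is at least \<open>e r\<close>, some nonzero one is orthogonal to all
  of the \<open>r\<close> vectors \<open>h j\<close>.\<close>

lemma eigval_Suc_le:
  assumes sym: "symf n A" and r: "r < n"
    and le: "\<And>v. (\<And>j. j < r \<Longrightarrow> ip n (h j) v = 0) \<Longrightarrow> ip n v (mv n A v) \<le> c * ip n v v"
  shows "eigval (Suc r) (mat n n A) \<le> c"
proof -
  obtain f e where E: "eigensystem n A n f e" using eigensystem_exists[OF sym] by blast
  obtain x where x: "\<exists>j<Suc r. x j \<noteq> 0" "\<And>i. i < r \<Longrightarrow> (\<Sum>j<Suc r. ip n (h i) (f j) * x j) = 0"
    using underdetermined_nontrivial[of r "Suc r" "\<lambda>i j. ip n (h i) (f j)"] by auto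
  let ?v = "lc (Suc r) f x"
  note comb = eigenvector_combinations[OF E, of "Suc r" x]
  have "e r * (\<Sum>j<Suc r. (x j)\<^sup>2) \<le> (\<Sum>j<Suc r. e j * (x j)\<^sup>2)"
    unfolding sum_distrib_left using eigensystem_antimono[OF E, of _ r] r
    by (intro sum_mono mult_right_mono) auto
  also have "\<dots> \<le> c * (\<Sum>j<Suc r. (x j)\<^sup>2)"
    using le[of ?v] x(2) r comb by (simp add: ip_lc_right mult.commute del: sum.lessThan_Suc)
  finally have "e r * (\<Sum>j<Suc r. (x j)\<^sup>2) \<le> c * (\<Sum>j<Suc r. (x j)\<^sup>2)" .
  moreover have "0 < (\<Sum>j<Suc r. (x j)\<^sup>2)"
    using x(1) by (intro sum_pos2[of _ "SOME j. j < Suc r \<and> x j \<noteq> 0"])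
      (metis (mono_tags, lifting) someI_ex lessThan_iff finite_lessThan zero_less_power2 zero_le_power2)+
  ultimately have "e r \<le> c" by simp
  thus ?thesis using eigval_eigensystem[OF E r] by simp
qed

text \<open>Weyl's inequality, with the top eigenvectors of \<open>B\<close> as constraints for
  \<open>A\<close>; it yields the continuity of eigenvalues, on which the measurability of the good
  event rests.\<close>

lemma eigval_le_perturbed:
  assumes sym: "symf n A" "symf n B" and r: "r < n"
    and le: "\<And>v. ip n v (mv n A v) \<le> ip n v (mv n B v) + c * ip n v v"
  shows "eigval (Suc r) (mat n n A) \<le> eigval (Suc r) (mat n n B) + c"
proof -
  obtain f e where E: "eigensystem n B n f e" using eigensystem_exists[OF sym(2)] by blast
  have "eigval (Suc r) (mat n n A) \<le> e r + c"
  proof (rule eigval_Suc_le[OF sym(1) r, of f])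
    fix v assume "\<And>j. j < r \<Longrightarrow> ip n (f j) v = 0"
    hence "ip n v (mv n B v) \<le> e r * ip n v v" using E r by (auto simp: eigensystem_def)
    thus "ip n v (mv n A v) \<le> (e r + c) * ip n v v" using le[of v] by (simp add: algebra_simps)
  qed
  thus ?thesis using eigval_eigensystem[OF E r] by simp
qed

subsection \<open>The operator norm\<close>

abbreviation fn :: "real vec \<Rightarrow> nat \<Rightarrow> real" where
  "fn v \<equiv> vec_index v"

lemma scalar_prod_eq_ip: "w \<in> carrier_vec n \<Longrightarrow> scalar_prod v w = ip n (fn v) (fn w)"
  by (simp add: scalar_prod_def ip_def atLeast0LessThan)

lemma mult_mat_vec_eq_mv:
  "A \<in> carrier_mat n n \<Longrightarrow> v \<in> carrier_vec n \<Longrightarrow> i < n \<Longrightarrow> vec_index (A *\<^sub>v v) i = mv n (index_mat A) (fn v) i"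
  by (simp add: scalar_prod_def mv_def atLeast0LessThan)

lemma ip_vec [simp]: "ip n (fn (vec n u)) (fn (vec n v)) = ip n u v"
  by (rule ip_cong) auto

lemma mat_index_mat: "A \<in> carrier_mat n n \<Longrightarrow> mat n n (index_mat A) = A"
  by (auto intro!: eq_matI)

lemma index_mat_mult:
  fixes A B :: "real mat"
  assumes "A \<in> carrier_mat n n" "B \<in> carrier_mat n n" "i < n"
  shows "mv n (index_mat (A * B)) v i = mv n (index_mat A) (mv n (index_mat B) v) i"
proof -
  have "mv n (index_mat (A * B)) v i = (\<Sum>j<n. \<Sum>k<n. index_mat A (i, k) * index_mat B (k, j) * v j)"
    using assms by (simp add: mv_def scalar_prod_def atLeast0LessThan sum_distrib_right)
  also have "\<dots> = (\<Sum>k<n. \<Sum>j<n. index_mat A (i, k) * index_mat B (k, j) * v j)" by (rule sum.swap)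
  finally show ?thesis by (simp add: mv_def sum_distrib_left mult.assoc)
qed

lemma symmetric_mats_iff_symf:
  "A \<in> symmetric_mats n \<longleftrightarrow> A \<in> carrier_mat n n \<and> symf n (index_mat A)"
  unfolding symmetric_mats_def symf_def
  by (auto simp: mat_eq_iff)

text \<open>The supremum in \<open>op_norm\<close> is informative only over a bounded set; the
  Frobenius norm is a crude bound.\<close>

lemma op_norm_bdd_above:
  fixes A :: "real mat"
  assumes A: "A \<in> carrier_mat n n"
  shows "bdd_above ((\<lambda>v. sqrt (scalar_prod (A *\<^sub>v v) (A *\<^sub>v v))) `
    {v \<in> carrier_vec (dim_col A). scalar_prod v v \<le> (1 :: real)})"
proof (rule bdd_aboveI2)
  fix v :: "real vec" assume v: "v \<in> {v \<in> carrier_vec (dim_col A). scalar_prod v v \<le> (1 :: real)}"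
  hence vc: "v \<in> carrier_vec n" and v1: "ip n (fn v) (fn v) \<le> 1" using A by (auto simp: scalar_prod_eq_ip)
  have "scalar_prod (A *\<^sub>v v) (A *\<^sub>v v) = (\<Sum>i<n. (mv n (index_mat A) (fn v) i)\<^sup>2)"
    using A vc by (subst scalar_prod_eq_ip[of _ n]) (auto simp: ip_def mult_mat_vec_eq_mv power2_eq_square simp del: index_mult_mat_vec)
  also have "\<dots> \<le> (\<Sum>i<n. \<Sum>j<n. (index_mat A (i, j))\<^sup>2)"
  proof (rule sum_mono)
    fix i
    have "(mv n (index_mat A) (fn v) i)\<^sup>2 = (ip n (\<lambda>j. index_mat A (i, j)) (fn v))\<^sup>2"
      by (simp add: mv_def ip_def)
    also have "\<dots> \<le> ip n (\<lambda>j. index_mat A (i, j)) (\<lambda>j. index_mat A (i, j)) * ip n (fn v) (fn v)"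
      by (rule ip_cauchy_schwarz)
    also have "\<dots> \<le> ip n (\<lambda>j. index_mat A (i, j)) (\<lambda>j. index_mat A (i, j))"
      using v1 ip_self_nonneg by (intro mult_left_le) auto
    finally show "(mv n (index_mat A) (fn v) i)\<^sup>2 \<le> (\<Sum>j<n. (index_mat A (i, j))\<^sup>2)"
      by (simp add: ip_def power2_eq_square)
  qed
  finally show "sqrt (scalar_prod (A *\<^sub>v v) (A *\<^sub>v v)) \<le> sqrt (\<Sum>i<n. \<Sum>j<n. (index_mat A (i, j))\<^sup>2)"
    by simp
qed

lemma op_norm_nonneg:
  fixes A :: "real mat"
  assumes A: "A \<in> carrier_mat n n"
  shows "0 \<le> op_norm A"
proof -
  have "sqrt (scalar_prod (A *\<^sub>v 0\<^sub>v n) (A *\<^sub>v 0\<^sub>v n)) \<le> op_norm A"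
    unfolding op_norm_def using A
    by (intro cSUP_upper op_norm_bdd_above[OF A]) auto
  moreover have "0 \<le> scalar_prod (A *\<^sub>v 0\<^sub>v n) (A *\<^sub>v 0\<^sub>v n)"
    using A by (subst scalar_prod_eq_ip[of _ n]) (auto simp: ip_self_nonneg simp del: index_mult_mat_vec)
  ultimately show ?thesis by (meson order_trans real_sqrt_ge_zero)
qed

lemma ip_mv_le_op_norm:
  fixes A :: "real mat"
  assumes A: "A \<in> carrier_mat n n"
  shows "ip n (mv n (index_mat A) v) (mv n (index_mat A) v) \<le> (op_norm A)\<^sup>2 * ip n v v"
proof (cases "0 < ip n v v")
  case False
  hence 0: "\<forall>i<n. v i = 0" using ip_self_pos_iff by blast
  hence "ip n (mv n (index_mat A) v) (mv n (index_mat A) v) = 0" by (simp add: ip_def mv_def)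
  thus ?thesis using ip_self_nonneg[of n v] by simp
next
  case True
  define c where "c = 1 / sqrt (ip n v v)"
  define w where "w = vec n (\<lambda>i. c * v i)"
  have w: "w \<in> carrier_vec n" by (simp add: w_def)
  have c2: "c * (c * ip n v v) = 1" using True by (simp add: c_def)
  have "scalar_prod w w = ip n (\<lambda>i. c * v i) (\<lambda>i. c * v i)"
    unfolding scalar_prod_eq_ip[OF w] by (simp add: w_def)
  hence w1: "scalar_prod w w = 1" unfolding ip_scale_left ip_scale_right c2 .
  have Aw: "scalar_prod (A *\<^sub>v w) (A *\<^sub>v w) = c * (c * ip n (mv n (index_mat A) v) (mv n (index_mat A) v))"
  proof -
    have "scalar_prod (A *\<^sub>v w) (A *\<^sub>v w) = ip n (fn (A *\<^sub>v w)) (fn (A *\<^sub>v w))"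
      by (rule scalar_prod_eq_ip) (use A w in auto)
    also have "\<dots> = ip n (mv n (index_mat A) (\<lambda>i. c * v i)) (mv n (index_mat A) (\<lambda>i. c * v i))"
    proof (rule ip_cong)
      show "fn (A *\<^sub>v w) i = mv n (index_mat A) (\<lambda>i. c * v i) i" if "i < n" for i
        unfolding mult_mat_vec_eq_mv[OF A w that] by (rule mv_cong) (auto simp: w_def)
      thus "fn (A *\<^sub>v w) i = mv n (index_mat A) (\<lambda>i. c * v i) i" if "i < n" for i using that .
    qed
    finally show ?thesis unfolding mv_scale ip_scale_left ip_scale_right .
  qed
  have "sqrt (scalar_prod (A *\<^sub>v w) (A *\<^sub>v w)) \<le> op_norm A"
    unfolding op_norm_def using A w w1 by (intro cSUP_upper op_norm_bdd_above[OF A]) auto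
  hence "scalar_prod (A *\<^sub>v w) (A *\<^sub>v w) \<le> (op_norm A)\<^sup>2" by (rule sqrt_le_D)
  hence "c * (c * ip n (mv n (index_mat A) v) (mv n (index_mat A) v)) * ip n v v \<le> (op_norm A)\<^sup>2 * ip n v v"
    unfolding Aw using ip_self_nonneg by (rule mult_right_mono)
  moreover have "c * (c * ip n (mv n (index_mat A) v) (mv n (index_mat A) v)) * ip n v v =
      c * (c * ip n v v) * ip n (mv n (index_mat A) v) (mv n (index_mat A) v)" by (simp add: mult_ac)
  ultimately show ?thesis unfolding c2 by simp
qed

lemma op_norm_le:
  fixes A :: "real mat"
  assumes A: "A \<in> carrier_mat n n" and "0 \<le> c"
    and le: "\<And>v. ip n (mv n (index_mat A) v) (mv n (index_mat A) v) \<le> c\<^sup>2 * ip n v v"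
  shows "op_norm A \<le> c"
  unfolding op_norm_def
proof (rule cSUP_least)
  show "{v \<in> carrier_vec (dim_col A). scalar_prod v v \<le> (1 :: real)} \<noteq> {}"
    using A by (auto intro!: exI[of _ "0\<^sub>v n"])
next
  fix v :: "real vec" assume "v \<in> {v \<in> carrier_vec (dim_col A). scalar_prod v v \<le> (1 :: real)}"
  hence v: "v \<in> carrier_vec n" and v1: "ip n (fn v) (fn v) \<le> 1" using A by (auto simp: scalar_prod_eq_ip)
  have "scalar_prod (A *\<^sub>v v) (A *\<^sub>v v) = ip n (fn (A *\<^sub>v v)) (fn (A *\<^sub>v v))"
    by (rule scalar_prod_eq_ip) (use A v in auto)
  also have "\<dots> = ip n (mv n (index_mat A) (fn v)) (mv n (index_mat A) (fn v))"
    by (rule ip_cong; rule mult_mat_vec_eq_mv[OF A v])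
  also have "\<dots> \<le> c\<^sup>2 * ip n (fn v) (fn v)" by (rule le)
  also have "\<dots> \<le> c\<^sup>2" using v1 by (intro mult_left_le) auto
  finally show "sqrt (scalar_prod (A *\<^sub>v v) (A *\<^sub>v v)) \<le> c"
    using \<open>0 \<le> c\<close> by (simp add: real_le_lsqrt)
qed

subsection \<open>Square roots, singular values and the relative gap\<close>

text \<open>A square matrix with orthonormal columns has orthonormal rows, since a left inverse is
  also a right inverse. This gives the expansion of every vector in the eigenbasis.\<close>

lemma eigensystem_complete:
  assumes E: "eigensystem n A n f e" and "i < n" "j < n"
  shows "(\<Sum>k<n. f k i * f k j) = (if i = j then 1 else 0)"
proof -
  define P where "P = mat n n (\<lambda>(i, j). f j i)"
  have P: "P \<in> carrier_mat n n" "transpose_mat P \<in> carrier_mat n n" by (auto simp: P_def)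
  have "transpose_mat P * P = 1\<^sub>m n"
    unfolding P_def by (rule eigensystem_orthogonal_matrix[OF E])
  hence "P * transpose_mat P = 1\<^sub>m n" using mat_mult_left_right_inverse P by blast
  moreover have "(P * transpose_mat P) $$ (i, j) = (\<Sum>k<n. f k i * f k j)"
    using assms(2,3) by (simp add: P_def scalar_prod_def atLeast0LessThan)
  ultimately show ?thesis using assms(2,3) by simp
qed

lemma matrix_eq_on_eigensystem:
  assumes E: "eigensystem n A n f e"
    and eq: "\<And>k i. k < n \<Longrightarrow> i < n \<Longrightarrow> mv n X (f k) i = mv n Y (f k) i"
    and ij: "i < n" "j < n"
  shows "X (i, j) = Y (i, j)"
proof -
  have *: "Z (i, j) = (\<Sum>k<n. mv n Z (f k) i * f k j)" for Z
  proof -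
    have "Z (i, j) = (\<Sum>l<n. if l = j then Z (i, l) else 0)" using ij by simp
    also have "\<dots> = (\<Sum>l<n. Z (i, l) * (\<Sum>k<n. f k l * f k j))"
      using ij by (intro sum.cong) (auto simp: eigensystem_complete[OF E])
    also have "\<dots> = (\<Sum>l<n. \<Sum>k<n. Z (i, l) * f k l * f k j)" by (simp add: sum_distrib_left mult.assoc)
    also have "\<dots> = (\<Sum>k<n. \<Sum>l<n. Z (i, l) * f k l * f k j)" by (rule sum.swap)
    finally show ?thesis by (simp add: mv_def sum_distrib_right)
  qed
  show ?thesis unfolding *[of X] *[of Y] using eq ij by simp
qed

text \<open>Let \<open>f\<close> be an eigenvector of \<open>B\<close> with eigenvalue
  \<open>e\<close>. As C^2 f = e^2 f, the vector w = C f - e f satisfies C w = - e w. For e > 0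
  positivity of \<open>C\<close> forces w = 0, and for e = 0 this follows from |C f|^2 = f^T C^2 f =
  0. So \<open>B\<close> and \<open>C\<close> agree on an eigenbasis.\<close>

lemma psd_square_root_unique:
  assumes B: "symf n B" "\<And>v. 0 \<le> ip n v (mv n B v)"
    and C: "symf n C" "\<And>v. 0 \<le> ip n v (mv n C v)"
    and sq: "\<And>v i. i < n \<Longrightarrow> mv n B (mv n B v) i = mv n C (mv n C v) i"
    and ij: "i < n" "j < n"
  shows "B (i, j) = C (i, j)"
proof -
  obtain f e where E: "eigensystem n B n f e" using eigensystem_exists[OF B(1)] by blast
  have "mv n C (f k) i = e k * f k i" if k: "k < n" and i: "i < n" for k i
  proof -
    have Bf: "mv n B (f k) i = e k * f k i" if "i < n" for i using E k that by (simp add: eigensystem_def)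
    have ff: "ip n (f k) (f k) = 1" using E k by (simp add: eigensystem_def)
    have "ip n (f k) (mv n B (f k)) = ip n (f k) (\<lambda>i. e k * f k i)" using Bf by (intro ip_cong) auto
    also have "\<dots> = e k" by (simp add: ip_scale_right ff)
    finally have e0: "0 \<le> e k" using B(2)[of "f k"] by simp
    have CC: "mv n C (mv n C (f k)) i = e k * (e k * f k i)" if "i < n" for i
    proof -
      have "mv n C (mv n C (f k)) i = mv n B (mv n B (f k)) i" using sq[OF that] by simp
      also have "\<dots> = mv n B (\<lambda>i. e k * f k i) i" using Bf by (intro mv_cong) auto
      also have "\<dots> = e k * (e k * f k i)" using Bf[OF that] by (simp add: mv_scale)
      finally show ?thesis .
    qed
    define w where "w = (\<lambda>i. 1 * mv n C (f k) i + (- e k) * f k i)"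
    have Cw: "mv n C w i = - e k * w i" if "i < n" for i
      unfolding w_def mv_comb using CC[OF that] by (simp add: algebra_simps)
    have "ip n w w = 0"
    proof (cases "e k = 0")
      case True
      have "ip n w w = ip n (mv n C (f k)) (mv n C (f k))" by (simp add: w_def True)
      also have "\<dots> = ip n (f k) (mv n C (mv n C (f k)))" by (rule ip_mv_sym[OF C(1), symmetric])
      also have "\<dots> = ip n (f k) (\<lambda>_. 0)" using CC True by (intro ip_cong) auto
      finally show ?thesis by (simp add: ip_def)
    next
      case False
      have "ip n w (mv n C w) = ip n w (\<lambda>i. (- e k) * w i)" using Cw by (intro ip_cong) auto
      hence "0 \<le> - e k * ip n w w" using C(2)[of w] unfolding ip_scale_right by simp
      moreover have "0 < e k" using False e0 by simp
      ultimately have "ip n w w \<le> 0" by (simp add: mult_le_0_iff)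
      thus ?thesis using ip_self_nonneg[of n w] by simp
    qed
    hence "w i = 0" using i unfolding ip_self_eq_0_iff by blast
    thus ?thesis by (simp add: w_def)
  qed
  moreover have "mv n B (f k) i = e k * f k i" if "k < n" "i < n" for k i
    using E that by (simp add: eigensystem_def)
  ultimately show ?thesis using matrix_eq_on_eigensystem[OF E _ ij, of B C] by simp
qed

lemma psd_mats_iff:
  "A \<in> psd_mats n \<longleftrightarrow> A \<in> carrier_mat n n \<and> symf n (index_mat A) \<and> (\<forall>v. 0 \<le> ip n v (mv n (index_mat A) v))"
proof -
  have *: "scalar_prod v (A *\<^sub>v v) = ip n (fn v) (mv n (index_mat A) (fn v))"
    if "A \<in> carrier_mat n n" "v \<in> carrier_vec n" for v
  proof -
    have "scalar_prod v (A *\<^sub>v v) = ip n (fn v) (fn (A *\<^sub>v v))"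
      by (rule scalar_prod_eq_ip) (use that in auto)
    also have "\<dots> = ip n (fn v) (mv n (index_mat A) (fn v))"
      by (rule ip_cong) (auto simp: mult_mat_vec_eq_mv[OF that] simp del: index_mult_mat_vec)
    finally show ?thesis .
  qed
  have "(\<forall>v\<in>carrier_vec n. 0 \<le> scalar_prod v (A *\<^sub>v v)) \<longleftrightarrow> (\<forall>v. 0 \<le> ip n v (mv n (index_mat A) v))"
    if A: "A \<in> carrier_mat n n"
  proof
    assume pos: "\<forall>v\<in>carrier_vec n. 0 \<le> scalar_prod v (A *\<^sub>v v)"
    show "\<forall>v. 0 \<le> ip n v (mv n (index_mat A) v)"
    proof
      fix v
      have "0 \<le> ip n (fn (vec n v)) (mv n (index_mat A) (fn (vec n v)))"
        using bspec[OF pos vec_carrier, of v] unfolding *[OF A vec_carrier] .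
      also have "\<dots> = ip n v (mv n (index_mat A) v)" by (intro ip_cong mv_cong) auto
      finally show "0 \<le> ip n v (mv n (index_mat A) v)" .
    qed
  qed (use *[OF A] in auto)
  thus ?thesis by (auto simp: psd_mats_def symmetric_mats_iff_symf)
qed

lemma square_eigval_form:
  assumes M: "M \<in> symmetric_mats n"
  shows "M * M \<in> carrier_mat n n" "symf n (index_mat (M * M))"
    "ip n v (mv n (index_mat (M * M)) v) = ip n (mv n (index_mat M) v) (mv n (index_mat M) v)"
proof -
  have c: "M \<in> carrier_mat n n" and s: "symf n (index_mat M)" and t: "transpose_mat M = M"
    using M by (auto simp: symmetric_mats_iff_symf) (use M in \<open>simp add: symmetric_mats_def\<close>)
  show MM: "M * M \<in> carrier_mat n n" using c by simp
  have "transpose_mat (M * M) = M * M" using transpose_mult[OF c c] t by simp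
  hence "M * M \<in> symmetric_mats n" using MM by (simp add: symmetric_mats_def)
  thus "symf n (index_mat (M * M))" by (simp add: symmetric_mats_iff_symf)
  have "ip n v (mv n (index_mat (M * M)) v) = ip n v (mv n (index_mat M) (mv n (index_mat M) v))"
    by (rule ip_cong) (auto simp: index_mat_mult[OF c c])
  also have "\<dots> = ip n (mv n (index_mat M) v) (mv n (index_mat M) v)" by (rule ip_mv_sym[OF s])
  finally show "ip n v (mv n (index_mat (M * M)) v) = ip n (mv n (index_mat M) v) (mv n (index_mat M) v)" .
qed

text \<open>The definite description in \<open>psd_sqrt\<close> needs existence and uniqueness. The
  witness flips the signs of the negative eigenvalues in the spectral decomposition of
  \<open>M\<close>.\<close>

lemma mat_abs_square:
  assumes M: "M \<in> symmetric_mats n"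
  shows "mat_abs M \<in> carrier_mat n n" "mat_abs M * mat_abs M = M * M"
proof -
  let ?I = index_mat
  have c: "M \<in> carrier_mat n n" and s: "symf n (?I M)" using M by (auto simp: symmetric_mats_iff_symf)
  obtain f e where E: "eigensystem n (?I M) n f e" using eigensystem_exists[OF s] by blast
  have ff: "ip n (f i) (f j) = (if i = j then 1 else 0)" if "i < n" "j < n" for i j
    using E that by (simp add: eigensystem_def)
  have Mf: "mv n (?I M) (f k) i = e k * f k i" if "k < n" "i < n" for k i
    using E that by (simp add: eigensystem_def)
  define B where "B = mat n n (\<lambda>(i, j). \<Sum>k<n. \<bar>e k\<bar> * f k i * f k j)"
  have B: "B \<in> carrier_mat n n" by (simp add: B_def)
  have Bv: "mv n (?I B) v i = lc n f (\<lambda>k. \<bar>e k\<bar> * ip n (f k) v) i" if "i < n" for v i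
  proof -
    have "mv n (?I B) v i = (\<Sum>j<n. \<Sum>k<n. \<bar>e k\<bar> * f k i * f k j * v j)"
      using that by (simp add: mv_def B_def sum_distrib_right)
    also have "\<dots> = (\<Sum>k<n. \<Sum>j<n. \<bar>e k\<bar> * f k i * f k j * v j)" by (rule sum.swap)
    finally show ?thesis by (simp add: lc_def ip_def sum_distrib_left sum_distrib_right mult_ac)
  qed
  have Bf: "mv n (?I B) (f k) i = \<bar>e k\<bar> * f k i" if "k < n" "i < n" for k i
  proof -
    have "mv n (?I B) (f k) i = (\<Sum>l<n. if l = k then \<bar>e k\<bar> * f k i else 0)"
      unfolding Bv[OF that(2)] lc_def using that by (intro sum.cong) (auto simp: ff)
    thus ?thesis using that by simp
  qed
  have symB: "symf n (?I B)" by (auto simp: symf_def B_def mult_ac)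
  have "0 \<le> ip n v (mv n (?I B) v)" for v
  proof -
    have "ip n v (mv n (?I B) v) = ip n v (lc n f (\<lambda>k. \<bar>e k\<bar> * ip n (f k) v))"
      by (rule ip_cong) (auto simp: Bv)
    also have "\<dots> = (\<Sum>k<n. \<bar>e k\<bar> * (ip n (f k) v)\<^sup>2)"
      by (simp add: ip_lc_right ip_commute[of n v] power2_eq_square mult_ac)
    finally show ?thesis by (simp add: sum_nonneg)
  qed
  hence Bpsd: "B \<in> psd_mats n" using B symB by (simp add: psd_mats_iff)
  have BB: "B * B = M * M"
  proof (rule eq_matI)
    fix i j assume "i < dim_row (M * M)" "j < dim_col (M * M)"
    hence ij: "i < n" "j < n" using c by auto
    have "mv n (?I (B * B)) (f k) i = mv n (?I (M * M)) (f k) i" if k: "k < n" and i: "i < n" for k i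
    proof -
      have "mv n (?I (B * B)) (f k) i = mv n (?I B) (\<lambda>i. \<bar>e k\<bar> * f k i) i"
        unfolding index_mat_mult[OF B B i] by (rule mv_cong) (auto simp: Bf k)
      moreover have "mv n (?I (M * M)) (f k) i = mv n (?I M) (\<lambda>i. e k * f k i) i"
        unfolding index_mat_mult[OF c c i] by (rule mv_cong) (auto simp: Mf k)
      ultimately show ?thesis by (simp add: mv_scale Bf Mf k i)
    qed
    thus "(B * B) $$ (i, j) = (M * M) $$ (i, j)" by (rule matrix_eq_on_eigensystem[OF E _ ij])
  qed (use B c in auto)
  have "mat_abs M = B"
    unfolding mat_abs_def psd_sqrt_def
  proof (rule the_equality)
    show "B \<in> psd_mats (dim_row (M * M)) \<and> B * B = M * M" using Bpsd BB c by simp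
    fix C assume "C \<in> psd_mats (dim_row (M * M)) \<and> C * C = M * M"
    hence C: "C \<in> psd_mats n" "C * C = M * M" using c by auto
    hence C': "C \<in> carrier_mat n n" "symf n (?I C)" "\<And>v. 0 \<le> ip n v (mv n (?I C) v)"
      by (auto simp: psd_mats_iff)
    have B': "symf n (?I B)" "\<And>v. 0 \<le> ip n v (mv n (?I B) v)" using Bpsd by (auto simp: psd_mats_iff)
    have sq: "mv n (?I C) (mv n (?I C) v) i = mv n (?I B) (mv n (?I B) v) i" if "i < n" for v i
      unfolding index_mat_mult[OF C'(1) C'(1) that, symmetric] index_mat_mult[OF B B that, symmetric] C(2) BB ..
    show "C = B"
    proof (rule eq_matI)
      fix i j assume "i < dim_row B" "j < dim_col B"
      thus "C $$ (i, j) = B $$ (i, j)"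
        using psd_square_root_unique[OF C'(2,3) B' sq] B by auto
    qed (use B C' in auto)
  qed
  thus "mat_abs M \<in> carrier_mat n n" "mat_abs M * mat_abs M = M * M" using B BB by auto
qed

text \<open>Singular values depend only on the square and the dimension of a matrix, which
  \<open>M\<close> and \<open>mat_abs M\<close> share.\<close>

lemma gap_mat_abs:
  assumes "M \<in> symmetric_mats n"
  shows "gap r (mat_abs M) = gap r M"
proof -
  have "M \<in> carrier_mat n n" using assms by (simp add: symmetric_mats_def)
  thus ?thesis using mat_abs_square[OF assms] by (simp add: gap_def singval_def)
qed

text \<open>The top \<open>r\<close> eigenvalues are at least \<open>eigval r M\<close>, which is
  nonnegative, so on the span of their eigenvectors the form of M^2 is at least its square. Very
  negative eigenvalues can only enlarge the singular value, hence an inequality.\<close>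

lemma eigval_le_singval:
  assumes M: "M \<in> symmetric_mats n" and r: "0 < r" "r \<le> n" and pos: "0 \<le> eigval r M"
  shows "eigval r M \<le> singval r M"
proof -
  have c: "M \<in> carrier_mat n n" and s: "symf n (index_mat M)" using M by (auto simp: symmetric_mats_iff_symf)
  obtain f e where E: "eigensystem n (index_mat M) n f e" using eigensystem_exists[OF s] by blast
  have er: "eigval r M = e (r - 1)"
    using eigval_eigensystem[OF E, of "r - 1"] r by (simp add: mat_index_mat[OF c])
  note comb = eigenvector_combinations[OF E r(2)]
  have "(eigval r M)\<^sup>2 \<le> eigval r (mat n n (index_mat (M * M)))"
  proof (rule eigval_ge[OF square_eigval_form(2)[OF M] r, where y = f])
    fix x :: "nat \<Rightarrow> real" assume "\<exists>j<r. x j \<noteq> 0"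
    then obtain j where "j < r" "x j \<noteq> 0" by blast
    thus "0 < ip n (lc r f x) (lc r f x)" unfolding comb(1) by (intro sum_pos2[of _ j]) auto
  next
    fix x :: "nat \<Rightarrow> real"
    have "(eigval r M)\<^sup>2 * (x j)\<^sup>2 \<le> (e j * x j)\<^sup>2" if "j < r" for j
    proof -
      have "eigval r M \<le> e j" unfolding er using that r by (intro eigensystem_antimono[OF E]) auto
      hence "(eigval r M)\<^sup>2 \<le> (e j)\<^sup>2" using pos by (rule power_mono)
      thus ?thesis by (simp add: power_mult_distrib mult_right_mono)
    qed
    thus "(eigval r M)\<^sup>2 * ip n (lc r f x) (lc r f x)
        \<le> ip n (lc r f x) (mv n (index_mat (M * M)) (lc r f x))"
      unfolding square_eigval_form(3)[OF M] comb sum_distrib_left by (intro sum_mono) auto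
  qed
  hence "(eigval r M)\<^sup>2 \<le> eigval r (M * M)" using mat_index_mat[OF square_eigval_form(1)[OF M]] by simp
  thus ?thesis using c r pos by (simp add: singval_def real_le_rsqrt)
qed

section \<open>The spiked matrix and its relative gap\<close>

lemma spiked_mat_carrier:
  assumes "W \<in> carrier_mat n n" "U \<in> carrier_mat n r"
  shows "spiked_mat l W U \<in> carrier_mat n n"
  using assms by (simp add: spiked_mat_def)

lemma spiked_mat_index:
  assumes "W \<in> carrier_mat n n" "U \<in> carrier_mat n r" "i < n" "j < n"
  shows "spiked_mat l W U $$ (i, j) = W $$ (i, j) + l * (\<Sum>k<r. U $$ (i, k) * U $$ (j, k))"
  using assms by (simp add: spiked_mat_def scalar_prod_def atLeast0LessThan)

lemma spiked_mat_symmetric: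
  assumes "W \<in> symmetric_mats n" "U \<in> carrier_mat n r"
  shows "spiked_mat l W U \<in> symmetric_mats n"
proof -
  have W: "W \<in> carrier_mat n n" "symf n (index_mat W)" using assms by (auto simp: symmetric_mats_iff_symf)
  show ?thesis unfolding symmetric_mats_iff_symf symf_def
    using spiked_mat_carrier[OF W(1) assms(2)] W(2)
    by (auto simp: spiked_mat_index[OF W(1) assms(2)] symf_def mult.commute)
qed

lemma spiked_mat_mv:
  assumes "W \<in> carrier_mat n n" "U \<in> carrier_mat n r" "i < n"
  shows "mv n (index_mat (spiked_mat l W U)) v i =
    mv n (index_mat W) v i + l * lc r (\<lambda>k i. U $$ (i, k)) (\<lambda>k. ip n (\<lambda>i. U $$ (i, k)) v) i"
proof -
  have "mv n (index_mat (spiked_mat l W U)) v i =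
      mv n (index_mat W) v i + l * (\<Sum>j<n. \<Sum>k<r. U $$ (i, k) * U $$ (j, k) * v j)"
    using assms(3) by (simp add: mv_def spiked_mat_index[OF assms(1,2)] sum.distrib
        distrib_right sum_distrib_left sum_distrib_right mult.assoc)
  also have "(\<Sum>j<n. \<Sum>k<r. U $$ (i, k) * U $$ (j, k) * v j) =
      (\<Sum>k<r. \<Sum>j<n. U $$ (i, k) * U $$ (j, k) * v j)" by (rule sum.swap)
  finally show ?thesis by (simp add: lc_def ip_def sum_distrib_left mult_ac)
qed

text \<open>On the orthogonal complement of the columns of \<open>U\<close> the spiked matrix acts
  as \<open>W\<close>, and this subspace has codimension at most \<open>r\<close>. If
  \<open>r \<ge> n\<close>, the index is beyond the dimension and the singular value is 0 by
  convention.\<close>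

lemma singval_Suc_spiked_le:
  assumes W: "W \<in> symmetric_mats n" and U: "U \<in> carrier_mat n r"
  shows "singval (Suc r) (spiked_mat l W U) \<le> op_norm W"
proof (cases "r < n")
  case False
  thus ?thesis using W spiked_mat_carrier[of W n U r l] U op_norm_nonneg[of W n]
    by (simp add: singval_def symmetric_mats_def)
next
  case True
  let ?M = "spiked_mat l W U"
  have Wc: "W \<in> carrier_mat n n" using W by (simp add: symmetric_mats_def)
  have M: "?M \<in> symmetric_mats n" by (rule spiked_mat_symmetric[OF W U])
  have "eigval (Suc r) (mat n n (index_mat (?M * ?M))) \<le> (op_norm W)\<^sup>2"
  proof (rule eigval_Suc_le[OF square_eigval_form(2)[OF M] True, where h = "\<lambda>k i. U $$ (i, k)"])
    fix v assume v: "\<And>j. j < r \<Longrightarrow> ip n (\<lambda>i. U $$ (i, j)) v = 0"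
    have Mv: "mv n (index_mat ?M) v i = mv n (index_mat W) v i" if "i < n" for i
      using v by (simp add: spiked_mat_mv[OF Wc U that] lc_def)
    have "ip n v (mv n (index_mat (?M * ?M)) v) = ip n (mv n (index_mat W) v) (mv n (index_mat W) v)"
      unfolding square_eigval_form(3)[OF M] by (rule ip_cong) (auto simp: Mv)
    also have "\<dots> \<le> (op_norm W)\<^sup>2 * ip n v v" by (rule ip_mv_le_op_norm[OF Wc])
    finally show "ip n v (mv n (index_mat (?M * ?M)) v) \<le> (op_norm W)\<^sup>2 * ip n v v" .
  qed
  hence "sqrt (eigval (Suc r) (?M * ?M)) \<le> op_norm W"
    using mat_index_mat[OF square_eigval_form(1)[OF M]] op_norm_nonneg[OF Wc]
    by (simp add: real_le_lsqrt)
  thus ?thesis using True spiked_mat_carrier[OF Wc U, of l] by (simp add: singval_def)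
qed

text \<open>The spike is the larger root of t^2 - 2 t / (1 - g) + 1, whose roots have product 1 and
  sum 2 / (1 - g).\<close>

lemma spike_quadratic:
  assumes "0 < g" "g < 1"
  shows "1 < spike g" "spike g + inverse (spike g) = 2 / (1 - g)"
proof -
  let ?s = "sqrt (g * (2 - g))" and ?l = "spike g"
  have s2: "?s\<^sup>2 = g * (2 - g)" using assms by simp
  have s0: "0 < ?s" using assms by simp
  have "1 - g < 1 + ?s" using assms s0 by linarith
  thus l1: "1 < ?l" using assms by (simp add: spike_def field_simps)
  have l: "?l * (1 - g) = 1 + ?s" using assms by (simp add: spike_def)
  have "(?l\<^sup>2 + 1) * (1 - g)\<^sup>2 = (?l * (1 - g))\<^sup>2 + (1 - g)\<^sup>2" by (simp only: power_mult_distrib distrib_right mult_1)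
  also have "\<dots> = 2 * (?l * (1 - g))" unfolding l using s2 by (simp add: power2_eq_square algebra_simps)
  finally have "(?l\<^sup>2 + 1) * (1 - g) = 2 * ?l" using assms by (simp add: power2_eq_square)
  hence "(?l\<^sup>2 + 1) / ?l = 2 / (1 - g)" using assms l1 by (simp add: frac_eq_eq)
  moreover have "?l + inverse ?l = (?l\<^sup>2 + 1) / ?l" using l1 by (simp add: field_simps power2_eq_square)
  ultimately show "?l + inverse ?l = 2 / (1 - g)" by simp
qed

lemma spike_identities:
  assumes "0 < g" "g < 1"
  shows "g = (spike g + inverse (spike g) - 2) / (spike g + inverse (spike g))"
    and "g = (spike g - 1)\<^sup>2 / ((spike g)\<^sup>2 + 1)"
proof -
  note sq = spike_quadratic[OF assms]
  show 1: "g = (spike g + inverse (spike g) - 2) / (spike g + inverse (spike g))"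
    unfolding sq(2) using assms by (simp add: field_simps)
  have "(spike g + inverse (spike g) - 2) / (spike g + inverse (spike g)) =
      (spike g * (spike g + inverse (spike g) - 2)) / (spike g * (spike g + inverse (spike g)))"
    using sq(1) by simp
  also have "spike g * (spike g + inverse (spike g) - 2) = (spike g - 1)\<^sup>2"
    using sq(1) by (simp add: power2_eq_square algebra_simps)
  also have "spike g * (spike g + inverse (spike g)) = (spike g)\<^sup>2 + 1"
    using sq(1) by (simp add: power2_eq_square algebra_simps)
  finally show "g = (spike g - 1)\<^sup>2 / ((spike g)\<^sup>2 + 1)" using 1 by simp
qed

text \<open>With z = l + 1/l the quotient (z - 2) / z is exactly \<open>g\<close>. The gap 1 -
  sigma_{r+1} / sigma_r is at least 1 - |W| / lambda_r, hence at least (1 - \<gamma>) (z - 2) /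
  lambda_r, and lambda_r \<le> lambda_1 \<le> (1 + \<gamma>) z.\<close>

lemma gap_on_good_event:
  assumes g: "0 < g" "g < 1" and \<gamma>: "0 < \<gamma>" "\<gamma> < 1" and r: "1 \<le> r" "r \<le> d"
    and good: "(W, U) \<in> good_event d r g \<gamma>"
  shows "gap r (spiked_mat (spike g) W U) = gap r (mat_abs (spiked_mat (spike g) W U))"
    and "(1 - \<gamma>) / (1 + \<gamma>) * g \<le> gap r (spiked_mat (spike g) W U)"
proof -
  define M where "M = spiked_mat (spike g) W U"
  define z where "z = spike g + inverse (spike g)"
  define \<mu> where "\<mu> = eigval r M"
  have W: "W \<in> symmetric_mats d" and U: "U \<in> carrier_mat d r"
    and lower: "op_norm W + (1 - \<gamma>) * (z - 2) \<le> \<mu>" and upper: "eigval 1 M \<le> (1 + \<gamma>) * z"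
    using good by (auto simp: good_event_def stiefel_def Let_def M_def z_def \<mu>_def)
  have M: "M \<in> symmetric_mats d" unfolding M_def by (rule spiked_mat_symmetric[OF W U])
  show "gap r (spiked_mat (spike g) W U) = gap r (mat_abs (spiked_mat (spike g) W U))"
    using gap_mat_abs[OF M] by (simp add: M_def)
  have z: "z = 2 / (1 - g)" using spike_quadratic[OF g] by (simp add: z_def)
  have z2: "2 < z" unfolding z using g by (simp add: field_simps)
  have gz: "g * z = z - 2" unfolding z using g by (simp add: field_simps)
  have norm0: "0 \<le> op_norm W" using W op_norm_nonneg by (auto simp: symmetric_mats_def)
  have "0 < (1 - \<gamma>) * (z - 2)" using z2 \<gamma> by simp
  hence \<mu>: "0 < \<mu>" "op_norm W < \<mu>" using lower norm0 by linarith+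
  have c: "M \<in> carrier_mat d d" "symf d (index_mat M)" using M by (auto simp: symmetric_mats_iff_symf)
  obtain f e where E: "eigensystem d (index_mat M) d f e" using eigensystem_exists[OF c(2)] by blast
  have "\<mu> \<le> eigval 1 M"
    using eigval_eigensystem[OF E, of "r - 1"] eigval_eigensystem[OF E, of 0]
      eigensystem_antimono[OF E, of 0 "r - 1"] r by (simp add: mat_index_mat[OF c(1)] \<mu>_def)
  hence \<mu>z: "\<mu> \<le> (1 + \<gamma>) * z" using upper by linarith
  have s: "\<mu> \<le> singval r M" using eigval_le_singval[OF M] r \<mu> by (simp add: \<mu>_def)
  have s': "singval (Suc r) M \<le> op_norm W" unfolding M_def by (rule singval_Suc_spiked_le[OF W U])
  have "(1 - \<gamma>) / (1 + \<gamma>) * g = (1 - \<gamma>) * (z - 2) / ((1 + \<gamma>) * z)"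
    unfolding gz[symmetric] using z2 by simp
  also have "\<dots> \<le> (1 - \<gamma>) * (z - 2) / \<mu>"
    using \<mu>z \<mu> z2 \<gamma> by (intro divide_left_mono) auto
  also have "\<dots> \<le> (\<mu> - op_norm W) / \<mu>" using lower \<mu> by (intro divide_right_mono) auto
  also have "\<dots> = 1 - op_norm W / \<mu>" using \<mu> by (simp add: field_simps)
  also have "\<dots> \<le> 1 - op_norm W / singval r M"
    using norm0 s \<mu> by (intro diff_left_mono divide_left_mono mult_pos_pos) auto
  also have "\<dots> \<le> 1 - singval (Suc r) M / singval r M"
    using s s' \<mu> by (intro diff_left_mono divide_right_mono) auto
  also have "\<dots> = gap r M" using s \<mu> by (simp add: gap_def diff_divide_distrib)
  finally show "(1 - \<gamma>) / (1 + \<gamma>) * g \<le> gap r (spiked_mat (spike g) W U)" by (simp add: M_def)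
qed

subsection \<open>Rotation invariance of Gaussian matrices\<close>

abbreviation gauss :: "real measure" where
  "gauss \<equiv> density lborel (\<lambda>x. ennreal (std_normal_density x))"

lemma prob_space_gauss: "prob_space gauss"
  by (rule prob_space_normal_density) simp

lemma std_normal_density_rotate:
  assumes "c\<^sup>2 + s\<^sup>2 = 1"
  shows "std_normal_density (c * u - s * v) * std_normal_density (s * u + c * v) =
    std_normal_density u * std_normal_density v"
proof -
  have "(c * u - s * v)\<^sup>2 + (s * u + c * v)\<^sup>2 = (c\<^sup>2 + s\<^sup>2) * (u\<^sup>2 + v\<^sup>2)"
    by (simp add: power2_eq_square algebra_simps)
  hence "- (c * u - s * v)\<^sup>2 / 2 + - (s * u + c * v)\<^sup>2 / 2 = - u\<^sup>2 / 2 + - v\<^sup>2 / 2"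
    unfolding assms by (simp add: field_simps)
  hence "exp (- (c * u - s * v)\<^sup>2 / 2) * exp (- (s * u + c * v)\<^sup>2 / 2) = exp (- u\<^sup>2 / 2) * exp (- v\<^sup>2 / 2)"
    unfolding exp_add[symmetric] by simp
  thus ?thesis by (simp add: std_normal_density_def)
qed

lemma nn_integral_gauss:
  "f \<in> borel_measurable borel \<Longrightarrow>
    (\<integral>\<^sup>+ x. f x \<partial>gauss) = (\<integral>\<^sup>+ x. ennreal (std_normal_density x) * f x \<partial>lborel)"
  by (subst nn_integral_density) auto

text \<open>The plane rotation is performed by two successive affine substitutions, which need \<open>c \<noteq> 0\<close>.\<close>
lemma nn_integral_gauss_rotate:
  fixes f :: "real \<times> real \<Rightarrow> ennreal"
  assumes f [measurable]: "f \<in> borel_measurable (borel \<Otimes>\<^sub>M borel)"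
    and cs: "c\<^sup>2 + s\<^sup>2 = 1" and c: "c \<noteq> 0"
  shows "(\<integral>\<^sup>+ x. \<integral>\<^sup>+ y. f (c * x + s * y, - s * x + c * y) \<partial>gauss \<partial>gauss) = (\<integral>\<^sup>+ x. \<integral>\<^sup>+ y. f (x, y) \<partial>gauss \<partial>gauss)"
proof -
  let ?\<phi> = "\<lambda>x. ennreal (std_normal_density x)"
  have gauss2: "(\<integral>\<^sup>+ x. \<integral>\<^sup>+ y. h (x, y) \<partial>gauss \<partial>gauss) =
      (\<integral>\<^sup>+ x. \<integral>\<^sup>+ y. ?\<phi> x * (?\<phi> y * h (x, y)) \<partial>lborel \<partial>lborel)"
    if h [measurable]: "h \<in> borel_measurable (borel \<Otimes>\<^sub>M borel)" for h :: "real \<times> real \<Rightarrow> ennreal"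
  proof -
    have "(\<integral>\<^sup>+ y. h (x, y) \<partial>gauss) = (\<integral>\<^sup>+ y. ?\<phi> y * h (x, y) \<partial>lborel)" for x
      by (rule nn_integral_gauss) measurable
    hence "(\<integral>\<^sup>+ x. \<integral>\<^sup>+ y. h (x, y) \<partial>gauss \<partial>gauss) = (\<integral>\<^sup>+ x. (\<integral>\<^sup>+ y. ?\<phi> y * h (x, y) \<partial>lborel) \<partial>gauss)"
      by simp
    also have "\<dots> = (\<integral>\<^sup>+ x. ?\<phi> x * (\<integral>\<^sup>+ y. ?\<phi> y * h (x, y) \<partial>lborel) \<partial>lborel)"
      by (rule nn_integral_gauss) measurable
    also have "\<dots> = (\<integral>\<^sup>+ x. \<integral>\<^sup>+ y. ?\<phi> x * (?\<phi> y * h (x, y)) \<partial>lborel \<partial>lborel)"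
      by (intro nn_integral_cong nn_integral_cmult[symmetric]) measurable
    finally show ?thesis .
  qed
  have "(\<integral>\<^sup>+ x. \<integral>\<^sup>+ y. f (c * x + s * y, - s * x + c * y) \<partial>gauss \<partial>gauss) =
      (\<integral>\<^sup>+ x. \<integral>\<^sup>+ y. ?\<phi> x * (?\<phi> y * f (c * x + s * y, - s * x + c * y)) \<partial>lborel \<partial>lborel)"
    using gauss2[of "\<lambda>(x, y). f (c * x + s * y, - s * x + c * y)"] by (simp add: split_beta')
  also have "\<dots> = (\<integral>\<^sup>+ y. \<integral>\<^sup>+ x. ?\<phi> x * (?\<phi> y * f (c * x + s * y, - s * x + c * y)) \<partial>lborel \<partial>lborel)"
    by (rule lborel_pair.Fubini'[symmetric]) measurable
  \<comment> \<open>First substitution, for fixed \<open>y\<close>: u = c x + s y. The second one,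
    after exchanging the integrals, is y = s u + c v for fixed \<open>u\<close>; the Jacobians 1/|c|
    and |c| cancel.\<close>
  also have "\<dots> = (\<integral>\<^sup>+ y. \<integral>\<^sup>+ u. ennreal \<bar>1 / c\<bar> * (?\<phi> ((u - s * y) / c) * (?\<phi> y * f (u, (y - s * u) / c))) \<partial>lborel \<partial>lborel)"
  proof (rule nn_integral_cong)
    fix y :: real
    have "(\<integral>\<^sup>+ x. ?\<phi> x * (?\<phi> y * f (c * x + s * y, - s * x + c * y)) \<partial>lborel) =
        ennreal \<bar>1 / c\<bar> * (\<integral>\<^sup>+ u. ?\<phi> (- (s * y / c) + 1 / c * u) * (?\<phi> y *
          f (c * (- (s * y / c) + 1 / c * u) + s * y, - s * (- (s * y / c) + 1 / c * u) + c * y)) \<partial>lborel)"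
      by (rule nn_integral_real_affine, measurable) (use c in simp)
    also have "\<dots> = ennreal \<bar>1 / c\<bar> * (\<integral>\<^sup>+ u. ?\<phi> ((u - s * y) / c) * (?\<phi> y * f (u, (y - s * u) / c)) \<partial>lborel)"
    proof -
      have "- (s * y / c) + 1 / c * u = (u - s * y) / c" for u using c by (simp add: field_simps)
      moreover have "c * ((u - s * y) / c) + s * y = u" for u using c by simp
      moreover have "- s * ((u - s * y) / c) + c * y = (y - s * u) / c" for u
      proof -
        have "- s * ((u - s * y) / c) + c * y = ((c\<^sup>2 + s\<^sup>2) * y - s * u) / c"
          using c by (simp add: field_simps power2_eq_square)
        thus ?thesis by (simp add: cs)
      qed
      ultimately show ?thesis by simp
    qed
    also have "\<dots> = (\<integral>\<^sup>+ u. ennreal \<bar>1 / c\<bar> * (?\<phi> ((u - s * y) / c) * (?\<phi> y * f (u, (y - s * u) / c))) \<partial>lborel)"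
      by (rule nn_integral_cmult[symmetric]) measurable
    finally show "(\<integral>\<^sup>+ x. ?\<phi> x * (?\<phi> y * f (c * x + s * y, - s * x + c * y)) \<partial>lborel) = \<dots>" .
  qed
  also have "\<dots> = (\<integral>\<^sup>+ u. \<integral>\<^sup>+ y. ennreal \<bar>1 / c\<bar> * (?\<phi> ((u - s * y) / c) * (?\<phi> y * f (u, (y - s * u) / c))) \<partial>lborel \<partial>lborel)"
    by (rule lborel_pair.Fubini'[symmetric]) measurable
  also have "\<dots> = (\<integral>\<^sup>+ u. \<integral>\<^sup>+ v. ?\<phi> u * (?\<phi> v * f (u, v)) \<partial>lborel \<partial>lborel)"
  proof (rule nn_integral_cong)
    fix u :: real
    have "(\<integral>\<^sup>+ y. ennreal \<bar>1 / c\<bar> * (?\<phi> ((u - s * y) / c) * (?\<phi> y * f (u, (y - s * u) / c))) \<partial>lborel) =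
        ennreal \<bar>c\<bar> * (\<integral>\<^sup>+ v. ennreal \<bar>1 / c\<bar> * (?\<phi> ((u - s * (s * u + c * v)) / c) *
          (?\<phi> (s * u + c * v) * f (u, ((s * u + c * v) - s * u) / c))) \<partial>lborel)"
      by (rule nn_integral_real_affine, measurable) (use c in simp)
    also have "\<dots> = ennreal \<bar>c\<bar> * (\<integral>\<^sup>+ v. ennreal \<bar>1 / c\<bar> * (?\<phi> u * (?\<phi> v * f (u, v))) \<partial>lborel)"
    proof -
      have "((s * u + c * v) - s * u) / c = v" for v using c by simp
      moreover have "(u - s * (s * u + c * v)) / c = c * u - s * v" for v
      proof -
        have "(u - s * (s * u + c * v)) / c = ((c\<^sup>2 + s\<^sup>2) * u - s * (s * u + c * v)) / c" by (simp add: cs)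
        thus ?thesis using c by (simp add: field_simps power2_eq_square)
      qed
      moreover have "?\<phi> (c * u - s * v) * (?\<phi> (s * u + c * v) * t) = ?\<phi> u * (?\<phi> v * t)" for v t
        using std_normal_density_rotate[OF cs, of u v]
        by (simp add: mult.assoc[symmetric] ennreal_mult'[symmetric])
      ultimately show ?thesis by simp
    qed
    also have "\<dots> = ennreal \<bar>c\<bar> * (ennreal \<bar>1 / c\<bar> * (\<integral>\<^sup>+ v. ?\<phi> u * (?\<phi> v * f (u, v)) \<partial>lborel))"
      by (subst nn_integral_cmult) auto
    also have "\<dots> = (ennreal \<bar>c\<bar> * ennreal \<bar>1 / c\<bar>) * (\<integral>\<^sup>+ v. ?\<phi> u * (?\<phi> v * f (u, v)) \<partial>lborel)"
      by (simp only: mult.assoc)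
    also have "ennreal \<bar>c\<bar> * ennreal \<bar>1 / c\<bar> = 1"
      using c by (simp add: ennreal_mult'[symmetric] abs_mult[symmetric])
    finally show "(\<integral>\<^sup>+ y. ennreal \<bar>1 / c\<bar> * (?\<phi> ((u - s * y) / c) * (?\<phi> y * f (u, (y - s * u) / c))) \<partial>lborel) =
      (\<integral>\<^sup>+ v. ?\<phi> u * (?\<phi> v * f (u, v)) \<partial>lborel)" by simp
  qed
  also have "\<dots> = (\<integral>\<^sup>+ x. \<integral>\<^sup>+ y. f (x, y) \<partial>gauss \<partial>gauss)"
    using gauss2[OF f] by simp
  finally show ?thesis .
qed

interpretation gauss: prob_space gauss by (rule prob_space_gauss)
interpretation gauss_prod: product_sigma_finite "\<lambda>_. gauss" by unfold_locales

lemma sets_PiM_gauss [measurable_cong]: "sets (PiM I (\<lambda>_. gauss)) = sets (PiM I (\<lambda>_. borel))"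
  by (rule sets_PiM_cong) auto

lemma nn_integral_PiM_gauss_rotate:
  fixes f :: "('i \<Rightarrow> real) \<Rightarrow> ennreal"
  assumes I: "finite I" "p \<in> I" "q \<in> I" "p \<noteq> q" and cs: "c\<^sup>2 + s\<^sup>2 = 1" "c \<noteq> 0"
    and f: "f \<in> borel_measurable (PiM I (\<lambda>_. gauss))"
  shows "(\<integral>\<^sup>+ G. f (G(p := c * G p + s * G q, q := - s * G p + c * G q)) \<partial>PiM I (\<lambda>_. gauss)) =
    (\<integral>\<^sup>+ G. f G \<partial>PiM I (\<lambda>_. gauss))"
proof -
  define J where "J = I - {p, q}"
  have IJ: "I = insert p (insert q J)" "finite J" "q \<notin> J" "p \<notin> insert q J" "finite (insert q J)"
    using I by (auto simp: J_def)
  let ?P = "\<lambda>I. PiM I (\<lambda>_. gauss)"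
  have split: "integral\<^sup>N (?P I) h = (\<integral>\<^sup>+ x. \<integral>\<^sup>+ b. \<integral>\<^sup>+ a. h (x(q := b, p := a)) \<partial>gauss \<partial>gauss \<partial>?P J)"
    if h: "h \<in> borel_measurable (?P I)" for h :: "('i \<Rightarrow> real) \<Rightarrow> ennreal"
  proof -
    have 1: "(\<lambda>(x, a). h (x(p := a))) \<in> borel_measurable (?P (insert q J) \<Otimes>\<^sub>M gauss)"
      using measurable_compose[OF measurable_add_dim h[unfolded IJ(1)]] by (simp add: split_beta')
    have "(\<lambda>x. \<integral>\<^sup>+ a. h (x(p := a)) \<partial>gauss) \<in> borel_measurable (?P (insert q J))"
      using gauss.borel_measurable_nn_integral[OF 1] .
    thus ?thesis
      unfolding IJ(1) gauss_prod.product_nn_integral_insert[OF IJ(5,4) h[unfolded IJ(1)]]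
      by (rule gauss_prod.product_nn_integral_insert[OF IJ(2,3)])
  qed
  let ?R = "\<lambda>G. G(p := c * G p + s * G q, q := - s * G p + c * G q)"
  have R: "?R \<in> measurable (?P I) (?P I)"
    unfolding measurable_cong_sets[OF sets_PiM_gauss sets_PiM_gauss]
  proof (intro measurable_fun_upd[where J = I] measurable_fun_upd[where J = I and M = "\<lambda>_. borel"])
    show "(\<lambda>x. c * x p + s * x q) \<in> measurable (PiM I (\<lambda>_. borel)) borel"
      "(\<lambda>x. - s * x p + c * x q) \<in> measurable (PiM I (\<lambda>_. borel)) borel"
      using I by measurable
  qed (use I in auto)
  have "(\<integral>\<^sup>+ G. f (?R G) \<partial>?P I) =
      (\<integral>\<^sup>+ x. \<integral>\<^sup>+ b. \<integral>\<^sup>+ a. f (?R (x(q := b, p := a))) \<partial>gauss \<partial>gauss \<partial>?P J)"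
    by (rule split) (rule measurable_compose[OF R f])
  also have "\<dots> = (\<integral>\<^sup>+ x. \<integral>\<^sup>+ b. \<integral>\<^sup>+ a. f (x(q := b, p := a)) \<partial>gauss \<partial>gauss \<partial>?P J)"
  proof (rule nn_integral_cong)
    fix x assume x: "x \<in> space (?P J)"
    define h where "h = (\<lambda>(b, a). f (x(q := b, p := a)))"
    have "h \<in> borel_measurable (borel \<Otimes>\<^sub>M borel)"
    proof -
      have "(\<lambda>z. x(q := fst z, p := snd z)) \<in> measurable (borel \<Otimes>\<^sub>M borel) (PiM I (\<lambda>_. borel))"
      proof (rule measurable_fun_upd[where J = "insert q J"])
        show "(\<lambda>z. x(q := fst z)) \<in> measurable (borel \<Otimes>\<^sub>M borel) (PiM (insert q J) (\<lambda>_. borel))"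
          using x by (intro measurable_fun_upd[where J = J] measurable_const) (auto simp: space_PiM)
      qed (use IJ in auto)
      from measurable_compose[OF this] f show ?thesis
        unfolding h_def measurable_cong_sets[OF sets_PiM_gauss refl] by (simp add: split_beta')
    qed
    \<comment> \<open>The coordinate \<open>q\<close> is integrated outside \<open>p\<close>; in
      this order the rotation has parameter \<open>- s\<close>.\<close>
    from nn_integral_gauss_rotate[OF this, of c "- s"] cs
    have "(\<integral>\<^sup>+ b. \<integral>\<^sup>+ a. h (c * b - s * a, s * b + c * a) \<partial>gauss \<partial>gauss) = (\<integral>\<^sup>+ b. \<integral>\<^sup>+ a. h (b, a) \<partial>gauss \<partial>gauss)"
      by simp
    moreover have "f (?R (x(q := b, p := a))) = h (c * b - s * a, s * b + c * a)" for a b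
    proof -
      have "?R (x(q := b, p := a)) = x(q := c * b - s * a, p := s * b + c * a)"
        using I(4) by (auto simp: fun_eq_iff algebra_simps)
      thus ?thesis by (simp add: h_def)
    qed
    ultimately show "(\<integral>\<^sup>+ b. \<integral>\<^sup>+ a. f (?R (x(q := b, p := a))) \<partial>gauss \<partial>gauss) =
        (\<integral>\<^sup>+ b. \<integral>\<^sup>+ a. f (x(q := b, p := a)) \<partial>gauss \<partial>gauss)"
      by (simp add: h_def)
  qed
  also have "\<dots> = integral\<^sup>N (?P I) f" by (rule split[OF f, symmetric])
  finally show ?thesis .
qed

definition rotv :: "nat \<Rightarrow> nat \<Rightarrow> real \<Rightarrow> real \<Rightarrow> (nat \<Rightarrow> real) \<Rightarrow> nat \<Rightarrow> real" where
  "rotv p q c s v = v(p := c * v p + s * v q, q := - s * v p + c * v q)"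

text \<open>A plane rotation applied to the columns in \<open>K\<close> only: with one new column at
  a time, each step of the induction touches just two entries of the matrix.\<close>

definition row_rot :: "nat set \<Rightarrow> nat \<Rightarrow> nat \<Rightarrow> real \<Rightarrow> real \<Rightarrow> (nat \<times> nat \<Rightarrow> real) \<Rightarrow> nat \<times> nat \<Rightarrow> real" where
  "row_rot K p q c s G = (\<lambda>(i, j). if j \<in> K then rotv p q c s (\<lambda>i. G (i, j)) i else G (i, j))"

abbreviation gauss_matrix :: "nat \<Rightarrow> (nat \<times> nat \<Rightarrow> real) measure" where
  "gauss_matrix n \<equiv> PiM ({..<n} \<times> {..<n}) (\<lambda>_. gauss)"

lemma row_rot_insert:
  assumes "j \<notin> K" "p \<noteq> q"
  shows "row_rot (insert j K) p q c s G = (row_rot K p q c s G)((p, j) := c * row_rot K p q c s G (p, j) + s * row_rot K p q c s G (q, j),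
    (q, j) := - s * row_rot K p q c s G (p, j) + c * row_rot K p q c s G (q, j))"
  using assms by (auto simp: row_rot_def rotv_def fun_eq_iff)

lemma measurable_rotate_entries:
  assumes "a \<in> I" "b \<in> I"
  shows "(\<lambda>G. G(a := c * G a + s * G b, b := - s * G a + c * G b)) \<in> measurable (PiM I (\<lambda>_. gauss)) (PiM I (\<lambda>_. gauss))"
    unfolding measurable_cong_sets[OF sets_PiM_gauss sets_PiM_gauss]
proof (intro measurable_fun_upd[where J = I] measurable_fun_upd[where J = I and M = "\<lambda>_. borel"])
  show "(\<lambda>x. c * x a + s * x b) \<in> measurable (PiM I (\<lambda>_. borel)) borel"
    "(\<lambda>x. - s * x a + c * x b) \<in> measurable (PiM I (\<lambda>_. borel)) borel"
    using assms by measurable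
qed (use assms in auto)

lemma row_rot_gauss_matrix:
  assumes K: "finite K" "K \<subseteq> {..<n}" and pq: "p < n" "q < n" "p \<noteq> q" and cs: "c\<^sup>2 + s\<^sup>2 = 1" "c \<noteq> 0"
  shows "row_rot K p q c s \<in> measurable (gauss_matrix n) (gauss_matrix n) \<and>
    (\<forall>f\<in>borel_measurable (gauss_matrix n). (\<integral>\<^sup>+ G. f (row_rot K p q c s G) \<partial>gauss_matrix n) = (\<integral>\<^sup>+ G. f G \<partial>gauss_matrix n))"
  using K
proof (induction K rule: finite_induct)
  case empty
  have "row_rot {} p q c s = (\<lambda>G. G)" by (auto simp: row_rot_def fun_eq_iff)
  thus ?case by simp
next
  case (insert j K)
  hence IH: "row_rot K p q c s \<in> measurable (gauss_matrix n) (gauss_matrix n)"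
    "\<And>f. f \<in> borel_measurable (gauss_matrix n) \<Longrightarrow>
      (\<integral>\<^sup>+ G. f (row_rot K p q c s G) \<partial>gauss_matrix n) = (\<integral>\<^sup>+ G. f G \<partial>gauss_matrix n)" by auto
  let ?a = "(p, j)" and ?b = "(q, j)"
  let ?R = "\<lambda>G. G(?a := c * G ?a + s * G ?b, ?b := - s * G ?a + c * G ?b)"
  have ab: "?a \<in> {..<n} \<times> {..<n}" "?b \<in> {..<n} \<times> {..<n}" "?a \<noteq> ?b" "finite ({..<n} \<times> {..<n})"
    using pq insert.prems by auto
  have R: "?R \<in> measurable (gauss_matrix n) (gauss_matrix n)" by (rule measurable_rotate_entries[OF ab(1,2)])
  have eq: "row_rot (insert j K) p q c s = (\<lambda>G. ?R (row_rot K p q c s G))"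
    using row_rot_insert[OF insert.hyps(2) pq(3)] by blast
  have "(\<integral>\<^sup>+ G. f (?R (row_rot K p q c s G)) \<partial>gauss_matrix n) = (\<integral>\<^sup>+ G. f G \<partial>gauss_matrix n)"
    if f: "f \<in> borel_measurable (gauss_matrix n)" for f
    using IH(2)[OF measurable_compose[OF R f]] nn_integral_PiM_gauss_rotate[OF ab(4,1-3) cs f] by simp
  moreover have "(\<lambda>G. ?R (row_rot K p q c s G)) \<in> measurable (gauss_matrix n) (gauss_matrix n)"
    by (rule measurable_compose[OF IH(1) R])
  ultimately show ?case unfolding eq by blast
qed

text \<open>Transposition, which converts column rotations into row rotations. The restricted lambda
  keeps the values in the space of the product measure.\<close>

definition swapm :: "nat \<Rightarrow> (nat \<times> nat \<Rightarrow> real) \<Rightarrow> nat \<times> nat \<Rightarrow> real" where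
  "swapm n G = (\<lambda>x\<in>{..<n} \<times> {..<n}. G (prod.swap x))"

lemma distr_gauss_matrix_swap: "distr (gauss_matrix n) (gauss_matrix n) (swapm n) = gauss_matrix n"
  unfolding swapm_def
  by (rule distr_PiM_reindex[where K = "{..<n} \<times> {..<n}" and M = "\<lambda>_. gauss"])
    (auto simp: prob_space_gauss)

lemma measurable_swapm: "swapm n \<in> measurable (gauss_matrix n) (gauss_matrix n)"
  unfolding swapm_def by (rule measurable_restrict) auto

lemma nn_integral_swapm:
  assumes "f \<in> borel_measurable (gauss_matrix n)"
  shows "(\<integral>\<^sup>+ G. f (swapm n G) \<partial>gauss_matrix n) = (\<integral>\<^sup>+ G. f G \<partial>gauss_matrix n)"
  using nn_integral_distr[OF measurable_swapm, of f n] assms unfolding distr_gauss_matrix_swap by simp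

text \<open>\<open>G \<mapsto> R G R\<^sup>T\<close> for a plane rotation \<open>R\<close>.\<close>
definition conj_rot :: "nat \<Rightarrow> nat \<Rightarrow> nat \<Rightarrow> real \<Rightarrow> real \<Rightarrow> (nat \<times> nat \<Rightarrow> real) \<Rightarrow> nat \<times> nat \<Rightarrow> real" where
  "conj_rot n p q c s G = row_rot {..<n} p q c s (swapm n (row_rot {..<n} p q c s (swapm n G)))"

lemma conj_rot_gauss_matrix:
  assumes pq: "p < n" "q < n" "p \<noteq> q" and cs: "c\<^sup>2 + s\<^sup>2 = 1" "c \<noteq> 0"
  shows "conj_rot n p q c s \<in> measurable (gauss_matrix n) (gauss_matrix n)"
    "f \<in> borel_measurable (gauss_matrix n) \<Longrightarrow>
      (\<integral>\<^sup>+ G. f (conj_rot n p q c s G) \<partial>gauss_matrix n) = (\<integral>\<^sup>+ G. f G \<partial>gauss_matrix n)"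
proof -
  note rr = row_rot_gauss_matrix[OF finite_lessThan order_refl pq cs]
  have m1: "row_rot {..<n} p q c s \<in> measurable (gauss_matrix n) (gauss_matrix n)" using rr by blast
  have m2: "(\<lambda>G. row_rot {..<n} p q c s (swapm n G)) \<in> measurable (gauss_matrix n) (gauss_matrix n)"
    by (rule measurable_compose[OF measurable_swapm m1])
  show "conj_rot n p q c s \<in> measurable (gauss_matrix n) (gauss_matrix n)"
    unfolding conj_rot_def by (rule measurable_compose[OF m2 m2])
  have 1: "(\<integral>\<^sup>+ G. h (row_rot {..<n} p q c s (swapm n G)) \<partial>gauss_matrix n) = (\<integral>\<^sup>+ G. h G \<partial>gauss_matrix n)"
    if h: "h \<in> borel_measurable (gauss_matrix n)" for h
    using nn_integral_swapm[OF measurable_compose[OF m1 h]] rr h by simp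
  show "(\<integral>\<^sup>+ G. f (conj_rot n p q c s G) \<partial>gauss_matrix n) = (\<integral>\<^sup>+ G. f G \<partial>gauss_matrix n)"
    if f: "f \<in> borel_measurable (gauss_matrix n)"
    using 1[OF measurable_compose[OF m2 f]] 1[OF f] by (simp add: conj_rot_def)
qed

section \<open>Quadratic forms under conjugation by a rotation\<close>

abbreviation qf :: "nat \<Rightarrow> (nat \<times> nat \<Rightarrow> real) \<Rightarrow> (nat \<Rightarrow> real) \<Rightarrow> real" where
  "qf n A v \<equiv> ip n v (mv n A v)"

lemma ip_rotv:
  assumes "p < n" "q < n" "p \<noteq> q"
  shows "ip n (rotv p q c s u) v = ip n u (rotv p q c (- s) v)"
proof -
  have split: "ip n a b = a p * b p + (a q * b q + (\<Sum>i\<in>{..<n} - {p} - {q}. a i * b i))" for a b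
    unfolding ip_def using assms
    by (subst sum.remove[of _ p]; simp) (subst sum.remove[of _ q]; simp)
  have "(\<Sum>i\<in>{..<n} - {p} - {q}. rotv p q c s u i * v i) = (\<Sum>i\<in>{..<n} - {p} - {q}. u i * rotv p q c (- s) v i)"
    by (rule sum.cong) (auto simp: rotv_def)
  thus ?thesis using assms unfolding split by (simp add: rotv_def algebra_simps)
qed

lemma ip_mv_swapm: "ip n u (mv n (swapm n A) v) = ip n v (mv n A u)"
proof -
  have "ip n u (mv n (swapm n A) v) = (\<Sum>i<n. \<Sum>j<n. u i * (A (j, i) * v j))"
    by (simp add: ip_def mv_def swapm_def sum_distrib_left)
  also have "\<dots> = (\<Sum>j<n. \<Sum>i<n. u i * (A (j, i) * v j))" by (rule sum.swap)
  finally show ?thesis by (simp add: ip_def mv_def sum_distrib_left mult_ac)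
qed

lemma ip_mv_row_rot:
  assumes "p < n" "q < n" "p \<noteq> q"
  shows "ip n u (mv n (row_rot {..<n} p q c s A) v) = ip n (rotv p q c (- s) u) (mv n A v)"
proof -
  have *: "ip n u (mv n B v) = (\<Sum>j<n. v j * ip n u (\<lambda>i. B (i, j)))" for u B
    unfolding ip_def mv_def sum_distrib_left by (subst sum.swap) (simp add: mult_ac)
  have "ip n u (\<lambda>i. row_rot {..<n} p q c s A (i, j)) = ip n (rotv p q c (- s) u) (\<lambda>i. A (i, j))" if "j < n" for j
    using that ip_rotv[OF assms, of c "- s" u "\<lambda>i. A (i, j)"] by (simp add: row_rot_def)
  thus ?thesis unfolding * by simp
qed

lemma qf_conj_rot:
  assumes "p < n" "q < n" "p \<noteq> q"
  shows "qf n (conj_rot n p q c s A) v = qf n A (rotv p q c (- s) v)"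
  unfolding conj_rot_def ip_mv_row_rot[OF assms] ip_mv_swapm ..

subsection \<open>The law of the upper triangle\<close>

definition upper :: "nat \<Rightarrow> (nat \<times> nat) set" where
  "upper n = {(i, j). i \<le> j \<and> j < n}"

abbreviation goe_sd :: "nat \<Rightarrow> nat \<times> nat \<Rightarrow> real" where
  "goe_sd d p \<equiv> (if fst p = snd p then sqrt (2 / real d) else sqrt (1 / real d))"

abbreviation goe_entry :: "nat \<Rightarrow> nat \<times> nat \<Rightarrow> real measure" where
  "goe_entry d p \<equiv> density lborel (\<lambda>x. ennreal (normal_density 0 (goe_sd d p) x))"

text \<open>The upper triangle of the top left \<open>n \<times> n\<close> corner of a \<open>GOE(d)\<close> matrix.\<close>
definition tri :: "nat \<Rightarrow> nat \<Rightarrow> (nat \<times> nat \<Rightarrow> real) measure" where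
  "tri d n = PiM (upper n) (goe_entry d)"

definition symx :: "(nat \<times> nat \<Rightarrow> real) \<Rightarrow> nat \<times> nat \<Rightarrow> real" where
  "symx w = (\<lambda>(i, j). w (min i j, max i j))"

lemma finite_upper [simp]: "finite (upper n)"
  by (rule finite_subset[of _ "{..<n} \<times> {..<n}"]) (auto simp: upper_def)

lemma prob_space_goe_entry: "0 < d \<Longrightarrow> prob_space (goe_entry d p)"
  by (rule prob_space_normal_density) auto

lemma sets_tri [measurable_cong]: "sets (tri d n) = sets (PiM (upper n) (\<lambda>_. borel))"
  unfolding tri_def by (rule sets_PiM_cong) auto

lemma space_tri: "space (tri d n) = PiE (upper n) (\<lambda>_. UNIV)"
  by (simp add: tri_def space_PiM)

lemma prob_space_tri: "0 < d \<Longrightarrow> prob_space (tri d n)"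
  unfolding tri_def by (intro prob_space_PiM prob_space_goe_entry)

lemma prob_space_gauss_matrix: "prob_space (gauss_matrix n)"
  by (intro prob_space_PiM prob_space_gauss)

lemma gauss_coordinates:
  assumes "p \<in> {..<n} \<times> {..<n}"
  shows "distr (gauss_matrix n) borel (\<lambda>G. G p) = gauss"
proof -
  have "distr (gauss_matrix n) borel (\<lambda>G. G p) = distr (gauss_matrix n) gauss (\<lambda>G. G p)"
    by (rule distr_cong) auto
  also have "\<dots> = gauss" by (rule distr_PiM_component) (use assms prob_space_gauss in auto)
  finally show ?thesis .
qed

lemma indep_vars_gauss_coordinates:
  assumes "0 < n"
  shows "prob_space.indep_vars (gauss_matrix n) (\<lambda>_. borel) (\<lambda>p G. G p) ({..<n} \<times> {..<n})"
proof (subst prob_space.indep_vars_iff_distr_eq_PiM'[OF prob_space_gauss_matrix])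
  let ?S = "{..<n} \<times> {..<n}"
  show "?S \<noteq> {}" using assms by auto
  show "(\<lambda>G. G p) \<in> measurable (gauss_matrix n) borel" if "p \<in> ?S" for p
    using measurable_component_singleton[OF that, of "\<lambda>_. gauss"] by simp
  have "distr (gauss_matrix n) (PiM ?S (\<lambda>_. borel)) (\<lambda>x. \<lambda>p\<in>?S. x p) = distr (gauss_matrix n) (gauss_matrix n) (\<lambda>x. x)"
    by (intro distr_cong refl sets_PiM_cong) (auto simp: space_PiM PiE_iff extensional_restrict)
  also have "\<dots> = gauss_matrix n" by (rule distr_id2) simp
  also have "\<dots> = PiM ?S (\<lambda>p. distr (gauss_matrix n) borel (\<lambda>G. G p))"
    by (rule PiM_cong) (auto simp: gauss_coordinates)
  finally show "distr (gauss_matrix n) (PiM ?S (\<lambda>_. borel)) (\<lambda>x. \<lambda>p\<in>?S. x p) =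
    PiM ?S (\<lambda>p. distr (gauss_matrix n) borel (\<lambda>G. G p))" .
qed

text \<open>An entry of W = (G + G^T) / sqrt (2 d), where \<open>G\<close> has independent standard
  entries: the variance is 2 / (2 d) = 1/d off the diagonal and 4 / (2 d) = 2/d on it, as for the
  GOE.\<close>

definition sym_entry :: "nat \<Rightarrow> nat \<times> nat \<Rightarrow> (nat \<times> nat \<Rightarrow> real) \<Rightarrow> real" where
  "sym_entry d p G = (G p + G (prod.swap p)) / sqrt (2 * real d)"

lemma distributed_sym_entry:
  assumes d: "0 < d" and p: "p \<in> upper n"
  shows "distributed (gauss_matrix n) lborel (sym_entry d p) (\<lambda>x. ennreal (normal_density 0 (goe_sd d p) x))"
proof -
  interpret prob_space "gauss_matrix n" by (rule prob_space_gauss_matrix)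
  have pS: "p \<in> {..<n} \<times> {..<n}" "prod.swap p \<in> {..<n} \<times> {..<n}" and n: "0 < n"
    using p by (auto simp: upper_def)
  have coord: "distributed (gauss_matrix n) lborel (\<lambda>G. G p) (\<lambda>x. ennreal (std_normal_density x))"
    if "p \<in> {..<n} \<times> {..<n}" for p
  proof -
    have "distr (gauss_matrix n) lborel (\<lambda>G. G p) = distr (gauss_matrix n) borel (\<lambda>G. G p)"
      by (rule distr_cong) auto
    thus ?thesis unfolding distributed_def
      using gauss_coordinates[OF that] measurable_component_singleton[OF that, of "\<lambda>_. gauss"] by simp
  qed
  show ?thesis
  proof (cases "fst p = snd p")
    case True
    hence "prod.swap p = p" by (cases p) auto
    hence eq: "sym_entry d p = (\<lambda>G. 0 + sqrt (2 / real d) * G p)"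
      using d by (auto simp: sym_entry_def fun_eq_iff real_sqrt_mult real_sqrt_divide field_simps)
    have "distributed (gauss_matrix n) lborel (\<lambda>G. 0 + sqrt (2 / real d) * G p)
        (normal_density (0 + sqrt (2 / real d) * 0) (\<bar>sqrt (2 / real d)\<bar> * 1))"
      using d by (intro normal_density_affine coord pS) auto
    thus ?thesis unfolding eq using True by simp
  next
    case False
    hence ne: "p \<noteq> prod.swap p" by (cases p) auto
    have "indep_vars (\<lambda>_. borel) (\<lambda>p G. G p) {p, prod.swap p}"
      by (rule indep_vars_subset[OF indep_vars_gauss_coordinates[OF n]]) (use pS in auto)
    hence "distributed (gauss_matrix n) lborel (\<lambda>G. \<Sum>q\<in>{p, prod.swap p}. G q)
        (normal_density (\<Sum>q\<in>{p, prod.swap p}. 0) (sqrt (\<Sum>q\<in>{p, prod.swap p}. 1\<^sup>2)))"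
      using pS by (intro sum_indep_normal coord) auto
    hence 2: "distributed (gauss_matrix n) lborel (\<lambda>G. G p + G (prod.swap p)) (normal_density 0 (sqrt 2))"
      using ne by simp
    have "distributed (gauss_matrix n) lborel (\<lambda>G. 0 + 1 / sqrt (2 * real d) * (G p + G (prod.swap p)))
        (normal_density (0 + 1 / sqrt (2 * real d) * 0) (\<bar>1 / sqrt (2 * real d)\<bar> * sqrt 2))"
      using d by (intro normal_density_affine 2) auto
    moreover have "\<bar>1 / sqrt (2 * real d)\<bar> * sqrt 2 = sqrt (1 / real d)"
      using d by (simp add: real_sqrt_mult real_sqrt_divide)
    moreover have "(\<lambda>G. 0 + 1 / sqrt (2 * real d) * (G p + G (prod.swap p))) = sym_entry d p"
      by (auto simp: sym_entry_def fun_eq_iff)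
    ultimately show ?thesis using False by simp
  qed
qed

lemma measurable_sym_entries:
  "(\<lambda>G. \<lambda>p\<in>upper n. sym_entry d p G) \<in> measurable (gauss_matrix n) (PiM (upper n) (\<lambda>_. borel))"
  unfolding measurable_cong_sets[OF sets_PiM_gauss refl]
proof (rule measurable_restrict)
  fix p assume "p \<in> upper n"
  hence [measurable]: "p \<in> {..<n} \<times> {..<n}" "prod.swap p \<in> {..<n} \<times> {..<n}" by (auto simp: upper_def)
  show "sym_entry d p \<in> measurable (PiM ({..<n} \<times> {..<n}) (\<lambda>_. borel)) borel"
    unfolding sym_entry_def by measurable
qed

text \<open>Entries of \<open>W\<close> with different unordered index pairs use disjoint sets of
  entries of \<open>G\<close>, hence are independent. Through this representation the rotation
  invariance of \<open>G\<close> passes to \<open>W\<close>.\<close>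

lemma tri_eq_distr_gauss_matrix:
  assumes d: "0 < d" and n: "0 < n"
  shows "tri d n = distr (gauss_matrix n) (PiM (upper n) (\<lambda>_. borel)) (\<lambda>G. \<lambda>p\<in>upper n. sym_entry d p G)"
proof -
  interpret prob_space "gauss_matrix n" by (rule prob_space_gauss_matrix)
  let ?K = "\<lambda>p :: nat \<times> nat. {p, prod.swap p}"
  have "indep_vars (\<lambda>p. PiM (?K p) (\<lambda>_. borel)) (\<lambda>p G. \<lambda>q\<in>?K p. G q) (upper n)"
    by (rule indep_vars_restrict[OF indep_vars_gauss_coordinates[OF n]])
      (auto simp: upper_def disjoint_family_on_def)
  hence "indep_vars (\<lambda>_. borel) (\<lambda>p G. (\<lambda>x. (x p + x (prod.swap p)) / sqrt (2 * real d)) (\<lambda>q\<in>?K p. G q)) (upper n)"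
    by (rule indep_vars_compose2) measurable
  moreover have "sym_entry d = (\<lambda>p G. (G p + G (prod.swap p)) / sqrt (2 * real d))"
    by (intro ext) (simp add: sym_entry_def)
  ultimately have ind: "indep_vars (\<lambda>_. borel) (sym_entry d) (upper n)" by simp
  have ne: "upper n \<noteq> {}" using n by (auto simp: upper_def)
  have m: "sym_entry d p \<in> measurable (gauss_matrix n) borel" if "p \<in> upper n" for p
    using distributed_sym_entry[OF d that] by (simp add: distributed_def)
  have "distr (gauss_matrix n) (PiM (upper n) (\<lambda>_. borel)) (\<lambda>G. \<lambda>p\<in>upper n. sym_entry d p G) =
      PiM (upper n) (\<lambda>p. distr (gauss_matrix n) borel (sym_entry d p))"
    by (rule indep_vars_iff_distr_eq_PiM'[THEN iffD1, OF ne _ ind]) (rule m)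
  also have "\<dots> = tri d n"
    unfolding tri_def
  proof (rule PiM_cong[OF refl])
    fix p assume p: "p \<in> upper n"
    have "distr (gauss_matrix n) borel (sym_entry d p) = distr (gauss_matrix n) lborel (sym_entry d p)"
      by (rule distr_cong) auto
    thus "distr (gauss_matrix n) borel (sym_entry d p) = goe_entry d p"
      using distributed_distr_eq_density[OF distributed_sym_entry[OF d p]] by simp
  qed
  finally show ?thesis by simp
qed

text \<open>The antisymmetric part of \<open>G\<close> is invisible to a quadratic form, so the form
  of \<open>W\<close> is a multiple of that of \<open>G\<close>. This is why events are formulated
  through quadratic forms.\<close>

lemma qf_symx_sym_entries:
  assumes "0 < d"
  shows "qf n (symx (\<lambda>p\<in>upper n. sym_entry d p G)) v = sqrt (2 / real d) * qf n G v"
proof -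
  have "symx (\<lambda>p\<in>upper n. sym_entry d p G) (i, j) = (G (i, j) + G (j, i)) / sqrt (2 * real d)"
    if "i < n" "j < n" for i j
    using that by (auto simp: symx_def upper_def sym_entry_def min_def max_def add.commute)
  hence "qf n (symx (\<lambda>p\<in>upper n. sym_entry d p G)) v =
      (\<Sum>i<n. \<Sum>j<n. (v i * G (i, j) * v j + v i * G (j, i) * v j) / sqrt (2 * real d))"
    by (simp add: ip_def mv_def sum_distrib_left algebra_simps add_divide_distrib)
  also have "\<dots> = ((\<Sum>i<n. \<Sum>j<n. v i * G (i, j) * v j) + (\<Sum>i<n. \<Sum>j<n. v i * G (j, i) * v j)) / sqrt (2 * real d)"
    by (simp only: sum_divide_distrib[symmetric] sum.distrib)
  also have "(\<Sum>i<n. \<Sum>j<n. v i * G (j, i) * v j) = (\<Sum>i<n. \<Sum>j<n. v i * G (i, j) * v j)"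
    by (subst sum.swap) (simp add: mult_ac)
  also have "(\<Sum>i<n. \<Sum>j<n. v i * G (i, j) * v j) = qf n G v"
    by (simp add: ip_def mv_def sum_distrib_left mult_ac)
  also have "(qf n G v + qf n G v) / sqrt (2 * real d) = sqrt (2 / real d) * qf n G v"
    using assms by (simp add: real_sqrt_mult real_sqrt_divide field_simps)
  finally show ?thesis .
qed

text \<open>Probability that the random quadratic form \<open>v \<mapsto> v\<^sup>T W v\<close> violates \<open>Ev\<close>.\<close>
definition fail :: "nat \<Rightarrow> nat \<Rightarrow> (((nat \<Rightarrow> real) \<Rightarrow> real) \<Rightarrow> bool) \<Rightarrow> ennreal" where
  "fail d n Ev = emeasure (tri d n) {w \<in> space (tri d n). \<not> Ev (qf n (symx w))}"

definition form_event :: "nat \<Rightarrow> (((nat \<Rightarrow> real) \<Rightarrow> real) \<Rightarrow> bool) \<Rightarrow> bool" where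
  "form_event n Ev \<longleftrightarrow> {w \<in> space (PiM (upper n) (\<lambda>_. borel)). Ev (qf n (symx w))} \<in> sets (PiM (upper n) (\<lambda>_. borel))"

lemma fail_eq_gauss_matrix:
  assumes d: "0 < d" and n: "0 < n" and Ev: "form_event n Ev"
  shows "{G \<in> space (gauss_matrix n). \<not> Ev (\<lambda>v. sqrt (2 / real d) * qf n G v)} \<in> sets (gauss_matrix n)"
    and "fail d n Ev = emeasure (gauss_matrix n) {G \<in> space (gauss_matrix n). \<not> Ev (\<lambda>v. sqrt (2 / real d) * qf n G v)}"
proof -
  let ?B = "PiM (upper n) (\<lambda>_. borel :: real measure)"
  let ?X = "\<lambda>G. \<lambda>p\<in>upper n. sym_entry d p G"
  let ?bad = "{w \<in> space ?B. \<not> Ev (qf n (symx w))}"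
  have "?bad = space ?B - {w \<in> space ?B. Ev (qf n (symx w))}" by auto
  hence bad: "?bad \<in> sets ?B" using Ev by (simp add: form_event_def)
  have vimage: "?X -` ?bad \<inter> space (gauss_matrix n) =
      {G \<in> space (gauss_matrix n). \<not> Ev (\<lambda>v. sqrt (2 / real d) * qf n G v)}"
    using measurable_space[OF measurable_sym_entries, of _ n d] qf_symx_sym_entries[OF d] by auto
  show "{G \<in> space (gauss_matrix n). \<not> Ev (\<lambda>v. sqrt (2 / real d) * qf n G v)} \<in> sets (gauss_matrix n)"
    unfolding vimage[symmetric] by (rule measurable_sets[OF measurable_sym_entries bad])
  have "space (tri d n) = space ?B" by (simp add: space_tri space_PiM)
  thus "fail d n Ev = emeasure (gauss_matrix n) {G \<in> space (gauss_matrix n). \<not> Ev (\<lambda>v. sqrt (2 / real d) * qf n G v)}"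
    unfolding fail_def unfolding tri_eq_distr_gauss_matrix[OF d n]
    by (subst emeasure_distr[OF measurable_sym_entries]) (simp_all add: bad vimage[symmetric])
qed

text \<open>Conjugating \<open>G\<close> by the rotation with \<open>- s\<close> preserves its law
  and replaces \<open>v\<close> by \<open>rotv p q c s v\<close> in the quadratic form.\<close>

lemma fail_rotate:
  assumes d: "0 < d" and pq: "p < n" "q < n" "p \<noteq> q" and cs: "c\<^sup>2 + s\<^sup>2 = 1" "c \<noteq> 0"
    and Ev: "form_event n Ev" "form_event n (\<lambda>Q. Ev (\<lambda>v. Q (rotv p q c s v)))"
  shows "fail d n (\<lambda>Q. Ev (\<lambda>v. Q (rotv p q c s v))) = fail d n Ev"
proof -
  have n: "0 < n" using pq by simp
  have cs': "c\<^sup>2 + (- s)\<^sup>2 = 1" using cs by simp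
  let ?bad = "{G \<in> space (gauss_matrix n). \<not> Ev (\<lambda>v. sqrt (2 / real d) * qf n G v)}"
  let ?bad' = "{G \<in> space (gauss_matrix n). \<not> Ev (\<lambda>v. sqrt (2 / real d) * qf n G (rotv p q c s v))}"
  let ?C = "conj_rot n p q c (- s)"
  note bad = fail_eq_gauss_matrix[OF d n Ev(1)]
  note bad' = fail_eq_gauss_matrix[OF d n Ev(2)]
  have "emeasure (gauss_matrix n) ?bad = (\<integral>\<^sup>+ G. indicator ?bad G \<partial>gauss_matrix n)"
    using bad(1) by simp
  also have "\<dots> = (\<integral>\<^sup>+ G. indicator ?bad (?C G) \<partial>gauss_matrix n)"
    by (rule conj_rot_gauss_matrix(2)[OF pq cs' cs(2), symmetric]) (rule borel_measurable_indicator[OF bad(1)])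
  also have "\<dots> = (\<integral>\<^sup>+ G. indicator ?bad' G \<partial>gauss_matrix n)"
  proof (rule nn_integral_cong)
    fix G assume "G \<in> space (gauss_matrix n)"
    moreover from this have "?C G \<in> space (gauss_matrix n)"
      by (rule measurable_space[OF conj_rot_gauss_matrix(1)[OF pq cs' cs(2)]])
    ultimately show "indicator ?bad (?C G) = (indicator ?bad' G :: ennreal)"
      by (simp add: indicator_def qf_conj_rot[OF pq])
  qed
  also have "\<dots> = emeasure (gauss_matrix n) ?bad'" using bad'(1) by simp
  finally show ?thesis using bad(2) bad'(2) by simp
qed

subsection \<open>Resolvent events\<close>

text \<open>In terms of the matrix \<open>W\<close> of the form \<open>Q\<close>: \<open>z - \<sigma> W\<close> is positive semidefinite and
  \<open>u\<^sup>T (z - \<sigma> W)\<^sup>-\<^sup>1 u \<le> T |u|\<^sup>2\<close> for \<open>E_up\<close>, and \<open>u\<^sup>T (z - W)\<^sup>-\<^sup>1 u > s |u|\<^sup>2\<close> for \<open>E_low\<close>. The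
  variational formulation avoids inverses and makes the events closed and open, respectively.\<close>
definition E_up :: "nat \<Rightarrow> real \<Rightarrow> real \<Rightarrow> real \<Rightarrow> (nat \<Rightarrow> real) \<Rightarrow> ((nat \<Rightarrow> real) \<Rightarrow> real) \<Rightarrow> bool" where
  "E_up n z T \<sigma> u Q \<longleftrightarrow> (\<forall>v. 0 \<le> z * ip n v v - \<sigma> * Q v \<and>
     (ip n u v)\<^sup>2 \<le> T * ip n u u * (z * ip n v v - \<sigma> * Q v))"

definition E_low :: "nat \<Rightarrow> real \<Rightarrow> real \<Rightarrow> (nat \<Rightarrow> real) \<Rightarrow> ((nat \<Rightarrow> real) \<Rightarrow> real) \<Rightarrow> bool" where
  "E_low n z s u Q \<longleftrightarrow> (\<exists>v. s * ip n u u < 2 * ip n u v - (z * ip n v v - Q v))"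

text \<open>Extending the triangle by zeros maps the finite product measurably into
  \<open>nat \<times> nat \<Rightarrow> real\<close>, whose Borel sets are those of the product
  topology, and the form does not see the added entries. Closedness or openness there then gives
  measurability.\<close>

lemma form_eventI:
  assumes "{x. Ev (qf n (symx x))} \<in> sets borel"
  shows "form_event n Ev"
proof -
  let ?B = "PiM (upper n) (\<lambda>_. borel :: real measure)"
  let ?ext = "\<lambda>w p. if p \<in> upper n then w p else 0"
  have "?ext \<in> measurable ?B (PiM UNIV (\<lambda>_. borel))"
  proof (rule measurable_PiM_single')
    show "(\<lambda>w. ?ext w p) \<in> measurable ?B borel" for p by (cases "p \<in> upper n") auto
  qed auto
  hence "?ext \<in> measurable ?B borel" by (simp cong: measurable_cong_sets add: sets_PiM_equal_borel)
  hence "?ext -` {x. Ev (qf n (symx x))} \<inter> space ?B \<in> sets ?B" using assms by (rule measurable_sets)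
  moreover have "qf n (symx (?ext w)) = qf n (symx w)" for w
  proof
    fix v show "qf n (symx (?ext w)) v = qf n (symx w) v"
    proof (intro ip_cong mv_cong refl)
      fix i j assume "i < n" "j < n"
      hence "(min i j, max i j) \<in> upper n" by (auto simp: upper_def)
      thus "symx (?ext w) (i, j) = symx w (i, j)" by (simp add: symx_def)
    qed
  qed
  ultimately have "{w \<in> space ?B. Ev (qf n (symx w))} \<in> sets ?B"
    by (simp add: vimage_def Int_def conj_commute)
  thus ?thesis by (simp add: form_event_def)
qed

lemma continuous_qf_symx: "continuous_on UNIV (\<lambda>x. qf n (symx x) v)"
  unfolding ip_def mv_def symx_def prod.case
  by (intro continuous_intros continuous_on_product_coordinates)

lemma form_event_E_up: "form_event n (E_up n z T \<sigma> u)"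
  unfolding E_up_def
  by (intro form_eventI borel_closed closed_Collect_all closed_Collect_conj closed_Collect_le
      continuous_intros continuous_qf_symx)

lemma form_event_E_low: "form_event n (E_low n z s u)"
  unfolding E_low_def
  by (intro form_eventI borel_open open_Collect_ex open_Collect_less
      continuous_intros continuous_qf_symx)

section \<open>Covariance of the events under rotations\<close>

lemma rotv_inverse:
  assumes "p \<noteq> q" "c\<^sup>2 + s\<^sup>2 = 1"
  shows "rotv p q c s (rotv p q c (- s) v) = v" "rotv p q c (- s) (rotv p q c s v) = v"
proof -
  have r: "c * (c * x) + s * (s * x) = x" for x
    using assms(2) by (metis distrib_right mult.assoc mult_1 power2_eq_square)
  thus "rotv p q c s (rotv p q c (- s) v) = v" "rotv p q c (- s) (rotv p q c s v) = v"
    using assms(1) by (auto simp: rotv_def fun_eq_iff algebra_simps r)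
qed

lemma all_rotv:
  assumes "p \<noteq> q" "c\<^sup>2 + s\<^sup>2 = 1"
  shows "(\<forall>v. P v) \<longleftrightarrow> (\<forall>v. P (rotv p q c s v))" "(\<exists>v. P v) \<longleftrightarrow> (\<exists>v. P (rotv p q c s v))"
  using rotv_inverse[OF assms] by metis+

lemma ip_rotv_both:
  assumes "p < n" "q < n" "p \<noteq> q" "c\<^sup>2 + s\<^sup>2 = 1"
  shows "ip n (rotv p q c s u) (rotv p q c s v) = ip n u v"
  unfolding ip_rotv[OF assms(1-3)] rotv_inverse[OF assms(3,4)] ..

lemma E_up_rotv:
  assumes "p < n" "q < n" "p \<noteq> q" "c\<^sup>2 + s\<^sup>2 = 1"
  shows "E_up n z T \<sigma> u (\<lambda>v. Q (rotv p q c s v)) \<longleftrightarrow> E_up n z T \<sigma> (rotv p q c s u) Q"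
  unfolding E_up_def
  by (subst (2) all_rotv(1)[OF assms(3,4)]) (simp add: ip_rotv_both[OF assms])

lemma E_low_rotv:
  assumes "p < n" "q < n" "p \<noteq> q" "c\<^sup>2 + s\<^sup>2 = 1"
  shows "E_low n z t u (\<lambda>v. Q (rotv p q c s v)) \<longleftrightarrow> E_low n z t (rotv p q c s u) Q"
  unfolding E_low_def
  by (subst (2) all_rotv(2)[OF assms(3,4)]) (simp add: ip_rotv_both[OF assms])

text \<open>By Givens rotations every direction is as good as the last coordinate direction.\<close>
lemma fail_all_directions:
  fixes Ev :: "(nat \<Rightarrow> real) \<Rightarrow> ((nat \<Rightarrow> real) \<Rightarrow> real) \<Rightarrow> bool"
  assumes d: "0 < d"
    and rot: "\<And>p q c s u Q. p < Suc m \<Longrightarrow> q < Suc m \<Longrightarrow> p \<noteq> q \<Longrightarrow> c\<^sup>2 + s\<^sup>2 = 1 \<Longrightarrow>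
      Ev u (\<lambda>v. Q (rotv p q c s v)) \<longleftrightarrow> Ev (rotv p q c s u) Q"
    and meas: "\<And>u. form_event (Suc m) (Ev u)"
    and scale: "\<And>a u u' A. a \<noteq> 0 \<Longrightarrow> (\<And>i. i < Suc m \<Longrightarrow> u' i = a * u i) \<Longrightarrow>
      Ev u' (qf (Suc m) A) \<longleftrightarrow> Ev u (qf (Suc m) A)"
    and u: "\<exists>i<Suc m. u i \<noteq> 0"
  shows "fail d (Suc m) (Ev u) = fail d (Suc m) (Ev (\<lambda>i. if i = m then 1 else 0))"
  using u
\<comment> \<open>Induction on the number of nonzero entries other than the last: a rotation in the
  plane of \<open>p\<close> and \<open>m\<close> moves the entry \<open>p\<close> into the last
  one.\<close>
proof (induction "card {i. i < m \<and> u i \<noteq> 0}" arbitrary: u)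
  case 0
  hence "{i. i < m \<and> u i \<noteq> 0} = {}" by simp
  hence z: "u i = 0" if "i < m" for i using that by blast
  with 0 have "u m \<noteq> 0" by (auto simp: less_Suc_eq)
  hence "Ev u (qf (Suc m) A) \<longleftrightarrow> Ev (\<lambda>i. if i = m then 1 else 0) (qf (Suc m) A)" for A
    by (rule scale) (use z in \<open>auto simp: less_Suc_eq\<close>)
  thus ?case by (simp add: fail_def)
next
  case (Suc k)
  have rotate: "fail d (Suc m) (Ev (rotv p m c s u)) = fail d (Suc m) (Ev u)"
    if "p < m" "c\<^sup>2 + s\<^sup>2 = 1" "c \<noteq> 0" for p c s u
  proof -
    have eq: "(\<lambda>Q. Ev u (\<lambda>v. Q (rotv p m c s v))) = Ev (rotv p m c s u)"
      using that by (intro ext rot) auto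
    have "fail d (Suc m) (\<lambda>Q. Ev u (\<lambda>v. Q (rotv p m c s v))) = fail d (Suc m) (Ev u)"
      by (rule fail_rotate[OF d]) (use that meas in \<open>auto simp: eq\<close>)
    thus ?thesis unfolding eq .
  qed
  have main: "fail d (Suc m) (Ev u) = fail d (Suc m) (Ev (\<lambda>i. if i = m then 1 else 0))"
    if p: "p < m" "u p \<noteq> 0" and um: "u m \<noteq> 0" and k: "card {i. i < m \<and> u i \<noteq> 0} = Suc k" for u p
  proof -
    define \<rho> where "\<rho> = sqrt ((u p)\<^sup>2 + (u m)\<^sup>2)"
    have \<rho>: "0 < \<rho>" "\<rho>\<^sup>2 = (u p)\<^sup>2 + (u m)\<^sup>2" using p by (auto simp: \<rho>_def add_pos_nonneg)
    define c where "c = u m / \<rho>"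
    define s where "s = - u p / \<rho>"
    have cs: "c\<^sup>2 + s\<^sup>2 = 1" "c \<noteq> 0"
      using \<rho> um by (auto simp: c_def s_def power_divide add_divide_distrib[symmetric] add.commute)
    let ?u = "rotv p m c s u"
    have up: "?u p = 0" using p by (simp add: rotv_def c_def s_def)
    have "- s * u p + c * u m = ((u p)\<^sup>2 + (u m)\<^sup>2) / \<rho>"
      by (simp add: c_def s_def add_divide_distrib power2_eq_square)
    also have "\<dots> = \<rho>" unfolding \<rho>(2)[symmetric] using \<rho>(1) by (simp add: power2_eq_square)
    finally have "- s * u p + c * u m = \<rho>" .
    hence "?u m = \<rho>" by (simp add: rotv_def)
    hence "\<exists>i<Suc m. ?u i \<noteq> 0" using \<rho> by auto
    moreover have "{i. i < m \<and> ?u i \<noteq> 0} = {i. i < m \<and> u i \<noteq> 0} - {p}"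
      using up by (auto simp: rotv_def)
    hence "k = card {i. i < m \<and> ?u i \<noteq> 0}" using k p by simp
    ultimately have "fail d (Suc m) (Ev ?u) = fail d (Suc m) (Ev (\<lambda>i. if i = m then 1 else 0))"
      using Suc.hyps(1)[of ?u] by simp
    thus ?thesis using rotate[OF p(1) cs, of u] by simp
  qed
  have "{i. i < m \<and> u i \<noteq> 0} \<noteq> {}" using Suc.hyps(2) by (metis card.empty nat.distinct(1))
  then obtain p where p: "p < m" "u p \<noteq> 0" by auto
  show ?case
  proof (cases "u m = 0")
    case False
    with main[OF p _ Suc.hyps(2)[symmetric]] show ?thesis by simp
  next
    case True
    \<comment> \<open>Here the annihilating rotation would have c = 0, which the invariance lemma
      excludes. Rotating by 45 degrees first makes the last entry nonzero and keeps the set of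
      nonzero entries before \<open>m\<close>.\<close>
    let ?c = "1 / sqrt 2 :: real"
    let ?u = "rotv p m ?c ?c u"
    have cc: "?c\<^sup>2 + ?c\<^sup>2 = 1" "?c \<noteq> 0" by (auto simp: power_divide)
    have u': "?u p = ?c * u p" "?u m = - ?c * u p" using True p by (auto simp: rotv_def)
    have "{i. i < m \<and> ?u i \<noteq> 0} = {i. i < m \<and> u i \<noteq> 0}"
      using p u' by (auto simp: rotv_def split: if_splits)
    hence "card {i. i < m \<and> ?u i \<noteq> 0} = Suc k" using Suc.hyps(2) by simp
    with main[of p ?u] u' p have "fail d (Suc m) (Ev ?u) = fail d (Suc m) (Ev (\<lambda>i. if i = m then 1 else 0))"
      by simp
    thus ?thesis using rotate[OF p(1) cc, of u] by simp
  qed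
qed

subsection \<open>Chernoff bounds for a new row\<close>

text \<open>The factor exp (\<tau> x^2) turns the density into 1 / sqrt k times a centred normal
  density of variance \<sigma>^2 / k, where k = 1 - 2 \<tau> \<sigma>^2.\<close>

lemma nn_integral_normal_exp_square:
  assumes \<sigma>: "0 < \<sigma>" and k: "2 * \<tau> * \<sigma>\<^sup>2 < 1"
  shows "(\<integral>\<^sup>+ x. ennreal (exp (\<tau> * x\<^sup>2)) \<partial>density lborel (\<lambda>x. ennreal (normal_density 0 \<sigma> x))) =
    ennreal (1 / sqrt (1 - 2 * \<tau> * \<sigma>\<^sup>2))"
proof -
  define k where "k = 1 - 2 * \<tau> * \<sigma>\<^sup>2"
  have k0: "0 < k" using k by (simp add: k_def)
  define \<sigma>' where "\<sigma>' = \<sigma> / sqrt k"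
  have \<sigma>'2: "\<sigma>'\<^sup>2 = \<sigma>\<^sup>2 / k" using k0 by (simp add: \<sigma>'_def power_divide)
  have *: "normal_density 0 \<sigma> x * exp (\<tau> * x\<^sup>2) = 1 / sqrt k * normal_density 0 \<sigma>' x" for x
  proof -
    have "- (x - 0)\<^sup>2 / (2 * \<sigma>'\<^sup>2) = - (x\<^sup>2 * k) / (2 * \<sigma>\<^sup>2)" unfolding \<sigma>'2 by simp
    also have "\<dots> = - (x - 0)\<^sup>2 / (2 * \<sigma>\<^sup>2) + \<tau> * x\<^sup>2" using \<sigma> by (simp add: k_def field_simps)
    finally have "exp (- (x - 0)\<^sup>2 / (2 * \<sigma>'\<^sup>2)) = exp (- (x - 0)\<^sup>2 / (2 * \<sigma>\<^sup>2)) * exp (\<tau> * x\<^sup>2)"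
      by (simp only: exp_add)
    moreover have "1 / sqrt (2 * pi * \<sigma>'\<^sup>2) = sqrt k * (1 / sqrt (2 * pi * \<sigma>\<^sup>2))"
      unfolding \<sigma>'2 by (simp add: real_sqrt_divide real_sqrt_mult)
    ultimately show ?thesis unfolding normal_density_def using k0 by simp
  qed
  have "(\<integral>\<^sup>+ x. ennreal (exp (\<tau> * x\<^sup>2)) \<partial>density lborel (\<lambda>x. ennreal (normal_density 0 \<sigma> x))) =
      (\<integral>\<^sup>+ x. ennreal (normal_density 0 \<sigma> x) * ennreal (exp (\<tau> * x\<^sup>2)) \<partial>lborel)"
    by (subst nn_integral_density) auto
  also have "\<dots> = (\<integral>\<^sup>+ x. ennreal (1 / sqrt k) * ennreal (normal_density 0 \<sigma>' x) \<partial>lborel)"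
    using k0 by (simp add: ennreal_mult'[symmetric] * normal_density_nonneg)
  also have "\<dots> = ennreal (1 / sqrt k) * (\<integral>\<^sup>+ x. ennreal (normal_density 0 \<sigma>' x) \<partial>lborel)"
    by (rule nn_integral_cmult) measurable
  also have "(\<integral>\<^sup>+ x. ennreal (normal_density 0 \<sigma>' x) \<partial>lborel) = 1"
  proof -
    have "0 < \<sigma>'" using \<sigma> k0 by (simp add: \<sigma>'_def)
    then interpret prob_space "density lborel (\<lambda>x. ennreal (normal_density 0 \<sigma>' x))"
      by (rule prob_space_normal_density)
    show ?thesis using emeasure_space_1 by (simp add: emeasure_density)
  qed
  finally show ?thesis by (simp add: k_def)
qed

text \<open>Markov's inequality for arbitrary predicates; a set that is not measurable has
  \<open>emeasure\<close> 0.\<close>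

lemma emeasure_le_nn_integral:
  assumes "\<And>x. x \<in> space M \<Longrightarrow> P x \<Longrightarrow> 1 \<le> F x"
  shows "emeasure M {x \<in> space M. P x} \<le> (\<integral>\<^sup>+ x. F x \<partial>M)"
proof (cases "{x \<in> space M. P x} \<in> sets M")
  case True
  have "emeasure M {x \<in> space M. P x} = (\<integral>\<^sup>+ x. indicator {x \<in> space M. P x} x \<partial>M)" using True by simp
  also have "\<dots> \<le> (\<integral>\<^sup>+ x. F x \<partial>M)"
    using assms by (intro nn_integral_mono) (auto simp: indicator_def)
  finally show ?thesis .
qed (simp add: emeasure_notin_sets)

section \<open>Tails of the entries of a border\<close>

definition border :: "nat \<Rightarrow> (nat \<times> nat) set" where
  "border n = (\<lambda>i. (i, n)) ` {..n}"

abbreviation border_law :: "nat \<Rightarrow> nat \<Rightarrow> (nat \<times> nat \<Rightarrow> real) measure" where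
  "border_law d n \<equiv> PiM (border n) (goe_entry d)"

lemma upper_Suc: "upper (Suc n) = border n \<union> upper n" "border n \<inter> upper n = {}"
  by (auto simp: upper_def border_def less_Suc_eq)

lemma finite_border [simp]: "finite (border n)"
  by (simp add: border_def)

lemma sum_border: "(\<Sum>p\<in>border n. g p) = (\<Sum>i<n. g (i, n)) + (g (n, n) :: 'a :: comm_monoid_add)"
  unfolding border_def by (subst sum.reindex) (auto simp: inj_on_def lessThan_Suc_atMost[symmetric])

lemma prod_border: "(\<Prod>p\<in>border n. g p) = (\<Prod>i<n. g (i, n)) * (g (n, n) :: 'a :: comm_monoid_mult)"
  unfolding border_def by (subst prod.reindex) (auto simp: inj_on_def lessThan_Suc_atMost[symmetric])

lemma goe_entry_product: "0 < d \<Longrightarrow> product_sigma_finite (goe_entry d)"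
  by (intro product_sigma_finite.intro prob_space_imp_sigma_finite prob_space_goe_entry)

text \<open>One exponential Markov bound with a weight for each entry. The tail estimates that
  follow are three choices of \<open>\<tau>\<close>: positive on the diagonal entry only, positive
  on the others, negative on the others.\<close>

lemma border_chernoff:
  assumes d: "0 < d" and \<tau>: "\<And>p. p \<in> border n \<Longrightarrow> 2 * \<tau> p * (goe_sd d p)\<^sup>2 < 1"
  shows "emeasure (border_law d n) {x \<in> space (border_law d n). C \<le> (\<Sum>p\<in>border n. \<tau> p * (x p)\<^sup>2)} \<le>
    ennreal (exp (- C) * (\<Prod>p\<in>border n. 1 / sqrt (1 - 2 * \<tau> p * (goe_sd d p)\<^sup>2)))"
proof -
  interpret product_sigma_finite "goe_entry d" by (rule goe_entry_product[OF d])
  have "emeasure (border_law d n) {x \<in> space (border_law d n). C \<le> (\<Sum>p\<in>border n. \<tau> p * (x p)\<^sup>2)} \<le>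
      (\<integral>\<^sup>+ x. ennreal (exp (- C)) * (\<Prod>p\<in>border n. ennreal (exp (\<tau> p * (x p)\<^sup>2))) \<partial>border_law d n)"
  proof (rule emeasure_le_nn_integral)
    fix x :: "nat \<times> nat \<Rightarrow> real" assume "C \<le> (\<Sum>p\<in>border n. \<tau> p * (x p)\<^sup>2)"
    hence "1 \<le> exp (- C) * exp (\<Sum>p\<in>border n. \<tau> p * (x p)\<^sup>2)" by (simp add: exp_add[symmetric])
    thus "1 \<le> ennreal (exp (- C)) * (\<Prod>p\<in>border n. ennreal (exp (\<tau> p * (x p)\<^sup>2)))"
      by (simp add: prod_ennreal exp_sum ennreal_mult'[symmetric])
  qed
  also have "\<dots> = ennreal (exp (- C)) * (\<integral>\<^sup>+ x. (\<Prod>p\<in>border n. ennreal (exp (\<tau> p * (x p)\<^sup>2))) \<partial>border_law d n)"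
    by (rule nn_integral_cmult) measurable
  also have "(\<integral>\<^sup>+ x. (\<Prod>p\<in>border n. ennreal (exp (\<tau> p * (x p)\<^sup>2))) \<partial>border_law d n) =
      (\<Prod>p\<in>border n. \<integral>\<^sup>+ x. ennreal (exp (\<tau> p * x\<^sup>2)) \<partial>goe_entry d p)"
    by (rule product_nn_integral_prod) auto
  also have "\<dots> = (\<Prod>p\<in>border n. ennreal (1 / sqrt (1 - 2 * \<tau> p * (goe_sd d p)\<^sup>2)))"
    using d \<tau> by (intro prod.cong refl nn_integral_normal_exp_square) auto
  also have "\<dots> = ennreal (\<Prod>p\<in>border n. 1 / sqrt (1 - 2 * \<tau> p * (goe_sd d p)\<^sup>2))"
  proof (rule prod_ennreal)
    fix p assume "p \<in> border n"
    from \<tau>[OF this] show "0 \<le> 1 / sqrt (1 - 2 * \<tau> p * (goe_sd d p)\<^sup>2)" by simp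
  qed
  finally show ?thesis by (simp add: ennreal_mult'[symmetric])
qed

text \<open>In the Chernoff exponents the linear terms cancel against the mean, so the quadratic
  error terms decide. The bound 1/4 keeps 2 t within the range, up to 1/2, of the logarithm
  estimate.\<close>

lemma inverse_sqrt_le_exp:
  assumes "0 \<le> t" "t \<le> 1 / 4"
  shows "1 / sqrt (1 - 2 * t) \<le> exp (t + 4 * t\<^sup>2)" "1 / sqrt (1 + 2 * t) \<le> exp (- t + 2 * t\<^sup>2)"
proof -
  have sqrt: "sqrt y = exp (ln y / 2)" if "0 < y" for y :: real
    using that by (simp add: powr_half_sqrt[symmetric] powr_def)
  have "- (2 * t) - 2 * (2 * t)\<^sup>2 \<le> ln (1 - 2 * t)"
    using assms by (intro ln_one_minus_pos_lower_bound) auto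
  hence "- (ln (1 - 2 * t) / 2) \<le> t + 4 * t\<^sup>2" by (simp add: power2_eq_square)
  moreover have "1 / sqrt (1 - 2 * t) = exp (- (ln (1 - 2 * t) / 2))"
    using assms by (subst sqrt) (auto simp: exp_minus inverse_eq_divide)
  ultimately show "1 / sqrt (1 - 2 * t) \<le> exp (t + 4 * t\<^sup>2)" by simp
  have "2 * t - (2 * t)\<^sup>2 \<le> ln (1 + 2 * t)"
    using assms by (intro ln_one_plus_pos_lower_bound) auto
  hence "- (ln (1 + 2 * t) / 2) \<le> - t + 2 * t\<^sup>2" by (simp add: power2_eq_square)
  moreover have "1 / sqrt (1 + 2 * t) = exp (- (ln (1 + 2 * t) / 2))"
    using assms by (subst sqrt) (auto simp: exp_minus inverse_eq_divide)
  ultimately show "1 / sqrt (1 + 2 * t) \<le> exp (- t + 2 * t\<^sup>2)" by simp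
qed

lemma border_diagonal_tail:
  assumes d: "0 < d" and h: "0 \<le> h"
  shows "emeasure (border_law d n) {x \<in> space (border_law d n). h < \<bar>x (n, n)\<bar>} \<le> ennreal (2 * exp (- (real d * h\<^sup>2 / 16)))"
proof -
  \<comment> \<open>With variance 2/d the weight d/8 gives 1 - 2 \<tau> \<sigma>^2 = 1/2, hence the
    factor sqrt 2.\<close>
  define \<tau> where "\<tau> = (\<lambda>p :: nat \<times> nat. if p = (n, n) then real d / 8 else 0)"
  have \<tau>: "2 * \<tau> p * (goe_sd d p)\<^sup>2 < 1" for p using d by (auto simp: \<tau>_def)
  have "{x \<in> space (border_law d n). h < \<bar>x (n, n)\<bar>} \<subseteq>
      {x \<in> space (border_law d n). real d / 8 * h\<^sup>2 \<le> (\<Sum>p\<in>border n. \<tau> p * (x p)\<^sup>2)}"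
  proof safe
    fix x :: "nat \<times> nat \<Rightarrow> real" assume "h < \<bar>x (n, n)\<bar>"
    hence "h\<^sup>2 \<le> (x (n, n))\<^sup>2" using h by (simp add: abs_le_square_iff[symmetric])
    hence "real d / 8 * h\<^sup>2 \<le> real d / 8 * (x (n, n))\<^sup>2" by (intro mult_left_mono) auto
    thus "real d / 8 * h\<^sup>2 \<le> (\<Sum>p\<in>border n. \<tau> p * (x p)\<^sup>2)"
      unfolding sum_border by (simp add: \<tau>_def)
  qed
  hence "emeasure (border_law d n) {x \<in> space (border_law d n). h < \<bar>x (n, n)\<bar>} \<le>
      emeasure (border_law d n) {x \<in> space (border_law d n). real d / 8 * h\<^sup>2 \<le> (\<Sum>p\<in>border n. \<tau> p * (x p)\<^sup>2)}"
    by (intro emeasure_mono) measurable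
  also have "\<dots> \<le> ennreal (exp (- (real d / 8 * h\<^sup>2)) * (\<Prod>p\<in>border n. 1 / sqrt (1 - 2 * \<tau> p * (goe_sd d p)\<^sup>2)))"
    by (rule border_chernoff[OF d \<tau>])
  also have "\<dots> \<le> ennreal (2 * exp (- (real d * h\<^sup>2 / 16)))"
  proof (rule ennreal_leI)
    have "(\<Prod>p\<in>border n. 1 / sqrt (1 - 2 * \<tau> p * (goe_sd d p)\<^sup>2)) = sqrt 2"
      unfolding prod_border using d by (simp add: \<tau>_def) (simp add: real_sqrt_divide)
    moreover have "sqrt 2 \<le> (2::real)" by (simp add: real_le_lsqrt)
    moreover have "exp (- (real d / 8 * h\<^sup>2)) \<le> exp (- (real d * h\<^sup>2 / 16))" by simp
    ultimately show "exp (- (real d / 8 * h\<^sup>2)) * (\<Prod>p\<in>border n. 1 / sqrt (1 - 2 * \<tau> p * (goe_sd d p)\<^sup>2)) \<le>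
        2 * exp (- (real d * h\<^sup>2 / 16))"
      using mult_mono[of "exp (- (real d / 8 * h\<^sup>2))" "exp (- (real d * h\<^sup>2 / 16))" "sqrt 2" 2] by (simp add: mult.commute)
  qed
  finally show ?thesis .
qed

lemma border_norm_upper_tail:
  assumes d: "0 < d" "n \<le> d" and h: "0 \<le> h" "h \<le> 1"
  shows "emeasure (border_law d n) {x \<in> space (border_law d n). 1 + h < (\<Sum>i<n. (x (i, n))\<^sup>2)} \<le> ennreal (exp (- (real d * h\<^sup>2 / 16)))"
proof -
  \<comment> \<open>Minimises the exponent d (4 t^2 - t h), which becomes - d h^2 / 16.\<close>
  define t where "t = h / 8"
  have t: "0 \<le> t" "t \<le> 1 / 4" using h by (auto simp: t_def)
  define \<tau> where "\<tau> = (\<lambda>p :: nat \<times> nat. if p = (n, n) then 0 else real d * t)"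
  have \<tau>': "2 * \<tau> (i, n) * (goe_sd d (i, n))\<^sup>2 = 2 * t" if "i < n" for i using d that by (simp add: \<tau>_def)
  have \<tau>: "2 * \<tau> p * (goe_sd d p)\<^sup>2 < 1" if p: "p \<in> border n" for p
  proof (cases "p = (n, n)")
    case False
    then obtain i where "p = (i, n)" "i < n" using p by (auto simp: border_def le_less)
    thus ?thesis using \<tau>'[of i] t by simp
  qed (simp add: \<tau>_def)
  have "{x \<in> space (border_law d n). 1 + h < (\<Sum>i<n. (x (i, n))\<^sup>2)} \<subseteq>
      {x \<in> space (border_law d n). real d * t * (1 + h) \<le> (\<Sum>p\<in>border n. \<tau> p * (x p)\<^sup>2)}"
  proof safe
    fix x :: "nat \<times> nat \<Rightarrow> real" assume "1 + h < (\<Sum>i<n. (x (i, n))\<^sup>2)"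
    hence "real d * t * (1 + h) \<le> real d * t * (\<Sum>i<n. (x (i, n))\<^sup>2)" using t by (intro mult_left_mono) auto
    thus "real d * t * (1 + h) \<le> (\<Sum>p\<in>border n. \<tau> p * (x p)\<^sup>2)"
      unfolding sum_border by (simp add: \<tau>_def sum_distrib_left)
  qed
  hence "emeasure (border_law d n) {x \<in> space (border_law d n). 1 + h < (\<Sum>i<n. (x (i, n))\<^sup>2)} \<le>
      emeasure (border_law d n) {x \<in> space (border_law d n). real d * t * (1 + h) \<le> (\<Sum>p\<in>border n. \<tau> p * (x p)\<^sup>2)}"
    by (intro emeasure_mono) measurable
  also have "\<dots> \<le> ennreal (exp (- (real d * t * (1 + h))) * (\<Prod>p\<in>border n. 1 / sqrt (1 - 2 * \<tau> p * (goe_sd d p)\<^sup>2)))"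
    by (rule border_chernoff[OF d(1) \<tau>])
  also have "\<dots> \<le> ennreal (exp (- (real d * h\<^sup>2 / 16)))"
  proof (rule ennreal_leI)
    have "(\<Prod>p\<in>border n. 1 / sqrt (1 - 2 * \<tau> p * (goe_sd d p)\<^sup>2)) = (\<Prod>i<n. 1 / sqrt (1 - 2 * t))"
      unfolding prod_border using \<tau>' by (simp add: \<tau>_def)
    also have "\<dots> \<le> (\<Prod>i<n. exp (t + 4 * t\<^sup>2))"
      using inverse_sqrt_le_exp(1)[OF t] t by (intro prod_mono) auto
    also have "\<dots> = exp (real n * (t + 4 * t\<^sup>2))" by (simp add: exp_of_nat_mult[symmetric])
    also have "\<dots> \<le> exp (real d * (t + 4 * t\<^sup>2))" using d t by (simp add: mult_right_mono)
    finally have "exp (- (real d * t * (1 + h))) * (\<Prod>p\<in>border n. 1 / sqrt (1 - 2 * \<tau> p * (goe_sd d p)\<^sup>2)) \<le>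
        exp (- (real d * t * (1 + h))) * exp (real d * (t + 4 * t\<^sup>2))" by simp
    also have "\<dots> = exp (- (real d * h\<^sup>2 / 16))"
      unfolding exp_add[symmetric] by (simp add: t_def power2_eq_square algebra_simps)
    finally show "exp (- (real d * t * (1 + h))) * (\<Prod>p\<in>border n. 1 / sqrt (1 - 2 * \<tau> p * (goe_sd d p)\<^sup>2)) \<le>
        exp (- (real d * h\<^sup>2 / 16))" .
  qed
  finally show ?thesis .
qed

text \<open>The mean of the sum is n/d \<ge> 1 - h, so falling below 1 - 2 h is a deviation by at
  least \<open>h\<close>.\<close>

lemma border_norm_lower_tail:
  assumes d: "0 < d" and n: "real d * (1 - h) \<le> real n" and h: "0 \<le> h" "h \<le> 1"
  shows "emeasure (border_law d n) {x \<in> space (border_law d n). (\<Sum>i<n. (x (i, n))\<^sup>2) < 1 - 2 * h} \<le> ennreal (exp (- (real d * h\<^sup>2 / 16)))"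
proof -
  \<comment> \<open>Minimises 2 t^2 - t h; the remaining term - 2 h t^2 of the exponent only
    helps.\<close>
  define t where "t = h / 4"
  have t: "0 \<le> t" "t \<le> 1 / 4" using h by (auto simp: t_def)
  define \<tau> where "\<tau> = (\<lambda>p :: nat \<times> nat. if p = (n, n) then 0 else - (real d * t))"
  have \<tau>': "2 * \<tau> (i, n) * (goe_sd d (i, n))\<^sup>2 = - (2 * t)" if "i < n" for i using d that by (simp add: \<tau>_def)
  have \<tau>: "2 * \<tau> p * (goe_sd d p)\<^sup>2 < 1" if p: "p \<in> border n" for p
  proof (cases "p = (n, n)")
    case False
    then obtain i where "p = (i, n)" "i < n" using p by (auto simp: border_def le_less)
    thus ?thesis using \<tau>'[of i] t by simp
  qed (simp add: \<tau>_def)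
  have "{x \<in> space (border_law d n). (\<Sum>i<n. (x (i, n))\<^sup>2) < 1 - 2 * h} \<subseteq>
      {x \<in> space (border_law d n). - (real d * t * (1 - 2 * h)) \<le> (\<Sum>p\<in>border n. \<tau> p * (x p)\<^sup>2)}"
  proof safe
    fix x :: "nat \<times> nat \<Rightarrow> real" assume "(\<Sum>i<n. (x (i, n))\<^sup>2) < 1 - 2 * h"
    hence "real d * t * (\<Sum>i<n. (x (i, n))\<^sup>2) \<le> real d * t * (1 - 2 * h)" using t by (intro mult_left_mono) auto
    thus "- (real d * t * (1 - 2 * h)) \<le> (\<Sum>p\<in>border n. \<tau> p * (x p)\<^sup>2)"
      unfolding sum_border by (simp add: \<tau>_def sum_distrib_left sum_negf)
  qed
  hence "emeasure (border_law d n) {x \<in> space (border_law d n). (\<Sum>i<n. (x (i, n))\<^sup>2) < 1 - 2 * h} \<le>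
      emeasure (border_law d n) {x \<in> space (border_law d n). - (real d * t * (1 - 2 * h)) \<le> (\<Sum>p\<in>border n. \<tau> p * (x p)\<^sup>2)}"
    by (intro emeasure_mono) measurable
  also have "\<dots> \<le> ennreal (exp (- (- (real d * t * (1 - 2 * h)))) * (\<Prod>p\<in>border n. 1 / sqrt (1 - 2 * \<tau> p * (goe_sd d p)\<^sup>2)))"
    by (rule border_chernoff[OF d(1) \<tau>])
  also have "\<dots> \<le> ennreal (exp (- (real d * h\<^sup>2 / 16)))"
  proof (rule ennreal_leI)
    have t2: "0 \<le> t - 2 * t\<^sup>2" using t mult_left_mono[of t "1/4" t] by (simp add: power2_eq_square)
    have "(\<Prod>p\<in>border n. 1 / sqrt (1 - 2 * \<tau> p * (goe_sd d p)\<^sup>2)) = (\<Prod>i<n. 1 / sqrt (1 + 2 * t))"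
      unfolding prod_border using \<tau>' by (simp add: \<tau>_def)
    also have "\<dots> \<le> (\<Prod>i<n. exp (- t + 2 * t\<^sup>2))"
      using inverse_sqrt_le_exp(2)[OF t] t by (intro prod_mono) auto
    also have "\<dots> = exp (real n * (- t + 2 * t\<^sup>2))" by (simp add: exp_of_nat_mult[symmetric])
    also have "\<dots> \<le> exp (- (real d * (1 - h) * (t - 2 * t\<^sup>2)))"
      using mult_right_mono[OF n t2] by (simp add: algebra_simps)
    finally have "exp (- (- (real d * t * (1 - 2 * h)))) * (\<Prod>p\<in>border n. 1 / sqrt (1 - 2 * \<tau> p * (goe_sd d p)\<^sup>2)) \<le>
        exp (- (- (real d * t * (1 - 2 * h)))) * exp (- (real d * (1 - h) * (t - 2 * t\<^sup>2)))" by simp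
    also have "\<dots> \<le> exp (- (real d * h\<^sup>2 / 16))"
    proof -
      have "t * (1 - 2 * h) - (1 - h) * (t - 2 * t\<^sup>2) = - (h\<^sup>2 / 8) - h * h\<^sup>2 / 8"
        by (simp add: t_def power2_eq_square field_simps)
      also have "\<dots> \<le> - (h\<^sup>2 / 16)"
      proof -
        have "0 \<le> h\<^sup>2" "0 \<le> h * h\<^sup>2" using h by auto
        thus ?thesis by linarith
      qed
      finally have "real d * (t * (1 - 2 * h) - (1 - h) * (t - 2 * t\<^sup>2)) \<le> real d * (- (h\<^sup>2 / 16))"
        by (intro mult_left_mono) auto
      thus ?thesis unfolding exp_add[symmetric] by (simp add: algebra_simps)
    qed
    finally show "exp (- (- (real d * t * (1 - 2 * h)))) * (\<Prod>p\<in>border n. 1 / sqrt (1 - 2 * \<tau> p * (goe_sd d p)\<^sup>2)) \<le>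
        exp (- (real d * h\<^sup>2 / 16))" .
  qed
  finally show ?thesis .
qed

subsection \<open>Adding a row and a column\<close>

lemma qf_Suc:
  assumes "\<And>i. i < n \<Longrightarrow> A (n, i) = A (i, n)"
  shows "qf (Suc n) A v = qf n A v + 2 * v n * (\<Sum>i<n. A (i, n) * v i) + A (n, n) * (v n)\<^sup>2"
proof -
  have "(\<Sum>j<n. A (n, j) * v j) = (\<Sum>i<n. A (i, n) * v i)" using assms by (intro sum.cong) auto
  moreover have "(\<Sum>i<n. v i * (A (i, n) * v n)) = v n * (\<Sum>i<n. A (i, n) * v i)"
    by (simp add: sum_distrib_left mult_ac)
  ultimately show ?thesis
    by (simp add: ip_def mv_def sum.distrib distrib_left power2_eq_square algebra_simps)
qed

lemma qf_symx_merge: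
  "qf (Suc n) (symx (merge (border n) (upper n) (x, y))) v =
    qf n (symx y) v + 2 * v n * ip n (\<lambda>i. x (i, n)) v + x (n, n) * (v n)\<^sup>2"
proof -
  let ?A = "symx (merge (border n) (upper n) (x, y))"
  have border: "?A (i, n) = x (i, n)" "?A (n, i) = x (i, n)" if "i \<le> n" for i
    using that by (auto simp: symx_def merge_def border_def)
  have "qf n ?A v = qf n (symx y) v"
  proof (intro ip_cong mv_cong refl)
    fix i j assume "i < n" "j < n"
    hence "(min i j, max i j) \<in> upper n" by (auto simp: upper_def)
    moreover from this have "(min i j, max i j) \<notin> border n" using upper_Suc(2) by blast
    ultimately show "?A (i, j) = symx y (i, j)" by (simp add: symx_def merge_def)
  qed
  thus ?thesis by (subst qf_Suc) (simp_all add: border ip_def)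
qed

lemma fail_set_measurable:
  assumes "form_event n Ev"
  shows "{w \<in> space (tri d n). \<not> Ev (qf n (symx w))} \<in> sets (tri d n)"
proof -
  have "{w \<in> space (tri d n). \<not> Ev (qf n (symx w))} =
      space (PiM (upper n) (\<lambda>_. borel :: real measure)) - {w \<in> space (PiM (upper n) (\<lambda>_. borel)). Ev (qf n (symx w))}"
    by (auto simp: space_tri space_PiM)
  thus ?thesis using assms unfolding sets_tri form_event_def by simp
qed

lemma fail_mono:
  assumes "form_event n Ev" "\<And>Q. Ev Q \<Longrightarrow> Ev' Q"
  shows "fail d n Ev' \<le> fail d n Ev"
  unfolding fail_def
proof (rule emeasure_mono)
  show "{w \<in> space (tri d n). \<not> Ev (qf n (symx w))} \<in> sets (tri d n)"
    by (rule fail_set_measurable[OF assms(1)])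
qed (use assms in auto)

text \<open>Border and smaller corner are independent, so the border can be integrated last. The
  event \<open>Ev'\<close> of the corner may depend on the border \<open>x\<close>; only its bound
  \<open>\<beta>\<close> is uniform.\<close>

lemma fail_Suc_le:
  assumes d: "0 < d" and Ev: "form_event (Suc n) Ev"
    and bad: "emeasure (border_law d n) {x \<in> space (border_law d n). Bad x} \<le> \<alpha>"
      "{x \<in> space (border_law d n). Bad x} \<in> sets (border_law d n)"
    and good: "\<And>x. \<not> Bad x \<Longrightarrow> \<exists>Ev'. form_event n Ev' \<and> fail d n Ev' \<le> \<beta> \<and>
      (\<forall>A. Ev' (qf n A) \<longrightarrow> Ev (\<lambda>v. qf n A v + 2 * v n * ip n (\<lambda>i. x (i, n)) v + x (n, n) * (v n)\<^sup>2))"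
  shows "fail d (Suc n) Ev \<le> \<alpha> + \<beta>"
proof -
  interpret product_sigma_finite "goe_entry d" by (rule goe_entry_product[OF d])
  interpret tri: prob_space "tri d n" by (rule prob_space_tri[OF d])
  interpret border: prob_space "border_law d n" by (intro prob_space_PiM prob_space_goe_entry d)
  let ?S = "{w \<in> space (tri d (Suc n)). \<not> Ev (qf (Suc n) (symx w))}"
  let ?B = "{x \<in> space (border_law d n). Bad x}"
  let ?m = "merge (border n) (upper n)"
  have tri_Suc: "tri d (Suc n) = PiM (border n \<union> upper n) (goe_entry d)"
    by (simp add: tri_def upper_Suc(1))
  have S: "?S \<in> sets (tri d (Suc n))" by (rule fail_set_measurable[OF Ev])
  hence S': "indicator ?S \<in> borel_measurable (PiM (border n \<union> upper n) (goe_entry d))"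
    unfolding tri_Suc[symmetric] by (rule borel_measurable_indicator)
  have inner: "(\<integral>\<^sup>+ y. indicator ?S (?m (x, y)) \<partial>tri d n) \<le> indicator ?B x + \<beta>"
    if x: "x \<in> space (border_law d n)" for x
  proof (cases "Bad x")
    case True
    have "(\<integral>\<^sup>+ y. indicator ?S (?m (x, y)) \<partial>tri d n) \<le> (\<integral>\<^sup>+ y. 1 \<partial>tri d n)"
      by (intro nn_integral_mono) (simp add: indicator_def)
    also have "\<dots> = 1" using tri.emeasure_space_1 by simp
    also have "1 \<le> indicator ?B x + \<beta>" using x True by simp
    finally show ?thesis .
  next
    case False
    from good[OF this] obtain Ev' where Ev': "form_event n Ev'" "fail d n Ev' \<le> \<beta>"
      "\<And>A. Ev' (qf n A) \<Longrightarrow> Ev (\<lambda>v. qf n A v + 2 * v n * ip n (\<lambda>i. x (i, n)) v + x (n, n) * (v n)\<^sup>2)" by blast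
    let ?S' = "{w \<in> space (tri d n). \<not> Ev' (qf n (symx w))}"
    have meas: "?S' \<in> sets (tri d n)" by (rule fail_set_measurable[OF Ev'(1)])
    have "(\<integral>\<^sup>+ y. indicator ?S (?m (x, y)) \<partial>tri d n) \<le> (\<integral>\<^sup>+ y. indicator ?S' y \<partial>tri d n)"
    proof (rule nn_integral_mono)
      fix y assume y: "y \<in> space (tri d n)"
      have "Ev (qf (Suc n) (symx (?m (x, y))))" if "Ev' (qf n (symx y))"
        using Ev'(3)[OF that] unfolding qf_symx_merge .
      thus "indicator ?S (?m (x, y)) \<le> (indicator ?S' y :: ennreal)"
        using y by (auto simp: indicator_def)
    qed
    also have "\<dots> = fail d n Ev'" using meas by (simp add: fail_def)
    finally show ?thesis using Ev'(2) False by simp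
  qed
  have "fail d (Suc n) Ev = (\<integral>\<^sup>+ w. indicator ?S w \<partial>PiM (border n \<union> upper n) (goe_entry d))"
    unfolding fail_def tri_Suc[symmetric] using S by simp
  also have "\<dots> = (\<integral>\<^sup>+ x. \<integral>\<^sup>+ y. indicator ?S (?m (x, y)) \<partial>tri d n \<partial>border_law d n)"
    unfolding tri_def[of d n]
    by (rule product_nn_integral_fold[OF upper_Suc(2) _ _ S']) auto
  also have "\<dots> \<le> (\<integral>\<^sup>+ x. indicator ?B x + \<beta> \<partial>border_law d n)"
    by (rule nn_integral_mono) (rule inner)
  also have "\<dots> = (\<integral>\<^sup>+ x. indicator ?B x \<partial>border_law d n) + (\<integral>\<^sup>+ x. \<beta> \<partial>border_law d n)"
    using bad(2) by (intro nn_integral_add) auto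
  also have "\<dots> = emeasure (border_law d n) ?B + \<beta>"
    using bad(2) border.emeasure_space_1 by simp
  also have "\<dots> \<le> \<alpha> + \<beta>" using bad(1) by (rule add_right_mono)
  finally show ?thesis .
qed

lemma emeasure_disj_le:
  assumes "{x \<in> space M. P x} \<in> sets M" "{x \<in> space M. R x} \<in> sets M"
    and "emeasure M {x \<in> space M. P x} \<le> ennreal a" "emeasure M {x \<in> space M. R x} \<le> ennreal b"
    and "0 \<le> a" "0 \<le> b" "a + b \<le> c"
  shows "emeasure M {x \<in> space M. P x \<or> R x} \<le> ennreal c"
proof -
  have "{x \<in> space M. P x \<or> R x} = {x \<in> space M. P x} \<union> {x \<in> space M. R x}" by auto
  hence "emeasure M {x \<in> space M. P x \<or> R x} \<le> emeasure M {x \<in> space M. P x} + emeasure M {x \<in> space M. R x}"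
    using emeasure_subadditive[OF assms(1,2)] by simp
  also have "\<dots> \<le> ennreal a + ennreal b" using assms by (intro add_mono) auto
  also have "\<dots> \<le> ennreal c" using assms by (simp add: ennreal_plus[symmetric] ennreal_leI del: ennreal_plus)
  finally show ?thesis .
qed

lemma border_measurable:
  "{x \<in> space (border_law d n). h < \<bar>x (n, n)\<bar>} \<in> sets (border_law d n)"
  "{x \<in> space (border_law d n). k < (\<Sum>i<n. (x (i, n))\<^sup>2)} \<in> sets (border_law d n)"
  "{x \<in> space (border_law d n). (\<Sum>i<n. (x (i, n))\<^sup>2) < k} \<in> sets (border_law d n)"
proof -
  have [measurable]: "(\<lambda>x. x (i, n)) \<in> borel_measurable (border_law d n)" if "i \<le> n" for i
  proof -
    have "(i, n) \<in> border n" using that by (auto simp: border_def)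
    from measurable_component_singleton[OF this, of "goe_entry d"] show ?thesis by simp
  qed
  have [measurable]: "(\<lambda>x. \<Sum>i<n. (x (i, n))\<^sup>2) \<in> borel_measurable (border_law d n)"
    by (intro borel_measurable_sum borel_measurable_power) simp
  have [measurable]: "(\<lambda>x. x (n, n)) \<in> borel_measurable (border_law d n)" by simp
  show "{x \<in> space (border_law d n). h < \<bar>x (n, n)\<bar>} \<in> sets (border_law d n)"
    "{x \<in> space (border_law d n). k < (\<Sum>i<n. (x (i, n))\<^sup>2)} \<in> sets (border_law d n)"
    "{x \<in> space (border_law d n). (\<Sum>i<n. (x (i, n))\<^sup>2) < k} \<in> sets (border_law d n)"
    by measurable
qed

abbreviation unit_last :: "nat \<Rightarrow> nat \<Rightarrow> real" where
  "unit_last n \<equiv> (\<lambda>i. if i = n then 1 else 0)"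

lemma ip_Suc: "ip (Suc n) u v = ip n u v + u n * v n"
  by (simp add: ip_def)

lemma ip_unit_last: "ip (Suc n) (unit_last n) v = v n"
  unfolding ip_Suc by (simp add: ip_def)

text \<open>The Schur complement: for the last coordinate vector \<open>v\<close>, border \<open>b\<close> and diagonal entry \<open>a\<close>,
  \<open>v\<^sup>T (z - W)\<^sup>-\<^sup>1 v = 1 / (z - a - b\<^sup>T (z - W')\<^sup>-\<^sup>1 b)\<close>, where \<open>W'\<close> is the smaller corner.\<close>
lemma E_up_step:
  assumes IH: "E_up n z T \<sigma> b Q" and \<sigma>: "\<bar>\<sigma>\<bar> = 1" and a: "\<bar>a\<bar> \<le> h" and b: "ip n b b \<le> 1 + h"
    and T: "0 < T" "1 \<le> T * (z - h - (1 + h) * T)"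
  shows "E_up (Suc n) z T \<sigma> (unit_last n) (\<lambda>v. Q v + 2 * v n * ip n b v + a * (v n)\<^sup>2)"
proof -
  have main: "(v n)\<^sup>2 \<le> T * (z * ip (Suc n) v v - \<sigma> * (Q v + 2 * v n * ip n b v + a * (v n)\<^sup>2))" for v
  proof -
    define D where "D = z * ip n v v - \<sigma> * Q v"
    define p where "p = \<sigma> * ip n b v"
    define \<beta> where "\<beta> = ip n b b"
    define s where "s = v n"
    have \<sigma>2: "\<sigma>\<^sup>2 = 1" using \<sigma> by (metis power2_abs one_power2)
    have D0: "0 \<le> D" and "(ip n b v)\<^sup>2 \<le> T * \<beta> * D"
      using IH unfolding E_up_def D_def \<beta>_def by blast+
    hence p2: "p\<^sup>2 \<le> T * \<beta> * D" by (simp add: p_def power_mult_distrib \<sigma>2)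
    have \<beta>0: "0 \<le> \<beta>" by (simp add: \<beta>_def ip_self_nonneg)
    \<comment> \<open>The cross term is controlled by \<open>p\<^sup>2 \<le> T * \<beta> * D\<close>
      and 4 x y \<le> (x + y)^2; this replaces the minimisation over the smaller corner in the Schur
      complement.\<close>
    have "(2 * s * p)\<^sup>2 \<le> (D + T * \<beta> * s\<^sup>2)\<^sup>2"
    proof -
      have "(2 * s * p)\<^sup>2 = 4 * s\<^sup>2 * p\<^sup>2" by (simp add: power_mult_distrib)
      also have "\<dots> \<le> 4 * s\<^sup>2 * (T * \<beta> * D)" using p2 by (intro mult_left_mono) auto
      also have "\<dots> \<le> (D + T * \<beta> * s\<^sup>2)\<^sup>2"
        using zero_le_power2[of "D - T * \<beta> * s\<^sup>2"] by (simp add: power2_eq_square algebra_simps)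
      finally show ?thesis .
    qed
    hence "\<bar>2 * s * p\<bar> \<le> \<bar>D + T * \<beta> * s\<^sup>2\<bar>" by (simp only: abs_le_square_iff)
    also have "\<bar>D + T * \<beta> * s\<^sup>2\<bar> = D + T * \<beta> * s\<^sup>2" using D0 \<beta>0 T by simp
    finally have "\<bar>2 * s * p\<bar> \<le> D + T * \<beta> * s\<^sup>2" .
    hence 1: "- (T * \<beta> * s\<^sup>2) \<le> D - 2 * s * p" by linarith
    have 2: "(z - h - (1 + h) * T) * s\<^sup>2 \<le> (z - \<sigma> * a - T * \<beta>) * s\<^sup>2"
    proof (intro mult_right_mono)
      have "\<bar>\<sigma> * a\<bar> \<le> h" using \<sigma> a by (simp add: abs_mult)
      moreover have "T * \<beta> \<le> (1 + h) * T" using b T by (simp add: \<beta>_def mult.commute mult_right_mono)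
      ultimately show "z - h - (1 + h) * T \<le> z - \<sigma> * a - T * \<beta>" by linarith
    qed simp
    have "s\<^sup>2 \<le> T * (z - h - (1 + h) * T) * s\<^sup>2" using mult_right_mono[OF T(2), of "s\<^sup>2"] by simp
    also have "\<dots> \<le> T * ((z - \<sigma> * a - T * \<beta>) * s\<^sup>2)" using 2 T by (simp add: mult.assoc)
    also have "\<dots> \<le> T * (D - 2 * s * p + (z - \<sigma> * a) * s\<^sup>2)"
      using 1 T by (intro mult_left_mono) (auto simp: algebra_simps)
    also have "D - 2 * s * p + (z - \<sigma> * a) * s\<^sup>2 =
        z * ip (Suc n) v v - \<sigma> * (Q v + 2 * v n * ip n b v + a * (v n)\<^sup>2)"
      by (simp add: D_def p_def s_def ip_Suc power2_eq_square algebra_simps)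
    finally show ?thesis by (simp add: s_def)
  qed
  have "0 \<le> z * ip (Suc n) v v - \<sigma> * (Q v + 2 * v n * ip n b v + a * (v n)\<^sup>2)" for v
    using order_trans[OF zero_le_power2 main] T by (simp add: zero_le_mult_iff)
  thus ?thesis using main by (auto simp: E_up_def ip_unit_last)
qed

lemma E_low_step:
  assumes IH: "E_low n z s' b (qf n A)" and a: "\<bar>a\<bar> \<le> h" and b: "1 - 2 * h \<le> ip n b b"
    and s: "0 < s" "0 \<le> s'" "s * (z + h - s' * (1 - 2 * h)) \<le> 1"
  shows "E_low (Suc n) z s (unit_last n) (\<lambda>v. qf n A v + 2 * v n * ip n b v + a * (v n)\<^sup>2)"
proof -
  obtain y where y: "s' * ip n b b < 2 * ip n b y - (z * ip n y y - qf n A y)"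
    using IH by (auto simp: E_low_def)
  define \<Delta> where "\<Delta> = 2 * ip n b y - (z * ip n y y - qf n A y)"
  have "s' * (1 - 2 * h) \<le> s' * ip n b b" using b s by (intro mult_left_mono) auto
  hence \<Delta>: "s' * (1 - 2 * h) < \<Delta>" using y by (simp add: \<Delta>_def)
  \<comment> \<open>The Schur complement predicts a maximiser proportional to (y, 1) with y = (z -
    W')^-1 b. With factor \<open>s\<close> the functional is
    \<open>2 * s - s\<^sup>2 * (z - a - \<Delta>)\<close>, which exceeds \<open>s\<close> when s (z
    - a - \<Delta>) < 1.\<close>
  define v where "v = (\<lambda>i. if i = n then s else s * y i)"
  have vy: "ip n v v = s\<^sup>2 * ip n y y" "ip n b v = s * ip n b y" "qf n A v = s\<^sup>2 * qf n A y"
  proof -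
    have 1: "ip n v v = ip n (\<lambda>i. s * y i) (\<lambda>i. s * y i)" by (rule ip_cong) (auto simp: v_def)
    have 2: "ip n b v = ip n b (\<lambda>i. s * y i)" by (rule ip_cong) (auto simp: v_def)
    have 3: "qf n A v = qf n A (\<lambda>i. s * y i)" by (intro ip_cong mv_cong) (auto simp: v_def)
    show "ip n v v = s\<^sup>2 * ip n y y" "ip n b v = s * ip n b y" "qf n A v = s\<^sup>2 * qf n A y"
      unfolding 1 2 3 mv_scale ip_scale_left ip_scale_right by (simp_all add: power2_eq_square)
  qed
  have vn: "v n = s" by (simp add: v_def)
  have "2 * v n - (z * ip (Suc n) v v - (qf n A v + 2 * v n * ip n b v + a * (v n)\<^sup>2)) = 2 * s - s\<^sup>2 * (z - a - \<Delta>)"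
    unfolding vy ip_Suc vn by (simp add: \<Delta>_def power2_eq_square algebra_simps)
  also have "s < \<dots>"
  proof -
    have "z - a - \<Delta> < z + h - s' * (1 - 2 * h)" using a \<Delta> by linarith
    hence "s\<^sup>2 * (z - a - \<Delta>) < s\<^sup>2 * (z + h - s' * (1 - 2 * h))" using s by (intro mult_strict_left_mono) auto
    also have "\<dots> \<le> s" using mult_left_mono[OF s(3), of s] s by (simp add: power2_eq_square mult.assoc)
    finally show ?thesis by linarith
  qed
  finally show ?thesis unfolding E_low_def ip_unit_last by (intro exI[of _ v]) simp
qed

text \<open>Along a small multiple of \<open>u\<close> the linear term beats the quadratic one. The
  level 0 is the free starting point of the lower induction.\<close>

lemma E_low_zero:
  assumes "\<exists>i<n. u i \<noteq> 0"
  shows "E_low n z 0 u (qf n A)"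
proof -
  define p where "p = ip n u u"
  define C where "C = z * ip n u u - qf n A u"
  have p: "0 < p" using assms unfolding p_def ip_self_pos_iff .
  define \<tau> where "\<tau> = p / (\<bar>C\<bar> + 1)"
  have \<tau>: "0 < \<tau>" using p by (auto simp: \<tau>_def)
  have "\<tau> * C \<le> p"
  proof -
    have "\<tau> * C \<le> \<tau> * (\<bar>C\<bar> + 1)" using \<tau> by (intro mult_left_mono) auto
    thus ?thesis by (simp add: \<tau>_def)
  qed
  hence "\<tau> * (\<tau> * C) \<le> \<tau> * p" using \<tau> by (intro mult_left_mono) auto
  moreover have "0 < \<tau> * p" using \<tau> p by simp
  ultimately have "0 < 2 * (\<tau> * p) - \<tau> * (\<tau> * C)" by linarith
  thus ?thesis unfolding E_low_def
    by (intro exI[of _ "\<lambda>i. \<tau> * u i"])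
      (simp only: mv_scale ip_scale_left ip_scale_right p_def C_def, simp add: algebra_simps)
qed

section \<open>Homogeneity in the direction\<close>

lemma ip_scaled:
  assumes "\<And>i. i < n \<Longrightarrow> u' i = a * u i"
  shows "ip n u' v = a * ip n u v" "ip n u' u' = a\<^sup>2 * ip n u u"
proof -
  have "ip n u' v = ip n (\<lambda>i. a * u i) v" for v by (rule ip_cong) (auto simp: assms)
  hence *: "ip n u' v = a * ip n u v" for v by (simp add: ip_scale_left)
  show "ip n u' v = a * ip n u v" by (rule *)
  show "ip n u' u' = a\<^sup>2 * ip n u u"
    unfolding * by (subst ip_commute, subst *) (simp add: power2_eq_square)
qed

lemma E_up_scale:
  assumes "a \<noteq> 0" "\<And>i. i < n \<Longrightarrow> u' i = a * u i"
  shows "E_up n z T \<sigma> u' Q \<longleftrightarrow> E_up n z T \<sigma> u Q"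
proof -
  have sc: "ip n u' v = a * ip n u v" "ip n u' u' = a\<^sup>2 * ip n u u" for v
    using assms(2) by (auto intro: ip_scaled)
  have "(ip n u' v)\<^sup>2 \<le> T * ip n u' u' * X \<longleftrightarrow> (ip n u v)\<^sup>2 \<le> T * ip n u u * X" for v X
  proof -
    have "(ip n u' v)\<^sup>2 \<le> T * ip n u' u' * X \<longleftrightarrow> a\<^sup>2 * (ip n u v)\<^sup>2 \<le> a\<^sup>2 * (T * ip n u u * X)"
      unfolding sc(2) unfolding sc(1) by (simp add: power_mult_distrib mult_ac)
    also have "\<dots> \<longleftrightarrow> (ip n u v)\<^sup>2 \<le> T * ip n u u * X" using assms(1) by (simp add: mult.assoc)
    finally show ?thesis .
  qed
  thus ?thesis by (simp add: E_up_def)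
qed

lemma E_low_scale:
  assumes "a \<noteq> 0" and u': "\<And>i. i < n \<Longrightarrow> u' i = a * u i" and low: "E_low n z s u (qf n A)"
  shows "E_low n z s u' (qf n A)"
proof -
  obtain v where v: "s * ip n u u < 2 * ip n u v - (z * ip n v v - qf n A v)"
    using low by (auto simp: E_low_def)
  have sc: "ip n u' w = a * ip n u w" "ip n u' u' = a\<^sup>2 * ip n u u" for w
    using u' by (auto intro: ip_scaled)
  let ?v = "\<lambda>i. a * v i"
  have "s * ip n u' u' = a\<^sup>2 * (s * ip n u u)"
    unfolding sc(2) by simp
  also have "\<dots> < a\<^sup>2 * (2 * ip n u v - (z * ip n v v - qf n A v))"
    using v assms(1) by (intro mult_strict_left_mono) auto
  also have "\<dots> = 2 * ip n u' ?v - (z * ip n ?v ?v - qf n A ?v)"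
    unfolding sc(1) mv_scale ip_scale_left ip_scale_right
    by (simp add: power2_eq_square algebra_simps)
  finally show ?thesis unfolding E_low_def by blast
qed

lemma E_low_scale_iff:
  assumes "a \<noteq> 0" "\<And>i. i < n \<Longrightarrow> u' i = a * u i"
  shows "E_low n z s u' (qf n A) \<longleftrightarrow> E_low n z s u (qf n A)"
  using E_low_scale[of a n u' u] E_low_scale[of "1 / a" n u u'] assms by auto

section \<open>Induction over the size of the corner\<close>

lemma sets_Collect_disjI:
  assumes "{x \<in> space M. P x} \<in> sets M" "{x \<in> space M. R x} \<in> sets M"
  shows "{x \<in> space M. P x \<or> R x} \<in> sets M"
proof -
  have "{x \<in> space M. P x \<or> R x} = {x \<in> space M. P x} \<union> {x \<in> space M. R x}" by auto
  thus ?thesis using assms by simp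
qed

text \<open>The hypothesis on \<open>T\<close> says that \<open>T\<close> is a supersolution of the
  Schur recursion even with border errors \<open>h\<close>, so the same \<open>T\<close> serves at
  every size. With \<kappa> = exp (- d h^2 / 16), each step costs 2 \<kappa> for the diagonal entry
  and \<kappa> for the norm of the border.\<close>

lemma fail_E_up:
  assumes d: "0 < d" and h: "0 \<le> h" "h \<le> 1" and \<sigma>: "\<bar>\<sigma>\<bar> = 1"
    and T: "0 < T" "1 \<le> T * (z - h - (1 + h) * T)"
  shows "n \<le> d \<Longrightarrow> fail d n (E_up n z T \<sigma> u) \<le> ennreal (real n * (3 * exp (- (real d * h\<^sup>2 / 16))))"
proof (induction n arbitrary: u)
  case 0
  thus ?case by (simp add: fail_def E_up_def ip_def)
next
  case (Suc n)
  define \<kappa> where "\<kappa> = exp (- (real d * h\<^sup>2 / 16))"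
  let ?Ev = "E_up (Suc n) z T \<sigma>"
  have "fail d (Suc n) (?Ev (unit_last n)) \<le> ennreal (3 * \<kappa>) + ennreal (real n * (3 * \<kappa>))"
  proof (rule fail_Suc_le[OF d form_event_E_up, where Bad = "\<lambda>x. h < \<bar>x (n, n)\<bar> \<or> 1 + h < (\<Sum>i<n. (x (i, n))\<^sup>2)"])
    show "emeasure (border_law d n) {x \<in> space (border_law d n). h < \<bar>x (n, n)\<bar> \<or> 1 + h < (\<Sum>i<n. (x (i, n))\<^sup>2)} \<le> ennreal (3 * \<kappa>)"
      unfolding \<kappa>_def
      by (rule emeasure_disj_le[OF border_measurable(1,2) border_diagonal_tail[OF d h(1)] border_norm_upper_tail[OF d _ h]])
        (use Suc.prems in auto)
    show "{x \<in> space (border_law d n). h < \<bar>x (n, n)\<bar> \<or> 1 + h < (\<Sum>i<n. (x (i, n))\<^sup>2)} \<in> sets (border_law d n)"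
      by (rule sets_Collect_disjI[OF border_measurable(1,2)])
  next
    fix x assume x: "\<not> (h < \<bar>x (n, n)\<bar> \<or> 1 + h < (\<Sum>i<n. (x (i, n))\<^sup>2))"
    let ?b = "\<lambda>i. x (i, n)"
    have b: "\<bar>x (n, n)\<bar> \<le> h" "ip n ?b ?b \<le> 1 + h" using x by (auto simp: ip_def power2_eq_square)
    show "\<exists>Ev'. form_event n Ev' \<and> fail d n Ev' \<le> ennreal (real n * (3 * \<kappa>)) \<and>
      (\<forall>A. Ev' (qf n A) \<longrightarrow> ?Ev (unit_last n) (\<lambda>v. qf n A v + 2 * v n * ip n ?b v + x (n, n) * (v n)\<^sup>2))"
      using form_event_E_up Suc.IH[of ?b] Suc.prems E_up_step[OF _ \<sigma> b T]
      by (intro exI[of _ "E_up n z T \<sigma> ?b"]) (simp add: \<kappa>_def)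
  qed
  also have "\<dots> = ennreal (real (Suc n) * (3 * \<kappa>))"
    by (simp add: ennreal_plus[symmetric] \<kappa>_def algebra_simps del: ennreal_plus)
  finally have last: "fail d (Suc n) (?Ev (unit_last n)) \<le> ennreal (real (Suc n) * (3 * \<kappa>))" .
  have "fail d (Suc n) (?Ev u) \<le> fail d (Suc n) (?Ev (unit_last n))"
  proof (cases "\<exists>i<Suc n. u i \<noteq> 0")
    case True
    have "fail d (Suc n) (?Ev u) = fail d (Suc n) (?Ev (unit_last n))"
      by (rule fail_all_directions[where Ev = ?Ev, OF d E_up_rotv form_event_E_up E_up_scale True])
    thus ?thesis by simp
  next
    \<comment> \<open>For u = 0 only semidefiniteness is left, and this is part of the event for the
      last coordinate vector. The direction 0 is the one used later for the norm of
      \<open>W\<close>.\<close>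
    case False
    hence "ip (Suc n) u v = 0" for v by (simp add: ip_def)
    hence "?Ev (unit_last n) Q \<Longrightarrow> ?Ev u Q" for Q by (auto simp: E_up_def)
    thus ?thesis by (rule fail_mono[OF form_event_E_up])
  qed
  thus ?case using last by (simp only: \<kappa>_def)
qed

text \<open>The levels may grow with the size. While the next level is 0 the event holds for free; a
  positive level occurs only for n \<ge> d (1 - h), where the border norm is bounded below. As h <
  1/2, such a border is nonzero and thus an admissible direction for the induction
  hypothesis.\<close>

lemma fail_E_low:
  fixes s :: "nat \<Rightarrow> real"
  assumes d: "0 < d" and h: "0 \<le> h" "h < 1 / 2"
    and s0: "\<And>n. 0 \<le> s n"
    and s: "\<And>n. n < d \<Longrightarrow> 0 < s (Suc n) \<Longrightarrow> real d * (1 - h) \<le> real n \<and> s (Suc n) * (z + h - s n * (1 - 2 * h)) \<le> 1"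
  shows "n \<le> d \<Longrightarrow> \<exists>i<n. u i \<noteq> 0 \<Longrightarrow>
    fail d n (E_low n z (s n) u) \<le> ennreal (real n * (3 * exp (- (real d * h\<^sup>2 / 16))))"
proof (induction n arbitrary: u)
  case (Suc n)
  define \<kappa> where "\<kappa> = exp (- (real d * h\<^sup>2 / 16))"
  let ?Ev = "E_low (Suc n) z (s (Suc n))"
  show ?case
  proof (cases "s (Suc n) = 0")
    case True
    thus ?thesis using E_low_zero[OF Suc.prems(2)] by (simp add: fail_def)
  next
    case False
    hence pos: "0 < s (Suc n)" using s0[of "Suc n"] by simp
    with s[of n] Suc.prems have n: "real d * (1 - h) \<le> real n"
      and step: "s (Suc n) * (z + h - s n * (1 - 2 * h)) \<le> 1" by auto
    have "fail d (Suc n) (?Ev u) = fail d (Suc n) (?Ev (unit_last n))"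
      by (rule fail_all_directions[where Ev = ?Ev, OF d E_low_rotv form_event_E_low E_low_scale_iff Suc.prems(2)])
    also have "\<dots> \<le> ennreal (3 * \<kappa>) + ennreal (real n * (3 * \<kappa>))"
    proof (rule fail_Suc_le[OF d form_event_E_low, where Bad = "\<lambda>x. h < \<bar>x (n, n)\<bar> \<or> (\<Sum>i<n. (x (i, n))\<^sup>2) < 1 - 2 * h"])
      show "emeasure (border_law d n) {x \<in> space (border_law d n). h < \<bar>x (n, n)\<bar> \<or> (\<Sum>i<n. (x (i, n))\<^sup>2) < 1 - 2 * h} \<le> ennreal (3 * \<kappa>)"
        unfolding \<kappa>_def
        by (rule emeasure_disj_le[OF border_measurable(1,3) border_diagonal_tail[OF d h(1)] border_norm_lower_tail[OF d n h(1)]])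
          (use h in auto)
      show "{x \<in> space (border_law d n). h < \<bar>x (n, n)\<bar> \<or> (\<Sum>i<n. (x (i, n))\<^sup>2) < 1 - 2 * h} \<in> sets (border_law d n)"
        by (rule sets_Collect_disjI[OF border_measurable(1,3)])
    next
      fix x assume x: "\<not> (h < \<bar>x (n, n)\<bar> \<or> (\<Sum>i<n. (x (i, n))\<^sup>2) < 1 - 2 * h)"
      let ?b = "\<lambda>i. x (i, n)"
      have b: "\<bar>x (n, n)\<bar> \<le> h" "1 - 2 * h \<le> ip n ?b ?b" using x by (auto simp: ip_def power2_eq_square)
      hence "0 < ip n ?b ?b" using h by linarith
      hence "\<exists>i<n. ?b i \<noteq> 0" by (simp only: ip_self_pos_iff)
      hence "fail d n (E_low n z (s n) ?b) \<le> ennreal (real n * (3 * \<kappa>))"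
        using Suc.IH[of ?b] Suc.prems(1) by (simp add: \<kappa>_def)
      thus "\<exists>Ev'. form_event n Ev' \<and> fail d n Ev' \<le> ennreal (real n * (3 * \<kappa>)) \<and>
        (\<forall>A. Ev' (qf n A) \<longrightarrow> ?Ev (unit_last n) (\<lambda>v. qf n A v + 2 * v n * ip n ?b v + x (n, n) * (v n)\<^sup>2))"
        using form_event_E_low E_low_step[OF _ b pos s0 step]
        by (intro exI[of _ "E_low n z (s n) ?b"]) simp
    qed
    also have "\<dots> = ennreal (real (Suc n) * (3 * \<kappa>))"
      by (simp add: ennreal_plus[symmetric] \<kappa>_def algebra_simps del: ennreal_plus)
    finally show ?thesis by (simp only: \<kappa>_def)
  qed
qed simp

subsection \<open>From resolvent entries to the eigenvalues of the spiked matrix\<close>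

lemma eigensystem_expansion:
  assumes E: "eigensystem n A n f e" and i: "i < n"
  shows "lc n f (\<lambda>k. ip n (f k) v) i = v i"
proof -
  have "lc n f (\<lambda>k. ip n (f k) v) i = (\<Sum>k<n. \<Sum>j<n. f k j * v j * f k i)"
    by (simp add: lc_def ip_def sum_distrib_right)
  also have "\<dots> = (\<Sum>j<n. \<Sum>k<n. f k j * v j * f k i)" by (rule sum.swap)
  also have "\<dots> = (\<Sum>j<n. v j * (\<Sum>k<n. f k j * f k i))" by (simp add: sum_distrib_left mult_ac)
  also have "\<dots> = (\<Sum>j<n. if j = i then v j else 0)"
    by (rule sum.cong) (use i in \<open>auto simp: eigensystem_complete[OF E]\<close>)
  finally show ?thesis using i by simp
qed

lemma eigenvalue_eq_form:
  assumes E: "eigensystem n A n f e" and k: "k < n"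
  shows "ip n (f k) (mv n A (f k)) = e k" "ip n (f k) (f k) = 1"
proof -
  show 1: "ip n (f k) (f k) = 1" using E k by (simp add: eigensystem_def)
  have "ip n (f k) (mv n A (f k)) = ip n (f k) (\<lambda>i. e k * f k i)"
    using E k by (intro ip_cong) (auto simp: eigensystem_def)
  thus "ip n (f k) (mv n A (f k)) = e k" by (simp add: ip_scale_right 1)
qed

text \<open>The values of the form at the eigenvectors are the eigenvalues, so the bound passes to
  the norm by Parseval.\<close>

lemma op_norm_le_form:
  fixes W :: "real mat"
  assumes W: "W \<in> symmetric_mats n" and c: "0 \<le> c"
    and form: "\<And>v. \<bar>ip n v (mv n (index_mat W) v)\<bar> \<le> c * ip n v v"
  shows "op_norm W \<le> c"
proof (rule op_norm_le[OF _ c])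
  let ?A = "index_mat W"
  show "W \<in> carrier_mat n n" using W by (simp add: symmetric_mats_def)
  have s: "symf n ?A" using W by (simp add: symmetric_mats_iff_symf)
  obtain f e where E: "eigensystem n ?A n f e" using eigensystem_exists[OF s] by blast
  fix v
  let ?x = "\<lambda>k. ip n (f k) v"
  note comb = eigenvector_combinations[OF E order_refl, of ?x]
  have v: "lc n f ?x i = v i" if "i < n" for i by (rule eigensystem_expansion[OF E that])
  have "(e k)\<^sup>2 \<le> c\<^sup>2" if "k < n" for k
    using form[of "f k"] eigenvalue_eq_form[OF E that] c by (simp add: abs_le_square_iff[symmetric])
  hence "(\<Sum>k<n. (e k * ?x k)\<^sup>2) \<le> c\<^sup>2 * (\<Sum>k<n. (?x k)\<^sup>2)"
    unfolding sum_distrib_left by (intro sum_mono) (simp add: power_mult_distrib mult_right_mono)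
  moreover have "ip n (mv n ?A v) (mv n ?A v) = ip n (mv n ?A (lc n f ?x)) (mv n ?A (lc n f ?x))"
    by (intro ip_cong mv_cong) (auto simp: v)
  moreover have "ip n v v = ip n (lc n f ?x) (lc n f ?x)"
    by (intro ip_cong) (auto simp: v)
  ultimately show "ip n (mv n ?A v) (mv n ?A v) \<le> c\<^sup>2 * ip n v v" using comb by simp
qed

text \<open>Solved in the eigenbasis by dividing the coefficients of \<open>u\<close> by the
  positive numbers \<open>z - e k\<close>.\<close>

lemma resolvent_exists:
  assumes s: "symf n A" and z: "c < z" and le: "\<And>v. ip n v (mv n A v) \<le> c * ip n v v"
  obtains y where "\<And>i. i < n \<Longrightarrow> z * y i - mv n A y i = u i"
proof -
  obtain f e where E: "eigensystem n A n f e" using eigensystem_exists[OF s] by blast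
  have ez: "e k < z" if "k < n" for k using le[of "f k"] eigenvalue_eq_form[OF E that] z by simp
  define g where "g = (\<lambda>k. ip n (f k) u / (z - e k))"
  define y where "y = lc n f g"
  have "z * y i - mv n A y i = u i" if i: "i < n" for i
  proof -
    have "mv n A y i = (\<Sum>k<n. g k * (e k * f k i))"
      unfolding y_def mv_lc unfolding lc_def using E i by (auto simp: eigensystem_def)
    hence "z * y i - mv n A y i = (\<Sum>k<n. g k * (z - e k) * f k i)"
      by (simp add: y_def lc_def sum_distrib_left sum_subtractf[symmetric] algebra_simps)
    also have "\<dots> = lc n f (\<lambda>k. ip n (f k) u) i"
      unfolding lc_def using ez by (intro sum.cong) (auto simp: g_def)
    also have "\<dots> = u i" by (rule eigensystem_expansion[OF E i])
    finally show ?thesis .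
  qed
  thus thesis by (rule that)
qed

text \<open>An entrywise error becomes an operator error at the price of a factor \<open>r\<close>,
  by |x y| \<le> (x^2 + y^2) / 2. This is the origin of the factor 1/r in the later choice of
  \<epsilon>.\<close>

lemma abs_double_sum_le:
  fixes x :: "nat \<Rightarrow> real"
  assumes E: "\<And>i j. i < r \<Longrightarrow> j < r \<Longrightarrow> \<bar>E i j\<bar> \<le> \<kappa>" and \<kappa>: "0 \<le> \<kappa>"
  shows "\<bar>\<Sum>i<r. \<Sum>j<r. x i * x j * E i j\<bar> \<le> \<kappa> * real r * (\<Sum>i<r. (x i)\<^sup>2)"
proof -
  have "\<bar>\<Sum>i<r. \<Sum>j<r. x i * x j * E i j\<bar> \<le> (\<Sum>i<r. \<Sum>j<r. \<bar>x i * x j * E i j\<bar>)"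
    by (rule order_trans[OF sum_abs]) (intro sum_mono sum_abs)
  also have "\<dots> \<le> (\<Sum>i<r. \<Sum>j<r. \<kappa> / 2 * ((x i)\<^sup>2 + (x j)\<^sup>2))"
  proof (intro sum_mono)
    fix i j assume "i \<in> {..<r}" "j \<in> {..<r}"
    hence "\<bar>x i * x j * E i j\<bar> \<le> \<bar>x i * x j\<bar> * \<kappa>"
      unfolding abs_mult[of "x i * x j"] using E by (intro mult_left_mono) auto
    also have "\<dots> \<le> ((x i)\<^sup>2 + (x j)\<^sup>2) / 2 * \<kappa>"
    proof (rule mult_right_mono[OF _ \<kappa>])
      show "\<bar>x i * x j\<bar> \<le> ((x i)\<^sup>2 + (x j)\<^sup>2) / 2"
        using sum_squares_bound[of "\<bar>x i\<bar>" "\<bar>x j\<bar>"] by (simp add: abs_mult)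
    qed
    finally show "\<bar>x i * x j * E i j\<bar> \<le> \<kappa> / 2 * ((x i)\<^sup>2 + (x j)\<^sup>2)" by (simp add: mult.commute)
  qed
  also have "\<dots> = \<kappa> / 2 * (\<Sum>i<r. \<Sum>j<r. (x i)\<^sup>2 + (x j)\<^sup>2)" by (simp add: sum_distrib_left)
  also have "(\<Sum>i<r. \<Sum>j<r. (x i)\<^sup>2 + (x j)\<^sup>2) = 2 * real r * (\<Sum>i<r. (x i)\<^sup>2)"
    by (simp add: sum.distrib sum_distrib_left[symmetric])
  also have "\<kappa> / 2 * (2 * real r * (\<Sum>i<r. (x i)\<^sup>2)) = \<kappa> * real r * (\<Sum>i<r. (x i)\<^sup>2)" by simp
  finally show ?thesis .
qed

text \<open>The second bound is positivity of z - A at v - y, that is, completing the square: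
  \<open>ip n u y\<close> is the maximum over \<open>v\<close> of 2 v^T u - v^T (z - A) v, attained
  at \<open>y\<close>. It links the variational events to the resolvent.\<close>

lemma resolvent_form_bounds:
  assumes s: "symf n A" and y: "\<And>i. i < n \<Longrightarrow> z * y i - mv n A y i = u i"
    and pos: "\<And>v. 0 \<le> z * ip n v v - ip n v (mv n A v)"
  shows "ip n v u = z * ip n v y - ip n v (mv n A y)"
    and "2 * ip n v u - ip n u y \<le> z * ip n v v - ip n v (mv n A v)"
    and "z * ip n y y - ip n y (mv n A y) = ip n u y"
proof -
  have 1: "ip n v u = z * ip n v y - ip n v (mv n A y)" for v
  proof -
    have "ip n v u = ip n v (\<lambda>i. z * y i + (- 1) * mv n A y i)" by (rule ip_cong) (auto simp: y[symmetric])
    thus ?thesis unfolding ip_comb_right by simp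
  qed
  show "ip n v u = z * ip n v y - ip n v (mv n A y)" by (rule 1)
  show 2: "z * ip n y y - ip n y (mv n A y) = ip n u y" using 1[of y] ip_commute[of n u y] by simp
  have Ayv: "ip n y (mv n A v) = ip n v (mv n A y)" using ip_mv_sym[OF s, of y v] ip_commute[of n "mv n A y" v] by simp
  have "0 \<le> z * ip n (\<lambda>i. 1 * v i + (- 1) * y i) (\<lambda>i. 1 * v i + (- 1) * y i) -
      ip n (\<lambda>i. 1 * v i + (- 1) * y i) (mv n A (\<lambda>i. 1 * v i + (- 1) * y i))"
    by (rule pos)
  thus "2 * ip n v u - ip n u y \<le> z * ip n v v - ip n v (mv n A v)"
    using 1[of v] 2 Ayv ip_commute[of n y v] unfolding mv_comb ip_comb_left ip_comb_right
    by (simp add: algebra_simps)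
qed

text \<open>Here \<open>y j\<close> stands for the resolvent applied to the column
  \<open>u j\<close>, and \<open>\<Gamma>\<close> says that the compressed resolvent is entrywise
  close to 1/l times the identity. The second condition on \<epsilon> keeps the operator error
  \<open>2 * \<epsilon> * real r\<close> at most half of 1/l.\<close>

locale spiked_resolvent =
  fixes n r :: nat and A :: "nat \<times> nat \<Rightarrow> real" and u y :: "nat \<Rightarrow> nat \<Rightarrow> real" and l z \<epsilon> :: real
  assumes sym: "symf n A"
    and l: "1 < l" and z: "z = l + inverse l"
    and u: "\<And>i j. i < r \<Longrightarrow> j < r \<Longrightarrow> ip n (u i) (u j) = (if i = j then 1 else 0)"
    and y: "\<And>j i. j < r \<Longrightarrow> i < n \<Longrightarrow> z * y j i - mv n A (y j) i = u j i"
    and pos: "\<And>v. 0 \<le> z * ip n v v - ip n v (mv n A v)"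
    and \<epsilon>: "0 \<le> \<epsilon>" "4 * \<epsilon> * real r * l \<le> 1"
    and \<Gamma>: "\<And>i j. i < r \<Longrightarrow> j < r \<Longrightarrow> \<bar>ip n (u i) (y j) - (if i = j then inverse l else 0)\<bar> \<le> 2 * \<epsilon>"
begin

lemma combination_equation:
  assumes "i < n"
  shows "z * lc r y x i - mv n A (lc r y x) i = lc r u x i"
proof -
  have "z * lc r y x i - mv n A (lc r y x) i = (\<Sum>j<r. x j * (z * y j i - mv n A (y j) i))"
    unfolding mv_lc by (simp add: lc_def sum_distrib_left sum_subtractf[symmetric] algebra_simps)
  thus ?thesis using y assms by (simp add: lc_def)
qed

lemma ip_lc_u: "ip n (lc r u x) (lc r u x) = (\<Sum>j<r. (x j)\<^sup>2)"
proof -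
  have "ip n (lc r u x) (lc r u x) = (\<Sum>j<r. x j * (\<Sum>i<r. x i * ip n (u i) (u j)))"
    by (simp add: ip_lc_left ip_lc_right)
  also have "\<dots> = (\<Sum>j<r. x j * x j)"
  proof (intro sum.cong arg_cong2[where f = "(*)"] refl)
    fix j assume j: "j \<in> {..<r}"
    have "(\<Sum>i<r. x i * ip n (u i) (u j)) = (\<Sum>i<r. if i = j then x i else 0)"
      using j by (intro sum.cong) (auto simp: u)
    thus "(\<Sum>i<r. x i * ip n (u i) (u j)) = x j" using j by simp
  qed
  finally show ?thesis by (simp add: power2_eq_square)
qed

lemma resolvent_form_approx:
  "\<bar>ip n (lc r u x) (lc r y x) - inverse l * (\<Sum>j<r. (x j)\<^sup>2)\<bar> \<le> 2 * \<epsilon> * real r * (\<Sum>j<r. (x j)\<^sup>2)"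
proof -
  let ?\<delta> = "\<lambda>i j. if i = j then inverse l else (0 :: real)"
  have "ip n (lc r u x) (lc r y x) = (\<Sum>j<r. \<Sum>i<r. x i * x j * ip n (u i) (y j))"
    by (simp add: ip_lc_left ip_lc_right sum_distrib_left mult_ac)
  also have "\<dots> = (\<Sum>i<r. \<Sum>j<r. x i * x j * ip n (u i) (y j))" by (rule sum.swap)
  finally have 1: "ip n (lc r u x) (lc r y x) = (\<Sum>i<r. \<Sum>j<r. x i * x j * ip n (u i) (y j))" .
  have "(\<Sum>i<r. \<Sum>j<r. x i * x j * ?\<delta> i j) = (\<Sum>i<r. \<Sum>j<r. if i = j then inverse l * (x j)\<^sup>2 else 0)"
    by (intro sum.cong) (auto simp: power2_eq_square)
  hence 2: "inverse l * (\<Sum>j<r. (x j)\<^sup>2) = (\<Sum>i<r. \<Sum>j<r. x i * x j * ?\<delta> i j)"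
    by (simp add: sum_distrib_left)
  have "ip n (lc r u x) (lc r y x) - inverse l * (\<Sum>j<r. (x j)\<^sup>2) =
      (\<Sum>i<r. \<Sum>j<r. x i * x j * (ip n (u i) (y j) - ?\<delta> i j))"
    unfolding 1 2 by (simp add: sum_subtractf[symmetric] right_diff_distrib)
  thus ?thesis using abs_double_sum_le[of r "\<lambda>i j. ip n (u i) (y j) - ?\<delta> i j" "2 * \<epsilon>" x] \<Gamma> \<epsilon> by simp
qed

text \<open>As (z - A) v = U x, the form of \<open>A\<close> at \<open>v\<close> is z |v|^2 - G with
  G = x^T U^T v, while completing the square gives l |U^T v|^2 \<ge> 2 G - |x|^2 / l. Their sum is
  at least z |v|^2 + (G - |x|^2 / l), and the bracket is small. The second bound turns |x|^2 into
  |v|^2 by |x|^2 / (2 l) \<le> G \<le> |x| |v|.\<close>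

lemma spiked_form_ge:
  fixes x :: "nat \<Rightarrow> real"
  defines "v \<equiv> lc r y x"
  shows "(z - 8 * \<epsilon> * real r * l\<^sup>2) * ip n v v \<le> ip n v (mv n A v) + l * (\<Sum>k<r. (ip n (u k) v)\<^sup>2)"
    and "(\<Sum>j<r. (x j)\<^sup>2) \<le> 4 * l\<^sup>2 * ip n v v"
proof -
  define X where "X = (\<Sum>j<r. (x j)\<^sup>2)"
  define G where "G = ip n (lc r u x) v"
  define e where "e = 2 * \<epsilon> * real r"
  have X0: "0 \<le> X" by (simp add: X_def sum_nonneg)
  have e: "0 \<le> e" "e \<le> inverse l / 2" using \<epsilon> l by (auto simp: e_def field_simps)
  have app: "\<bar>G - inverse l * X\<bar> \<le> e * X" using resolvent_form_approx[of x] by (simp add: G_def X_def v_def e_def)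
  have vu: "ip n v (lc r u x) = z * ip n v v - ip n v (mv n A v)"
    unfolding v_def by (rule resolvent_form_bounds(1)[OF sym combination_equation pos])
  hence Av: "ip n v (mv n A v) = z * ip n v v - G" by (simp add: G_def ip_commute[of n v "lc r u x"])
  have "2 * G - inverse l * X \<le> l * (\<Sum>k<r. (ip n (u k) v)\<^sup>2)"
  proof -
    have "2 * (x k * ip n (u k) v) - inverse l * (x k)\<^sup>2 \<le> l * (ip n (u k) v)\<^sup>2" for k
    proof -
      have "0 \<le> l * (ip n (u k) v - inverse l * x k)\<^sup>2" using l by simp
      also have "\<dots> = l * (ip n (u k) v)\<^sup>2 - 2 * (x k * ip n (u k) v) + inverse l * (x k)\<^sup>2"
        using l by (simp add: power2_eq_square field_simps)
      finally show ?thesis by linarith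
    qed
    hence "(\<Sum>k<r. 2 * (x k * ip n (u k) v) - inverse l * (x k)\<^sup>2) \<le> (\<Sum>k<r. l * (ip n (u k) v)\<^sup>2)"
      by (intro sum_mono) auto
    thus ?thesis by (simp add: G_def X_def ip_lc_left sum_subtractf sum_distrib_left)
  qed
  moreover have "- (e * X) \<le> G - inverse l * X" using app by linarith
  ultimately have 1: "z * ip n v v - e * X \<le> ip n v (mv n A v) + l * (\<Sum>k<r. (ip n (u k) v)\<^sup>2)"
    unfolding Av by linarith
  have XV: "X \<le> 4 * l\<^sup>2 * ip n v v"
  proof (cases "X = 0")
    case True thus ?thesis using ip_self_nonneg[of n v] by simp
  next
    case False
    hence Xpos: "0 < X" using X0 by simp
    have "e * X \<le> inverse l / 2 * X" using e X0 by (intro mult_right_mono)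
    hence "inverse l / 2 * X \<le> G" using app by linarith
    moreover have "0 \<le> inverse l / 2 * X" using l X0 by simp
    ultimately have "(inverse l / 2 * X)\<^sup>2 \<le> G\<^sup>2" by (intro power_mono)
    also have "\<dots> \<le> X * ip n v v"
      using ip_cauchy_schwarz[of n "lc r u x" v] unfolding ip_lc_u by (simp add: G_def X_def)
    also have "(inverse l / 2 * X)\<^sup>2 = X * ((inverse l / 2)\<^sup>2 * X)" by (simp add: power2_eq_square)
    finally have "(inverse l / 2)\<^sup>2 * X \<le> ip n v v" using Xpos by (simp only: mult_le_cancel_left_pos)
    hence "4 * l\<^sup>2 * ((inverse l / 2)\<^sup>2 * X) \<le> 4 * l\<^sup>2 * ip n v v" by (intro mult_left_mono) auto
    moreover have "4 * l\<^sup>2 * ((inverse l / 2)\<^sup>2 * X) = X" using l by (simp add: power2_eq_square field_simps)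
    ultimately show ?thesis by simp
  qed
  thus "(\<Sum>j<r. (x j)\<^sup>2) \<le> 4 * l\<^sup>2 * ip n v v" by (simp add: X_def)
  have "e * X \<le> e * (4 * l\<^sup>2 * ip n v v)" using XV e by (intro mult_left_mono)
  also have "\<dots> = 8 * \<epsilon> * real r * l\<^sup>2 * ip n v v" by (simp add: e_def)
  finally show "(z - 8 * \<epsilon> * real r * l\<^sup>2) * ip n v v \<le> ip n v (mv n A v) + l * (\<Sum>k<r. (ip n (u k) v)\<^sup>2)"
    using 1 by (simp add: algebra_simps)
qed

text \<open>An exact eigenvector satisfies (z - A) v = l U U^T v, which suggests the coefficients l
  U^T v in the variational inequality. The error is proportional to |U^T v|^2, at most |v|^2 by
  Bessel.\<close>

lemma spiked_form_le:
  "ip n v (mv n A v) + l * (\<Sum>k<r. (ip n (u k) v)\<^sup>2) \<le> (z + 2 * \<epsilon> * real r * l\<^sup>2) * ip n v v"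
proof -
  define c where "c = (\<lambda>k. ip n (u k) v)"
  define C where "C = (\<Sum>k<r. (c k)\<^sup>2)"
  define e where "e = 2 * \<epsilon> * real r"
  let ?x = "\<lambda>k. l * c k"
  have lC: "(\<Sum>k<r. (?x k)\<^sup>2) = l\<^sup>2 * C" by (simp add: C_def power_mult_distrib sum_distrib_left)
  have vux: "ip n v (lc r u x) = (\<Sum>k<r. x k * c k)" for x
    by (simp add: ip_lc_right c_def ip_commute[of n v])
  have "2 * ip n v (lc r u ?x) - ip n (lc r u ?x) (lc r y ?x) \<le> z * ip n v v - ip n v (mv n A v)"
    by (rule resolvent_form_bounds(2)[OF sym combination_equation pos])
  moreover have "ip n v (lc r u ?x) = l * C"
    unfolding vux by (simp add: C_def sum_distrib_left power2_eq_square mult.assoc)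
  moreover have "ip n (lc r u ?x) (lc r y ?x) \<le> inverse l * (l\<^sup>2 * C) + e * (l\<^sup>2 * C)"
    using resolvent_form_approx[of ?x] unfolding lC e_def by linarith
  moreover have "inverse l * (l\<^sup>2 * C) = l * C" using l by (simp add: power2_eq_square)
  ultimately have 1: "ip n v (mv n A v) + l * C \<le> z * ip n v v + e * l\<^sup>2 * C"
    by (simp add: mult.assoc)
  have "C \<le> ip n v v"
  proof -
    let ?w = "\<lambda>i. 1 * v i + (- 1) * lc r u c i"
    have "ip n v (lc r u c) = C" unfolding vux by (simp add: C_def power2_eq_square)
    moreover have "ip n (lc r u c) v = C" using calculation by (simp add: ip_commute)
    moreover have "ip n (lc r u c) (lc r u c) = C" by (simp add: ip_lc_u C_def)
    ultimately have "ip n ?w ?w = ip n v v - C" unfolding ip_comb_left ip_comb_right by simp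
    thus ?thesis using ip_self_nonneg[of n ?w] by simp
  qed
  hence "e * l\<^sup>2 * C \<le> e * l\<^sup>2 * ip n v v" using \<epsilon> by (intro mult_left_mono) (auto simp: e_def)
  with 1 show ?thesis by (simp add: C_def c_def e_def algebra_simps)
qed

end

text \<open>By polarisation, all entries of a symmetric bilinear form are determined by its values on
  the diagonal at \<open>u i\<close> and \<open>u i + u j\<close>.\<close>
definition pairing :: "(nat \<Rightarrow> nat \<Rightarrow> real) \<Rightarrow> nat \<Rightarrow> nat \<Rightarrow> nat \<Rightarrow> real" where
  "pairing u i j = (if i = j then u i else (\<lambda>x. 1 * u i x + 1 * u j x))"

text \<open>The events pinch w^T (z - A)^-1 w between (m - \<epsilon>) |w|^2 and (m + \<epsilon>)
  |w|^2. For w = u_i + u_j, of squared norm 2, subtracting both diagonal terms leaves twice the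
  mixed entry with error at most 4 \<epsilon>, hence the bound 2 \<epsilon>.\<close>

lemma resolvent_entries_approx:
  assumes sym: "symf n A"
    and u: "\<And>i j. i < r \<Longrightarrow> j < r \<Longrightarrow> ip n (u i) (u j) = (if i = j then 1 else 0)"
    and y: "\<And>j i. j < r \<Longrightarrow> i < n \<Longrightarrow> z * y j i - mv n A (y j) i = u j i"
    and pos: "\<And>v. 0 \<le> z * ip n v v - ip n v (mv n A v)"
    and up: "\<And>i j. i < r \<Longrightarrow> j < r \<Longrightarrow> E_up n z (m + \<epsilon>) 1 (pairing u i j) (qf n A)"
    and low: "\<And>i j. i < r \<Longrightarrow> j < r \<Longrightarrow> E_low n z (m - \<epsilon>) (pairing u i j) (qf n A)"
    and \<epsilon>: "0 \<le> \<epsilon>" and ij: "i < r" "j < r"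
  shows "\<bar>ip n (u i) (y j) - (if i = j then m else 0)\<bar> \<le> 2 * \<epsilon>"
proof -
  have bounds: "(m - \<epsilon>) * ip n w w \<le> ip n w x \<and> ip n w x \<le> (m + \<epsilon>) * ip n w w"
    if x: "\<And>i. i < n \<Longrightarrow> z * x i - mv n A x i = w i"
      and up: "E_up n z (m + \<epsilon>) 1 w (qf n A)" and low: "E_low n z (m - \<epsilon>) w (qf n A)" for w x
  proof
    note form = resolvent_form_bounds[OF sym x pos]
    from low obtain v where "(m - \<epsilon>) * ip n w w < 2 * ip n w v - (z * ip n v v - qf n A v)"
      by (auto simp: E_low_def)
    thus "(m - \<epsilon>) * ip n w w \<le> ip n w x" using form(2)[of v] ip_commute[of n v w] by simp
    have "(ip n w x)\<^sup>2 \<le> (m + \<epsilon>) * ip n w w * ip n w x"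
      using up form(3) unfolding E_up_def by (metis mult_1)
    hence "ip n w x * ip n w x \<le> (m + \<epsilon>) * ip n w w * ip n w x" by (simp add: power2_eq_square)
    moreover have "0 \<le> ip n w x" using pos[of x] form(3) by simp
    ultimately show "ip n w x \<le> (m + \<epsilon>) * ip n w w"
    proof (cases "ip n w x = 0")
      \<comment> \<open>Nothing can be cancelled here; testing \<open>E_up\<close> at
        \<open>w\<close> itself shows that m + \<epsilon> is positive unless w = 0.\<close>
      case True
      have "E_up n z (m + \<epsilon>) 1 w (qf n A)" by (rule up)
      show ?thesis
      proof (cases "ip n w w = 0")
        case False
        hence w: "0 < ip n w w" using ip_self_nonneg[of n w] by simp
        have "(ip n w w)\<^sup>2 \<le> (m + \<epsilon>) * ip n w w * (z * ip n w w - 1 * qf n A w)"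
          using up unfolding E_up_def by blast
        moreover have "0 < (ip n w w)\<^sup>2" using False by simp
        ultimately have "0 < (m + \<epsilon>) * ip n w w * (z * ip n w w - 1 * qf n A w)" by linarith
        thus ?thesis using pos[of w] True w by (auto simp: zero_less_mult_iff)
      qed (simp add: True)
    qed (simp add: mult_le_cancel_right)
  qed
  have diag: "m - \<epsilon> \<le> ip n (u k) (y k) \<and> ip n (u k) (y k) \<le> m + \<epsilon>" if "k < r" for k
    using bounds[OF y up[of k k, unfolded pairing_def, simplified] low[of k k, unfolded pairing_def, simplified]] that
    by (simp add: u)
  show ?thesis
  proof (cases "i = j")
    case True
    thus ?thesis using diag[OF ij(1)] \<epsilon> by (simp add: abs_le_iff)
  next
    case False
    let ?w = "\<lambda>x. 1 * u i x + 1 * u j x" and ?x = "\<lambda>x. 1 * y i x + 1 * y j x"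
    have "z * ?x k - mv n A ?x k = ?w k" if "k < n" for k
      unfolding mv_comb using y[OF ij(1) that] y[OF ij(2) that] by (simp add: algebra_simps)
    from bounds[OF this] up[OF ij] low[OF ij] False
    have "(m - \<epsilon>) * ip n ?w ?w \<le> ip n ?w ?x \<and> ip n ?w ?x \<le> (m + \<epsilon>) * ip n ?w ?w"
      by (simp add: pairing_def)
    moreover have "ip n ?w ?w = 2" unfolding ip_comb_left ip_comb_right using u ij False by simp
    moreover have "ip n (u j) (y i) = ip n (u i) (y j)"
    proof -
      have 1: "ip n (y i) (u j) = z * ip n (y i) (y j) - ip n (y i) (mv n A (y j))"
        by (rule resolvent_form_bounds(1)[OF sym y pos]) (rule ij)
      have 2: "ip n (y j) (u i) = z * ip n (y j) (y i) - ip n (y j) (mv n A (y i))"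
        by (rule resolvent_form_bounds(1)[OF sym y pos]) (rule ij)
      have "ip n (y i) (mv n A (y j)) = ip n (y j) (mv n A (y i))"
        using ip_mv_sym[OF sym, of "y i" "y j"] ip_commute[of n "mv n A (y i)" "y j"] by simp
      with 1 2 show ?thesis using ip_commute[of n "y i" "y j"] ip_commute[of n "y i" "u j"] ip_commute[of n "y j" "u i"]
        by simp
    qed
    moreover have "ip n ?w ?x = ip n (u i) (y i) + ip n (u j) (y j) + ip n (u i) (y j) + ip n (u j) (y i)"
      unfolding ip_comb_left ip_comb_right by simp
    ultimately show ?thesis using diag[OF ij(1)] diag[OF ij(2)] False by (simp add: abs_le_iff algebra_simps)
  qed
qed

section \<open>From resolvent bounds to the good event\<close>

lemma stiefel_orthonormal:
  assumes U: "U \<in> stiefel n r" and ij: "i < r" "j < r"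
  shows "ip n (\<lambda>k. U $$ (k, i)) (\<lambda>k. U $$ (k, j)) = (if i = j then 1 else 0)"
proof -
  have U': "U \<in> carrier_mat n r" "transpose_mat U * U = 1\<^sub>m r" using U by (auto simp: stiefel_def)
  from U'(1) have "(transpose_mat U * U) $$ (i, j) = ip n (\<lambda>k. U $$ (k, i)) (\<lambda>k. U $$ (k, j))"
    using ij by (simp add: scalar_prod_def ip_def atLeast0LessThan)
  thus ?thesis using ij unfolding U'(2) by simp
qed

lemma stiefel_le:
  assumes U: "U \<in> stiefel n r"
  shows "r \<le> n"
proof (rule ccontr)
  assume "\<not> r \<le> n"
  then obtain x :: "nat \<Rightarrow> real" where x: "\<exists>j<r. x j \<noteq> 0" "\<And>i. i < n \<Longrightarrow> (\<Sum>j<r. U $$ (i, j) * x j) = 0"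
    using underdetermined_nontrivial[of n r "\<lambda>i j. U $$ (i, j)"] by auto
  then obtain k where k: "k < r" "x k \<noteq> 0" by blast
  let ?u = "\<lambda>j i. U $$ (i, j)"
  have "ip n (?u k) (lc r ?u x) = 0" using x(2) by (simp add: ip_def lc_def mult.commute)
  moreover have "ip n (?u k) (lc r ?u x) = (\<Sum>j<r. if k = j then x j else 0)"
    unfolding ip_lc_right using k by (intro sum.cong) (auto simp: stiefel_orthonormal[OF U])
  ultimately show False using k by simp
qed

text \<open>The deterministic half of the argument. The budget \<open>\<gamma> * (z - 2)\<close> is
  shared between the excess \<eta> of the norm over 2 and the loss
  \<open>8 * \<epsilon> * real r * l\<^sup>2\<close> of the r-th eigenvalue; the budget
  \<open>\<gamma> * z\<close> covers the excess of the top eigenvalue over \<open>z\<close>.\<close>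

lemma good_eventI:
  assumes W: "W \<in> symmetric_mats n" and U: "U \<in> stiefel n r" and r: "1 \<le> r"
    and g: "0 < g" "g < 1" and l_spike: "l = spike g" and z_eq: "z = l + inverse l"
    and \<eta>: "0 \<le> \<eta>" "2 + \<eta> < z"
    and up: "\<And>v. 0 \<le> (2 + \<eta>) * ip n v v - qf n (index_mat W) v"
    and dn: "\<And>v. 0 \<le> (2 + \<eta>) * ip n v v + qf n (index_mat W) v"
    and E_up: "\<And>i j. i < r \<Longrightarrow> j < r \<Longrightarrow>
      E_up n z (inverse l + \<epsilon>) 1 (pairing (\<lambda>k i. U $$ (i, k)) i j) (qf n (index_mat W))"
    and E_low: "\<And>i j. i < r \<Longrightarrow> j < r \<Longrightarrow>
      E_low n z (inverse l - \<epsilon>) (pairing (\<lambda>k i. U $$ (i, k)) i j) (qf n (index_mat W))"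
    and eps: "0 \<le> \<epsilon>" "4 * \<epsilon> * real r * l \<le> 1" "2 * \<epsilon> * real r * l\<^sup>2 \<le> \<gamma> * z"
      "\<eta> + 8 * \<epsilon> * real r * l\<^sup>2 \<le> \<gamma> * (z - 2)"
  shows "(W, U) \<in> good_event n r g \<gamma>"
proof -
  let ?A = "index_mat W" and ?u = "\<lambda>k i. U $$ (i, k)"
  define M where "M = spiked_mat l W U"
  have Wc: "W \<in> carrier_mat n n" and s: "symf n ?A" using W by (auto simp: symmetric_mats_iff_symf)
  have Uc: "U \<in> carrier_mat n r" using U by (simp add: stiefel_def)
  have rn: "r \<le> n" by (rule stiefel_le[OF U])
  have l1: "1 < l" using spike_quadratic[OF g] l_spike by simp
  have pos: "0 \<le> z * ip n v v - qf n ?A v" for v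
  proof -
    have "(2 + \<eta>) * ip n v v \<le> z * ip n v v" using \<eta> ip_self_nonneg by (intro mult_right_mono) auto
    thus ?thesis using up[of v] by linarith
  qed
  have "\<exists>y. \<forall>i<n. z * y i - mv n ?A y i = ?u j i" for j
  proof -
    obtain y where "\<And>i. i < n \<Longrightarrow> z * y i - mv n ?A y i = ?u j i"
      by (rule resolvent_exists[OF s \<eta>(2), where u = "?u j"]) (use up in auto)
    thus ?thesis by blast
  qed
  then obtain y where y: "\<And>j i. i < n \<Longrightarrow> z * y j i - mv n ?A (y j) i = ?u j i" by metis
  note u = stiefel_orthonormal[OF U]
  have \<Gamma>: "\<bar>ip n (?u i) (y j) - (if i = j then inverse l else 0)\<bar> \<le> 2 * \<epsilon>" if "i < r" "j < r" for i j
    by (rule resolvent_entries_approx[OF s u _ pos E_up E_low eps(1) that]) (use y in auto)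
  interpret spiked_resolvent n r ?A ?u y l z \<epsilon>
    by unfold_locales (use s l1 z_eq u y pos eps \<Gamma> in auto)
  have M: "M \<in> symmetric_mats n" unfolding M_def by (rule spiked_mat_symmetric[OF W Uc])
  hence Mc: "M \<in> carrier_mat n n" and Ms: "symf n (index_mat M)" by (auto simp: symmetric_mats_iff_symf)
  have Mform: "qf n (index_mat M) v = qf n ?A v + l * (\<Sum>k<r. (ip n (?u k) v)\<^sup>2)" for v
  proof -
    have "qf n (index_mat M) v = ip n v (\<lambda>i. 1 * mv n ?A v i + l * lc r ?u (\<lambda>k. ip n (?u k) v) i)"
      unfolding M_def by (rule ip_cong) (simp_all add: spiked_mat_mv[OF Wc Uc])
    thus ?thesis unfolding ip_comb_right ip_lc_right by (simp add: ip_commute[of n v] power2_eq_square)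
  qed
  have lower: "z - 8 * \<epsilon> * real r * l\<^sup>2 \<le> eigval r M"
  proof -
    have "z - 8 * \<epsilon> * real r * l\<^sup>2 \<le> eigval r (mat n n (index_mat M))"
    proof (rule eigval_ge[OF Ms _ rn, where y = y])
      show "0 < r" using r by simp
      show "(z - 8 * \<epsilon> * real r * l\<^sup>2) * ip n (lc r y x) (lc r y x) \<le> qf n (index_mat M) (lc r y x)" for x
        unfolding Mform by (rule spiked_form_ge(1))
      fix x :: "nat \<Rightarrow> real" assume "\<exists>j<r. x j \<noteq> 0"
      then obtain j where "j < r" "x j \<noteq> 0" by blast
      hence "0 < (\<Sum>j<r. (x j)\<^sup>2)" by (intro sum_pos2[of _ j]) auto
      hence "0 < 4 * l\<^sup>2 * ip n (lc r y x) (lc r y x)" using spiked_form_ge(2)[of x] by linarith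
      thus "0 < ip n (lc r y x) (lc r y x)" using l1 by (simp add: zero_less_mult_iff)
    qed
    thus ?thesis using mat_index_mat[OF Mc] by simp
  qed
  have upper: "eigval 1 M \<le> z + 2 * \<epsilon> * real r * l\<^sup>2"
  proof -
    have "eigval (Suc 0) (mat n n (index_mat M)) \<le> z + 2 * \<epsilon> * real r * l\<^sup>2"
      by (rule eigval_Suc_le[OF Ms]) (use r rn spiked_form_le Mform in auto)
    thus ?thesis using mat_index_mat[OF Mc] by simp
  qed
  have norm: "op_norm W \<le> 2 + \<eta>"
  proof (rule op_norm_le_form[OF W])
    fix v show "\<bar>qf n ?A v\<bar> \<le> (2 + \<eta>) * ip n v v" using up[of v] dn[of v] by linarith
  qed (use \<eta> in simp)
  have "op_norm W + (1 - \<gamma>) * (z - 2) \<le> eigval r M"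
    using norm lower eps(4) by (simp add: algebra_simps)
  moreover have "eigval 1 M \<le> (1 + \<gamma>) * z" using upper eps(3) by (simp add: algebra_simps)
  ultimately show ?thesis using W U by (simp add: good_event_def Let_def M_def l_spike[symmetric] z_eq)
qed

subsection \<open>Measurability of the good event\<close>

lemma mat_borel_map:
  "(\<lambda>A. \<lambda>p\<in>{..<m} \<times> {..<n}. A $$ p) \<in> measurable (mat_borel m n) (PiM ({..<m} \<times> {..<n}) (\<lambda>_. borel))"
  unfolding mat_borel_def by (rule measurable_vimage_algebra1) (auto simp: space_PiM)

lemma space_mat_borel [simp]: "space (mat_borel m n) = carrier_mat m n"
  by (simp add: mat_borel_def)

lemma mat_borel_entry:
  assumes "i < m" "j < n"
  shows "(\<lambda>A. A $$ (i, j)) \<in> borel_measurable (mat_borel m n)"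
proof -
  have p: "(i, j) \<in> {..<m} \<times> {..<n}" using assms by simp
  from measurable_compose[OF mat_borel_map measurable_component_singleton[OF p]]
  show ?thesis using p by simp
qed

lemma measurable_to_mat_borel:
  assumes "f \<in> space N \<rightarrow> carrier_mat m n"
    and "\<And>i j. i < m \<Longrightarrow> j < n \<Longrightarrow> (\<lambda>x. f x $$ (i, j)) \<in> borel_measurable N"
  shows "f \<in> measurable N (mat_borel m n)"
  unfolding mat_borel_def
proof (rule measurable_vimage_algebra2)
  show "(\<lambda>x. \<lambda>p\<in>{..<m} \<times> {..<n}. f x $$ p) \<in> measurable N (PiM ({..<m} \<times> {..<n}) (\<lambda>_. borel))"
    using assms(2) by (intro measurable_restrict) auto
qed (use assms in auto)

text \<open>Eigenvalues are controlled for symmetric matrices only. Symmetrising first gives a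
  function that is continuous on all of \<open>nat \<times> nat \<Rightarrow> real\<close> and
  unchanged on symmetric matrices.\<close>

definition sym_part :: "(nat \<times> nat \<Rightarrow> real) \<Rightarrow> nat \<times> nat \<Rightarrow> real" where
  "sym_part w = (\<lambda>(i, j). (w (i, j) + w (j, i)) / 2)"

lemma symf_sym_part: "symf n (sym_part w)"
  by (simp add: symf_def sym_part_def add.commute)

lemma qf_le_add_entries:
  "qf n A v \<le> qf n B v + (\<Sum>i<n. \<Sum>j<n. \<bar>A (i, j) - B (i, j)\<bar>) * ip n v v"
proof -
  have "qf n A v - qf n B v = (\<Sum>i<n. \<Sum>j<n. (A (i, j) - B (i, j)) * (v i * v j))"
    by (simp add: ip_def mv_def sum_distrib_left sum_subtractf[symmetric] algebra_simps)
  also have "\<dots> \<le> (\<Sum>i<n. \<Sum>j<n. \<bar>A (i, j) - B (i, j)\<bar> * ip n v v)"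
  proof (intro sum_mono)
    fix i j assume ij: "i \<in> {..<n}" "j \<in> {..<n}"
    have "(v k)\<^sup>2 \<le> ip n v v" if "k \<in> {..<n}" for k
      unfolding ip_def power2_eq_square using that by (intro member_le_sum) auto
    hence "(v i)\<^sup>2 \<le> ip n v v" "(v j)\<^sup>2 \<le> ip n v v" using ij by auto
    hence "((v i)\<^sup>2 + (v j)\<^sup>2) / 2 \<le> (ip n v v + ip n v v) / 2" by (intro divide_right_mono add_mono) auto
    hence "((v i)\<^sup>2 + (v j)\<^sup>2) / 2 \<le> ip n v v" by simp
    moreover have "\<bar>v i * v j\<bar> \<le> ((v i)\<^sup>2 + (v j)\<^sup>2) / 2"
      using sum_squares_bound[of "\<bar>v i\<bar>" "\<bar>v j\<bar>"] by (simp add: abs_mult)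
    ultimately have "\<bar>v i * v j\<bar> \<le> ip n v v" by linarith
    hence "\<bar>A (i, j) - B (i, j)\<bar> * \<bar>v i * v j\<bar> \<le> \<bar>A (i, j) - B (i, j)\<bar> * ip n v v"
      by (intro mult_left_mono) auto
    thus "(A (i, j) - B (i, j)) * (v i * v j) \<le> \<bar>A (i, j) - B (i, j)\<bar> * ip n v v"
      by (metis abs_ge_self abs_mult order_trans)
  qed
  finally show ?thesis by (simp add: sum_distrib_right)
qed

text \<open>Weyl's inequality, with the sum of all entrywise differences as a crude bound for the
  perturbation.\<close>

lemma continuous_eigval:
  assumes "k < n"
  shows "continuous_on UNIV (\<lambda>w. eigval (Suc k) (mat n n (sym_part w)))"
  unfolding continuous_on_def
proof
  fix x :: "nat \<times> nat \<Rightarrow> real"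
  define \<delta> where "\<delta> = (\<lambda>w. \<Sum>i<n. \<Sum>j<n. \<bar>sym_part w (i, j) - sym_part x (i, j)\<bar>)"
  have "continuous_on UNIV \<delta>"
    unfolding \<delta>_def sym_part_def prod.case
    by (intro continuous_intros continuous_on_product_coordinates) auto
  hence lim: "(\<delta> \<longlongrightarrow> \<delta> x) (at x)" by (simp add: continuous_on_def)
  have \<delta>x: "\<delta> x = 0" by (simp add: \<delta>_def)
  have "\<bar>eigval (Suc k) (mat n n (sym_part w)) - eigval (Suc k) (mat n n (sym_part x))\<bar> \<le> \<delta> w" for w
  proof -
    have sw: "(\<Sum>i<n. \<Sum>j<n. \<bar>sym_part x (i, j) - sym_part w (i, j)\<bar>) = \<delta> w"
      unfolding \<delta>_def by (subst abs_minus_commute) (rule refl)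
    have "eigval (Suc k) (mat n n (sym_part w)) \<le> eigval (Suc k) (mat n n (sym_part x)) + \<delta> w"
      unfolding \<delta>_def
      by (rule eigval_le_perturbed[OF symf_sym_part symf_sym_part assms]) (rule qf_le_add_entries)
    moreover have "eigval (Suc k) (mat n n (sym_part x)) \<le> eigval (Suc k) (mat n n (sym_part w)) + \<delta> w"
      unfolding sw[symmetric]
      by (rule eigval_le_perturbed[OF symf_sym_part symf_sym_part assms]) (rule qf_le_add_entries)
    ultimately show ?thesis by linarith
  qed
  moreover have "0 \<le> \<delta> w" for w by (simp add: \<delta>_def sum_nonneg)
  ultimately show "((\<lambda>w. eigval (Suc k) (mat n n (sym_part w))) \<longlongrightarrow> eigval (Suc k) (mat n n (sym_part x))) (at x within UNIV)"
    by (intro metric_tendsto_imp_tendsto[OF lim]) (auto simp: dist_real_def \<delta>x)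
qed

text \<open>Each sublevel set is an intersection of closed conditions, one for each vector, so the
  uncountable family of vectors does no harm.\<close>

lemma borel_measurable_op_norm:
  "(\<lambda>w. op_norm (mat n n w)) \<in> borel_measurable borel"
proof (rule borel_measurableI_le)
  fix c :: real
  let ?A = "\<lambda>w :: nat \<times> nat \<Rightarrow> real. mat n n w"
  have mv: "mv n (index_mat (?A w)) v i = mv n w v i" if "i < n" for w v i
    using that by (simp add: mv_def)
  have eq: "ip n (mv n (index_mat (?A w)) v) (mv n (index_mat (?A w)) v) = ip n (mv n w v) (mv n w v)" for w v
    by (rule ip_cong) (auto simp: mv)
  have "op_norm (?A w) \<le> c \<longleftrightarrow> (\<forall>v. 0 \<le> c \<and> ip n (mv n w v) (mv n w v) \<le> c\<^sup>2 * ip n v v)" for w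
  proof
    assume le: "op_norm (?A w) \<le> c"
    have o: "0 \<le> op_norm (?A w)" by (rule op_norm_nonneg[of _ n]) simp
    hence "(op_norm (?A w))\<^sup>2 \<le> c\<^sup>2" using le by (intro power_mono)
    hence 2: "(op_norm (?A w))\<^sup>2 * ip n v v \<le> c\<^sup>2 * ip n v v" for v
      using ip_self_nonneg by (intro mult_right_mono)
    have 1: "ip n (mv n w v) (mv n w v) \<le> (op_norm (?A w))\<^sup>2 * ip n v v" for v
      using ip_mv_le_op_norm[of "?A w" n v] by (simp add: eq)
    show "\<forall>v. 0 \<le> c \<and> ip n (mv n w v) (mv n w v) \<le> c\<^sup>2 * ip n v v"
      using order_trans[OF 1 2] order_trans[OF o le] by blast
  next
    assume "\<forall>v. 0 \<le> c \<and> ip n (mv n w v) (mv n w v) \<le> c\<^sup>2 * ip n v v"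
    thus "op_norm (?A w) \<le> c" by (intro op_norm_le[of _ n]) (auto simp: eq)
  qed
  hence "{w \<in> space borel. op_norm (?A w) \<le> c} =
      {w. \<forall>v. 0 \<le> c \<and> ip n (mv n w v) (mv n w v) \<le> c\<^sup>2 * ip n v v}" by simp
  moreover have "closed {w. \<forall>v. 0 \<le> c \<and> ip n (mv n w v) (mv n w v) \<le> c\<^sup>2 * ip n v v}"
    unfolding mv_def
    by (intro closed_Collect_all closed_Collect_conj closed_Collect_le continuous_intros
        continuous_on_product_coordinates)
  ultimately show "{w \<in> space borel. op_norm (?A w) \<le> c} \<in> sets borel"
    by (simp only: borel_closed)
qed

lemma measurable_into_functions:
  fixes f :: "'a \<Rightarrow> nat \<times> nat \<Rightarrow> real"
  assumes "\<And>p. (\<lambda>x. f x p) \<in> borel_measurable N"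
  shows "f \<in> borel_measurable N"
proof -
  have "f \<in> measurable N (PiM UNIV (\<lambda>_. borel))"
    by (rule measurable_PiM_single') (use assms in auto)
  thus ?thesis by (simp cong: measurable_cong_sets add: sets_PiM_equal_borel)
qed

lemma good_event_measurable:
  assumes r: "1 \<le> r" "r \<le> d" and \<nu>: "sets \<nu> = sets (restrict_space (mat_borel d r) (stiefel d r))"
  shows "good_event d r g \<gamma> \<in> sets (mat_borel d d \<Otimes>\<^sub>M \<nu>)"
proof -
  let ?P = "mat_borel d d \<Otimes>\<^sub>M \<nu>"
  let ?l = "spike g"
  have sp\<nu>: "space \<nu> = stiefel d r"
    using sets_eq_imp_space_eq[OF \<nu>] by (auto simp: space_restrict_space stiefel_def)
  have spP: "space ?P = carrier_mat d d \<times> stiefel d r" by (simp add: space_pair_measure sp\<nu>)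
  have [measurable]: "(\<lambda>x. fst x $$ (i, j)) \<in> borel_measurable ?P" if "i < d" "j < d" for i j
    by (rule measurable_compose[OF measurable_fst mat_borel_entry[OF that]])
  have "(\<lambda>U. U $$ (i, j)) \<in> borel_measurable \<nu>" if "i < d" "j < r" for i j
    unfolding measurable_cong_sets[OF \<nu> refl] by (rule measurable_restrict_space1[OF mat_borel_entry[OF that]])
  hence [measurable]: "(\<lambda>x. snd x $$ (i, j)) \<in> borel_measurable ?P" if "i < d" "j < r" for i j
    using that by (intro measurable_compose[OF measurable_snd]) auto
  \<comment> \<open>Zero-padded versions of \<open>W\<close> and of the spiked matrix with values in
    \<open>nat \<times> nat \<Rightarrow> real\<close>, the domain of the measurability lemmas for
    norm and eigenvalues.\<close>
  define w where "w = (\<lambda>x :: real mat \<times> real mat. \<lambda>p. if fst p < d \<and> snd p < d then fst x $$ p else 0)"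
  define m where "m = (\<lambda>x :: real mat \<times> real mat. \<lambda>p. if fst p < d \<and> snd p < d
    then fst x $$ p + ?l * (\<Sum>k<r. snd x $$ (fst p, k) * snd x $$ (snd p, k)) else 0)"
  have w: "w \<in> borel_measurable ?P"
  proof (rule measurable_into_functions)
    fix p show "(\<lambda>x. w x p) \<in> borel_measurable ?P"
      by (cases p; cases "fst p < d \<and> snd p < d") (auto simp: w_def)
  qed
  have m: "m \<in> borel_measurable ?P"
  proof (rule measurable_into_functions)
    fix p show "(\<lambda>x. m x p) \<in> borel_measurable ?P"
      by (cases p; cases "fst p < d \<and> snd p < d") (auto simp: m_def intro!: borel_measurable_add borel_measurable_times borel_measurable_sum)
  qed
  have op: "(\<lambda>x. op_norm (mat d d (w x))) \<in> borel_measurable ?P"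
    by (rule measurable_compose[OF w borel_measurable_op_norm])
  have ev: "(\<lambda>x. eigval k (mat d d (sym_part (m x)))) \<in> borel_measurable ?P" if k: "1 \<le> k" "k \<le> d" for k
  proof -
    have "(\<lambda>w. eigval (Suc (k - 1)) (mat d d (sym_part w))) \<in> borel_measurable borel"
      by (rule borel_measurable_continuous_onI[OF continuous_eigval]) (use k in simp)
    from measurable_compose[OF m this] show ?thesis using k by simp
  qed
  have "good_event d r g \<gamma> = {x \<in> space ?P. (\<forall>i\<in>{..<d}. \<forall>j\<in>{..<d}. fst x $$ (i, j) = fst x $$ (j, i)) \<and>
      op_norm (mat d d (w x)) + (1 - \<gamma>) * (?l + inverse ?l - 2) \<le> eigval r (mat d d (sym_part (m x))) \<and>
      eigval 1 (mat d d (sym_part (m x))) \<le> (1 + \<gamma>) * (?l + inverse ?l)}"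
  proof (rule Set.set_eqI)
    fix x :: "real mat \<times> real mat"
    obtain W U where x: "x = (W, U)" by (cases x)
    show "x \<in> good_event d r g \<gamma> \<longleftrightarrow> x \<in> {x \<in> space ?P. (\<forall>i\<in>{..<d}. \<forall>j\<in>{..<d}. fst x $$ (i, j) = fst x $$ (j, i)) \<and>
      op_norm (mat d d (w x)) + (1 - \<gamma>) * (?l + inverse ?l - 2) \<le> eigval r (mat d d (sym_part (m x))) \<and>
      eigval 1 (mat d d (sym_part (m x))) \<le> (1 + \<gamma>) * (?l + inverse ?l)}"
    proof (cases "W \<in> symmetric_mats d \<and> U \<in> stiefel d r")
      case True
      hence Wc: "W \<in> carrier_mat d d" "symf d (index_mat W)" and Uc: "U \<in> carrier_mat d r"
        by (auto simp: symmetric_mats_iff_symf stiefel_def)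
      have ww: "mat d d (w x) = W" using Wc by (intro eq_matI) (auto simp: w_def x)
      have M: "spiked_mat ?l W U \<in> carrier_mat d d" "symf d (index_mat (spiked_mat ?l W U))"
        using spiked_mat_symmetric[of W d U r ?l] True Uc by (auto simp: symmetric_mats_iff_symf)
      have mm: "mat d d (sym_part (m x)) = spiked_mat ?l W U"
      proof (rule eq_matI)
        fix i j assume "i < dim_row (spiked_mat ?l W U)" "j < dim_col (spiked_mat ?l W U)"
        hence ij: "i < d" "j < d" using M by auto
        hence "m x (i, j) = spiked_mat ?l W U $$ (i, j)" "m x (j, i) = spiked_mat ?l W U $$ (j, i)"
          by (auto simp: m_def x spiked_mat_index[OF Wc(1) Uc])
        moreover have "spiked_mat ?l W U $$ (j, i) = spiked_mat ?l W U $$ (i, j)"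
          using M(2) ij by (simp add: symf_def)
        ultimately show "mat d d (sym_part (m x)) $$ (i, j) = spiked_mat ?l W U $$ (i, j)"
          using ij by (simp add: sym_part_def)
      qed (use M in auto)
      show ?thesis unfolding mem_Collect_eq ww mm
        using True Wc by (auto simp: good_event_def x spP Let_def symf_def)
    next
      case False
      thus ?thesis by (auto simp: good_event_def x spP symmetric_mats_iff_symf symf_def Let_def)
    qed
  qed
  note eq = this
  have "0 \<in> {..<d}" using r by simp
  hence ne: "{..<d} \<noteq> {}" by blast
  show ?thesis
    unfolding eq
  proof (intro sets.sets_Collect_conj sets.sets_Collect_finite_All' borel_measurable_le)
    fix i j assume "i \<in> {..<d}" "j \<in> {..<d}"
    thus "{x \<in> space ?P. fst x $$ (i, j) = fst x $$ (j, i)} \<in> sets ?P"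
      by (intro measurable_equality_set) simp_all
  next
    show "(\<lambda>x. op_norm (mat d d (w x)) + (1 - \<gamma>) * (?l + inverse ?l - 2)) \<in> borel_measurable ?P"
      by (intro borel_measurable_add borel_measurable_const op)
  qed (use r ev[of r] ev[of 1] ne in auto)
qed

subsection \<open>The probability of the good event\<close>

lemma goe_eq_distr_tri: "goe d = distr (tri d d) (mat_borel d d) (\<lambda>w. mat d d (symx w))"
proof -
  have "(\<lambda>(i, j). density lborel (\<lambda>x. ennreal (normal_density 0 (if i = j then sqrt (2 / real d) else sqrt (1 / real d)) x))) = goe_entry d"
    by (auto simp: fun_eq_iff)
  thus ?thesis unfolding goe_def tri_def upper_def symx_def by simp
qed

lemma symx_measurable:
  assumes "i < n" "j < n"
  shows "(\<lambda>w. symx w (i, j)) \<in> borel_measurable (tri d n)"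
proof -
  have p: "(min i j, max i j) \<in> upper n" using assms by (auto simp: upper_def)
  show ?thesis unfolding symx_def prod.case measurable_cong_sets[OF sets_tri refl]
    by (rule measurable_component_singleton[OF p])
qed

lemma goe_map_measurable: "(\<lambda>w. mat d d (symx w)) \<in> measurable (tri d d) (mat_borel d d)"
  by (rule measurable_to_mat_borel) (auto simp: symx_measurable)

lemma prob_space_goe: "0 < d \<Longrightarrow> prob_space (goe d)"
  unfolding goe_eq_distr_tri by (intro prob_space.prob_space_distr prob_space_tri goe_map_measurable)

lemma qf_index_mat: "qf n (index_mat (mat n n A)) v = qf n A v"
  by (intro ip_cong mv_cong) auto

lemma sym_mat_symx: "mat n n (symx w) \<in> symmetric_mats n"
  by (auto simp: symmetric_mats_iff_symf symf_def symx_def min.commute max.commute)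

lemma exists_fail_le:
  assumes I: "finite I" and ev: "\<And>i. i \<in> I \<Longrightarrow> form_event n (Ev i)" and le: "\<And>i. i \<in> I \<Longrightarrow> fail d n (Ev i) \<le> ennreal \<beta>"
    and \<beta>: "0 \<le> \<beta>"
  shows "emeasure (tri d n) (\<Union>i\<in>I. {w \<in> space (tri d n). \<not> Ev i (qf n (symx w))}) \<le> ennreal (real (card I) * \<beta>)"
proof -
  have "emeasure (tri d n) (\<Union>i\<in>I. {w \<in> space (tri d n). \<not> Ev i (qf n (symx w))}) \<le>
      (\<Sum>i\<in>I. emeasure (tri d n) {w \<in> space (tri d n). \<not> Ev i (qf n (symx w))})"
    using fail_set_measurable[OF ev] by (intro emeasure_subadditive_finite I) auto
  also have "\<dots> \<le> (\<Sum>i\<in>I. ennreal \<beta>)"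
    using le unfolding fail_def by (intro sum_mono)
  also have "\<dots> = ennreal (real (card I) * \<beta>)"
    using \<beta> by (simp add: ennreal_mult ennreal_of_nat_eq_real_of_nat)
  finally show ?thesis .
qed

text \<open>Union bound for a fixed \<open>U\<close>: upper and lower events for r^2 directions and
  two norm events, each with failure probability at most 3 d exp (- d h^2 / 16).\<close>

lemma goe_bad_section:
  assumes U: "U \<in> stiefel d r" and r: "1 \<le> r"
    and g: "0 < g" "g < 1" and l: "l = spike g" and z: "z = l + inverse l"
    and \<eta>: "0 \<le> \<eta>" "2 + \<eta> < z" "2 * h \<le> \<eta>"
    and eps: "0 \<le> \<epsilon>" "4 * \<epsilon> * real r * l \<le> 1" "2 * \<epsilon> * real r * l\<^sup>2 \<le> \<gamma> * z"
      "\<eta> + 8 * \<epsilon> * real r * l\<^sup>2 \<le> \<gamma> * (z - 2)"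
    and h: "0 \<le> h" "h < 1 / 2"
    and T: "1 \<le> (inverse l + \<epsilon>) * (z - h - (1 + h) * (inverse l + \<epsilon>))"
    and s: "\<And>n. 0 \<le> s n"
      "\<And>n. n < d \<Longrightarrow> 0 < s (Suc n) \<Longrightarrow> real d * (1 - h) \<le> real n \<and> s (Suc n) * (z + h - s n * (1 - 2 * h)) \<le> 1"
      "s d = inverse l - \<epsilon>"
    and meas: "{W \<in> carrier_mat d d. (W, U) \<notin> good_event d r g \<gamma>} \<in> sets (goe d)"
  shows "emeasure (goe d) {W \<in> carrier_mat d d. (W, U) \<notin> good_event d r g \<gamma>} \<le>
    ennreal ((2 + 2 * (real r)\<^sup>2) * (real d * (3 * exp (- (real d * h\<^sup>2 / 16)))))"
proof -
  let ?u = "\<lambda>k i. U $$ (i, k)"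
  define \<beta> where "\<beta> = real d * (3 * exp (- (real d * h\<^sup>2 / 16)))"
  have \<beta>: "0 \<le> \<beta>" by (simp add: \<beta>_def)
  have l1: "1 < l" using spike_quadratic[OF g] l by simp
  have d: "0 < d" using stiefel_le[OF U] r by simp
  let ?V = "{w \<in> space (tri d d). (mat d d (symx w), U) \<notin> good_event d r g \<gamma>}"
  define I where "I = ({..<r} \<times> {..<r}) \<times> (UNIV :: bool set)"
  define Ev where "Ev = (\<lambda>((i, j), b). if b then E_up d z (inverse l + \<epsilon>) 1 (pairing ?u i j)
    else E_low d z (inverse l - \<epsilon>) (pairing ?u i j))"
  \<comment> \<open>The two events say that 2 + \<eta> - W and 2 + \<eta> + W are positive
    semidefinite; the direction 0 leaves nothing else. The value T = 1 is a supersolution at 2 +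
    \<eta> precisely when 2 h \<le> \<eta>.\<close>
  define Ev' where "Ev' = (\<lambda>b :: bool. E_up d (2 + \<eta>) 1 (if b then 1 else - 1) (\<lambda>_. 0))"
  have Ev: "form_event d (Ev p)" for p
    by (auto simp: Ev_def form_event_E_up form_event_E_low split: prod.split)
  have Ev': "form_event d (Ev' b)" for b
    by (simp add: Ev'_def form_event_E_up)
  have failEv: "fail d d (Ev p) \<le> ennreal \<beta>" if pI: "p \<in> I" for p
  proof -
    obtain i j b where p: "p = ((i, j), b)" and ij: "i < r" "j < r" using pI by (auto simp: I_def)
    have up: "fail d d (E_up d z (inverse l + \<epsilon>) 1 (pairing ?u i j)) \<le> ennreal \<beta>"
      unfolding \<beta>_def using d h T l1 eps by (intro fail_E_up) (auto intro: add_pos_nonneg)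
    have "0 < ip d (pairing ?u i j) (pairing ?u i j)"
    proof (cases "i = j")
      case True
      thus ?thesis using stiefel_orthonormal[OF U ij] by (simp add: pairing_def)
    next
      case False
      have "ip d (pairing ?u i j) (pairing ?u i j) = 2"
        unfolding pairing_def if_not_P[OF False] ip_comb_left ip_comb_right
        using stiefel_orthonormal[OF U] ij False by simp
      thus ?thesis by simp
    qed
    hence "\<exists>k<d. pairing ?u i j k \<noteq> 0" by (simp only: ip_self_pos_iff)
    hence low: "fail d d (E_low d z (inverse l - \<epsilon>) (pairing ?u i j)) \<le> ennreal \<beta>"
      unfolding \<beta>_def s(3)[symmetric] using d h s(1,2) by (intro fail_E_low) auto
    show ?thesis using up low by (simp add: Ev_def p)
  qed
  have failEv': "fail d d (Ev' b) \<le> ennreal \<beta>" for b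
    unfolding \<beta>_def Ev'_def using d h \<eta> by (intro fail_E_up) auto
  have finI: "finite I" by (simp add: I_def)
  let ?B = "(\<Union>p\<in>I. {w \<in> space (tri d d). \<not> Ev p (qf d (symx w))})"
  let ?B' = "(\<Union>b\<in>UNIV. {w \<in> space (tri d d). \<not> Ev' b (qf d (symx w))})"
  have B: "?B \<in> sets (tri d d)" using fail_set_measurable[OF Ev] finI by (intro sets.finite_UN) auto
  have B': "?B' \<in> sets (tri d d)" using fail_set_measurable[OF Ev'] by (intro sets.finite_UN) auto
  have sub: "?V \<subseteq> ?B \<union> ?B'"
  proof
    fix w assume w: "w \<in> ?V"
    show "w \<in> ?B \<union> ?B'"
    proof (rule ccontr)
      assume no: "w \<notin> ?B \<union> ?B'"
      let ?W = "mat d d (symx w)"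
      have Q: "qf d (index_mat ?W) = qf d (symx w)" by (rule ext) (rule qf_index_mat)
      have E: "Ev p (qf d (symx w))" if "p \<in> I" for p using no w that by blast
      have E': "Ev' b (qf d (symx w))" for b using no w by blast
      have "(?W, U) \<in> good_event d r g \<gamma>"
      proof (rule good_eventI[OF sym_mat_symx U r g l z \<eta>(1,2) _ _ _ _ eps])
        show "0 \<le> (2 + \<eta>) * ip d v v - qf d (index_mat ?W) v" for v
          using E'[of True] by (simp add: qf_index_mat Ev'_def E_up_def)
        show "0 \<le> (2 + \<eta>) * ip d v v + qf d (index_mat ?W) v" for v
          using E'[of False] by (simp add: qf_index_mat Ev'_def E_up_def)
        show "E_up d z (inverse l + \<epsilon>) 1 (pairing ?u i j) (qf d (index_mat ?W))" if "i < r" "j < r" for i j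
          using E[of "((i, j), True)"] that unfolding Q by (simp add: Ev_def I_def)
        show "E_low d z (inverse l - \<epsilon>) (pairing ?u i j) (qf d (index_mat ?W))" if "i < r" "j < r" for i j
          using E[of "((i, j), False)"] that unfolding Q by (simp add: Ev_def I_def)
      qed
      thus False using w by simp
    qed
  qed
  have "emeasure (goe d) {W \<in> carrier_mat d d. (W, U) \<notin> good_event d r g \<gamma>} = emeasure (tri d d) ?V"
  proof -
    have "(\<lambda>w. mat d d (symx w)) -` {W \<in> carrier_mat d d. (W, U) \<notin> good_event d r g \<gamma>} \<inter> space (tri d d) = ?V" by auto
    thus ?thesis using meas unfolding goe_eq_distr_tri
      by (subst emeasure_distr[OF goe_map_measurable]) auto
  qed
  also have "\<dots> \<le> emeasure (tri d d) (?B \<union> ?B')"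
    using sub B B' by (intro emeasure_mono) auto
  also have "\<dots> \<le> emeasure (tri d d) ?B + emeasure (tri d d) ?B'"
    by (rule emeasure_subadditive[OF B B'])
  also have "\<dots> \<le> ennreal (real (card I) * \<beta>) + ennreal (real (card (UNIV :: bool set)) * \<beta>)"
    by (intro add_mono exists_fail_le[where Ev = Ev] exists_fail_le[where Ev = Ev'] finI Ev Ev' failEv failEv' \<beta> finite)
  also have "\<dots> = ennreal ((2 + 2 * (real r)\<^sup>2) * \<beta>)"
    using \<beta> by (simp add: I_def card_cartesian_product ennreal_plus[symmetric] power2_eq_square algebra_simps del: ennreal_plus)
  finally show ?thesis by (simp add: \<beta>_def)
qed

text \<open>Fubini with \<open>U\<close> integrated last. The measurability of a section, a premise
  within \<open>bad\<close>, comes from that of the good event in the product.\<close>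

lemma good_event_prob:
  assumes \<nu>: "uniform_stiefel d r \<nu>" and r: "1 \<le> r" "r \<le> d"
    and bad: "\<And>U. U \<in> stiefel d r \<Longrightarrow> {W \<in> carrier_mat d d. (W, U) \<notin> good_event d r g \<gamma>} \<in> sets (goe d) \<Longrightarrow>
      emeasure (goe d) {W \<in> carrier_mat d d. (W, U) \<notin> good_event d r g \<gamma>} \<le> ennreal \<delta>"
    and \<delta>: "0 \<le> \<delta>"
  shows "1 - \<delta> \<le> measure (goe d \<Otimes>\<^sub>M \<nu>) (good_event d r g \<gamma>)"
proof -
  let ?G = "good_event d r g \<gamma>"
  have d: "0 < d" using r by simp
  interpret goe: prob_space "goe d" by (rule prob_space_goe[OF d])
  interpret nu: prob_space \<nu> using \<nu> by (simp add: uniform_stiefel_def)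
  interpret pair: pair_prob_space "goe d" \<nu> ..
  let ?P = "goe d \<Otimes>\<^sub>M \<nu>"
  have sets\<nu>: "sets \<nu> = sets (restrict_space (mat_borel d r) (stiefel d r))"
    using \<nu> by (simp add: uniform_stiefel_def)
  have sp\<nu>: "space \<nu> = stiefel d r"
    using sets_eq_imp_space_eq[OF sets\<nu>] by (auto simp: space_restrict_space stiefel_def)
  have sgoe: "sets (goe d) = sets (mat_borel d d)" by (simp add: goe_eq_distr_tri)
  have spgoe: "space (goe d) = carrier_mat d d" by (simp add: goe_eq_distr_tri)
  have G: "?G \<in> sets ?P"
    using good_event_measurable[OF r sets\<nu>] sets_pair_measure_cong[OF sgoe refl, of \<nu>] by simp
  hence C: "space ?P - ?G \<in> sets ?P" by auto
  have "emeasure ?P (space ?P - ?G) = (\<integral>\<^sup>+ U. emeasure (goe d) ((\<lambda>W. (W, U)) -` (space ?P - ?G)) \<partial>\<nu>)"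
    by (rule pair.emeasure_pair_measure_alt2[OF C])
  also have "\<dots> \<le> (\<integral>\<^sup>+ U. ennreal \<delta> \<partial>\<nu>)"
  proof (rule nn_integral_mono)
    fix U assume U: "U \<in> space \<nu>"
    have eq: "(\<lambda>W. (W, U)) -` (space ?P - ?G) = {W \<in> carrier_mat d d. (W, U) \<notin> ?G}"
      using U by (auto simp: space_pair_measure spgoe)
    have "(\<lambda>W. (W, U)) -` (space ?P - ?G) \<in> sets (goe d)" by (rule sets_Pair2[OF C])
    thus "emeasure (goe d) ((\<lambda>W. (W, U)) -` (space ?P - ?G)) \<le> ennreal \<delta>"
      unfolding eq using bad U sp\<nu> by blast
  qed
  also have "\<dots> = ennreal \<delta>" using nu.emeasure_space_1 by simp
  finally have "measure ?P (space ?P - ?G) \<le> \<delta>"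
    using \<delta> by (simp add: pair.emeasure_eq_measure)
  thus ?thesis using pair.prob_compl[OF G] by simp
qed

text \<open>The number \<open>1 / l\<close> is the stable fixed point of \<open>t \<mapsto> 1 / (z - t)\<close>; the next two lemmas are its
  perturbed versions, from above as a supersolution and from below as an iteration that gains at
  least \<open>\<epsilon> g / (z + 3)\<close> in each step until it reaches \<open>1 / l - \<epsilon>\<close>.\<close>
lemma upper_fixed_point:
  fixes l z \<epsilon> g h :: real
  assumes l: "1 < l" and z: "z = l + inverse l" and g: "0 < g" and gap: "2 * g \<le> l - inverse l"
    and \<epsilon>: "0 < \<epsilon>" "\<epsilon> \<le> g" "\<epsilon> \<le> 1" and h: "0 \<le> h" "6 * h \<le> \<epsilon> * g"
  shows "1 \<le> (inverse l + \<epsilon>) * (z - h - (1 + h) * (inverse l + \<epsilon>))"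
proof -
  define T where "T = inverse l + \<epsilon>"
  have il: "0 < inverse l" "inverse l < 1" using l by (auto simp: inverse_less_1_iff)
  have T: "0 < T" "T \<le> 2" using il \<epsilon> unfolding T_def by linarith+
  \<comment> \<open>T \<le> 2 is the source of the constant 6 in the condition on \<open>h\<close>;
    moreover l - T \<ge> 2 g - \<epsilon> \<ge> g.\<close>
  have "T * (1 + T) \<le> 2 * 3" using T by (intro mult_mono) auto
  hence "h * (T * (1 + T)) \<le> h * 6" using h by (intro mult_left_mono) auto
  also have "\<dots> \<le> \<epsilon> * g" using h by simp
  also have "\<dots> \<le> \<epsilon> * (l - T)" using \<epsilon> gap by (intro mult_left_mono) (auto simp: T_def)
  finally have "h * (T * (1 + T)) \<le> \<epsilon> * (l - T)" .
  moreover have "T * (z - h - (1 + h) * T) = 1 + \<epsilon> * (l - T) - h * (T * (1 + T))"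
  proof -
    have "T * l = 1 + \<epsilon> * l" using l by (simp add: T_def algebra_simps)
    moreover have zT: "z = l + T - \<epsilon>" by (simp add: z T_def)
    have "T * (z - h - (1 + h) * T) = T * l - T * \<epsilon> - h * (T * (1 + T))"
      unfolding zT by (simp add: algebra_simps)
    ultimately show ?thesis by (simp add: algebra_simps)
  qed
  ultimately show ?thesis by (simp add: T_def)
qed

lemma lower_iteration_step:
  fixes l z \<epsilon> g h a b :: real
  assumes l: "1 < l" and z: "z = l + inverse l" and g: "0 < g" and gap: "2 * g \<le> l - inverse l"
    and \<epsilon>: "0 < \<epsilon>" and h: "0 \<le> h" "h \<le> 1" "6 * h \<le> \<epsilon> * g"
    and a: "0 \<le> a" "a \<le> inverse l - \<epsilon>" and b: "0 \<le> b" "b \<le> a + \<epsilon> * g / (z + 3)"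
  shows "b * (z + h - a * (1 - 2 * h)) \<le> 1"
proof -
  have il: "0 < inverse l" "inverse l < 1" using l by (auto simp: inverse_less_1_iff)
  have a1: "a \<le> 1" using a il \<epsilon> by linarith
  have z1: "1 < z" using z l il by linarith
  define F where "F = z + h - a * (1 - 2 * h)"
  have ah: "0 \<le> a * h" "a * h \<le> h" using a a1 h mult_right_mono[of a 1 h] by auto
  have "F = z + h - a + 2 * (a * h)" by (simp add: F_def algebra_simps)
  hence F: "0 \<le> F" "F \<le> z + 3" using ah a a1 h z1 by linarith+
  have "b * F \<le> (a + \<epsilon> * g / (z + 3)) * F" using b F by (intro mult_right_mono)
  also have "\<dots> = a * F + \<epsilon> * g * (F / (z + 3))" by (simp add: algebra_simps)
  also have "\<dots> \<le> a * F + \<epsilon> * g"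
    using F z1 \<epsilon> g mult_left_le[of "F / (z + 3)" "\<epsilon> * g"] by simp
  \<comment> \<open>Below the fixed point one gains (l - a) (1/l - a) \<ge> (l - 1/l) \<epsilon>
    \<ge> 2 g \<epsilon>. One half of this pays for the increment of the level, the other half for
    the border errors, at most 3 h.\<close>
  also have "a * F = 1 - (l - a) * (inverse l - a) + (a * h + 2 * (a * (a * h)))"
    using l by (simp add: F_def z algebra_simps)
  also have "(l - inverse l) * \<epsilon> \<le> (l - a) * (inverse l - a)"
    using a l il \<epsilon> gap g by (intro mult_mono) auto
  hence "1 - (l - a) * (inverse l - a) + (a * h + 2 * (a * (a * h))) + \<epsilon> * g \<le>
      1 - 2 * g * \<epsilon> + 3 * h + \<epsilon> * g"
  proof -
    have "2 * g * \<epsilon> \<le> (l - inverse l) * \<epsilon>" using gap \<epsilon> by (intro mult_right_mono) auto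
    moreover have "a * (a * h) \<le> a * h" using a1 a ah mult_right_mono[of a 1 "a * h"] by simp
    ultimately show ?thesis
      using \<open>(l - inverse l) * \<epsilon> \<le> (l - a) * (inverse l - a)\<close> ah by linarith
  qed
  also have "\<dots> \<le> 1"
  proof -
    have "2 * g * \<epsilon> = 2 * (\<epsilon> * g)" by simp
    thus ?thesis using h by linarith
  qed
  finally show ?thesis by (simp add: F_def)
qed

text \<open>The exponent is 2 a with a = D h^2 / 32. One factor exp (- a) absorbs \<open>D\<close>
  since a exp (- a) \<le> 1; the other is at most \<delta> exp (- 32 R / h^2), and the same
  inequality absorbs the remaining factor 32 R / h^2.\<close>

lemma exp_tail_le:
  fixes D h R \<delta> :: real
  assumes h: "0 < h" and R: "0 < R" and \<delta>: "0 < \<delta>" and D: "0 \<le> D" "32 / h\<^sup>2 * (ln (1 / \<delta>) + 32 * R / h\<^sup>2) \<le> D"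
  shows "R * (D * exp (- (D * h\<^sup>2 / 16))) \<le> \<delta>"
proof -
  define a where "a = D * h\<^sup>2 / 32"
  have a0: "0 \<le> a" using D by (simp add: a_def)
  have xe: "x * exp (- x) \<le> 1" for x :: real
  proof -
    have "x \<le> exp x" using exp_ge_add_one_self[of x] by linarith
    thus ?thesis by (simp add: exp_minus field_simps)
  qed
  have "ln (1 / \<delta>) + 32 * R / h\<^sup>2 \<le> a"
  proof -
    have "h\<^sup>2 / 32 * (32 / h\<^sup>2 * (ln (1 / \<delta>) + 32 * R / h\<^sup>2)) \<le> h\<^sup>2 / 32 * D"
      using D by (intro mult_left_mono) auto
    moreover have "h\<^sup>2 / 32 * (32 / h\<^sup>2 * X) = X" for X using h by simp
    moreover have "h\<^sup>2 / 32 * D = a" by (simp add: a_def)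
    ultimately show ?thesis by metis
  qed
  hence "exp (- a) \<le> exp (- ln (1 / \<delta>) - 32 * R / h\<^sup>2)" by simp
  also have "\<dots> = \<delta> * exp (- (32 * R / h\<^sup>2))"
    using \<delta> by (simp add: exp_diff exp_minus ln_div field_simps)
  finally have ea: "exp (- a) \<le> \<delta> * exp (- (32 * R / h\<^sup>2))" .
  have "D * exp (- (D * h\<^sup>2 / 16)) = 32 / h\<^sup>2 * (a * exp (- a)) * exp (- a)"
    using h by (simp add: a_def mult_exp_exp)
  also have "\<dots> \<le> 32 / h\<^sup>2 * 1 * exp (- a)"
    using xe[of a] by (intro mult_right_mono mult_left_mono) auto
  also have "\<dots> \<le> 32 / h\<^sup>2 * (\<delta> * exp (- (32 * R / h\<^sup>2)))"
    using ea by simp (intro divide_right_mono mult_left_mono, auto)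
  finally have "R * (D * exp (- (D * h\<^sup>2 / 16))) \<le> R * (32 / h\<^sup>2 * (\<delta> * exp (- (32 * R / h\<^sup>2))))"
    using R by (intro mult_left_mono) auto
  also have "\<dots> = \<delta> * (32 * R / h\<^sup>2 * exp (- (32 * R / h\<^sup>2)))" by simp
  also have "\<dots> \<le> \<delta>" using xe[of "32 * R / h\<^sup>2"] \<delta> by (intro mult_left_le) auto
  finally show ?thesis .
qed

lemma good_event_prob_explicit:
  fixes g \<gamma> \<delta> :: real and r d :: nat
  assumes g: "0 < g" "g < 1" and \<gamma>: "0 < \<gamma>" "\<gamma> < 1" and \<delta>: "0 < \<delta>" "ln (1 / \<delta>) \<ge> 1" and r: "1 \<le> r"
    and \<nu>: "uniform_stiefel d r \<nu>"
    and h_def: "h = \<gamma> * g\<^sup>2 * (1 - g)\<^sup>2 / (192 * real r)"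
    and d: "13000 * (1 / (1 - g)) * (real r)\<^sup>2 * ln (1 / \<delta>) / h ^ 4 \<le> real d"
  shows "1 - \<delta> \<le> measure (goe d \<Otimes>\<^sub>M \<nu>) (good_event d r g \<gamma>)"
proof -
  define l where "l = spike g"
  define z where "z = l + inverse l"
  \<comment> \<open>Since l (1 - g) \<le> 2, this choice gives \<epsilon> r l^2 \<le> \<gamma> g /
    8. Then \<open>8 * \<epsilon> * real r * l\<^sup>2\<close> is at most \<gamma> g \<le> \<eta>,
    the half of the budget \<gamma> (z - 2) that \<eta> leaves. The 192 = 6 * 32 in \<open>h\<close>
    makes \<open>6 * h = \<epsilon> * g\<close>.\<close>
  define \<epsilon> where "\<epsilon> = \<gamma> * g * (1 - g)\<^sup>2 / (32 * real r)"
  define \<eta> where "\<eta> = \<gamma> * (z - 2) / 2"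
  define Z where "Z = ln (1 / \<delta>)"
  define R where "R = real r"
  have R: "1 \<le> R" using r by (simp add: R_def)
  have l1: "1 < l" and z2: "z = 2 / (1 - g)" using spike_quadratic[OF g] by (auto simp: l_def z_def)
  have zg: "z - 2 = 2 * g / (1 - g)" unfolding z2 using g by (simp add: field_simps)
  have gw: "g \<le> g / (1 - g)" using g by (simp add: field_simps)
  have il: "0 < inverse l" "inverse l < 1" using l1 by (auto simp: inverse_less_1_iff)
  have lz: "l \<le> z" using il by (simp add: z_def)
  have gap: "2 * g \<le> l - inverse l"
  proof (rule power2_le_imp_le)
    \<comment> \<open>Squaring removes the root in the spike: z^2 - 4 = 4 g (2 - g) / (1 - g)^2
      \<ge> 4 g^2.\<close>
    have "(l - inverse l)\<^sup>2 = z\<^sup>2 - 4" using l1 by (simp add: z_def power2_eq_square field_simps)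
    also have "\<dots> = (4 - 4 * (1 - g)\<^sup>2) / (1 - g)\<^sup>2" unfolding z2 using g by (simp add: power_divide diff_divide_distrib)
    also have "4 - 4 * (1 - g)\<^sup>2 = 4 * g * (2 - g)" by (simp add: power2_eq_square algebra_simps)
    also have "4 * g * g / 1 \<le> 4 * g * (2 - g) / (1 - g)\<^sup>2"
      using g by (intro frac_le mult_left_mono) (auto simp: power_le_one)
    finally show "(2 * g)\<^sup>2 \<le> (l - inverse l)\<^sup>2" by (simp add: power2_eq_square)
    show "0 \<le> l - inverse l" using l1 il by linarith
  qed
  have \<epsilon>0: "0 < \<epsilon>" using g \<gamma> R by (simp add: \<epsilon>_def R_def)
  have \<epsilon>R: "\<epsilon> * R = \<gamma> * g * (1 - g)\<^sup>2 / 32" using R by (simp add: \<epsilon>_def R_def)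
  have \<epsilon>le: "\<epsilon> \<le> \<gamma> * g * (1 - g)\<^sup>2 / 32"
  proof -
    have "\<epsilon> * 1 \<le> \<epsilon> * R" using R \<epsilon>0 by (intro mult_left_mono) auto
    thus ?thesis unfolding \<epsilon>R by simp
  qed
  have g1: "(1 - g)\<^sup>2 \<le> 1 - g" using g by (simp add: power2_eq_square mult_left_le)
  have "\<gamma> * g * (1 - g)\<^sup>2 \<le> 1 * g * (1 - g)"
    using g \<gamma> g1 by (intro mult_mono) auto
  hence \<epsilon>g: "\<epsilon> \<le> g * (1 - g) / 32" using \<epsilon>le by simp
  have "g * (1 - g) \<le> g" "g * (1 - g) \<le> 1 - g" using g by (auto simp: mult_left_le mult_left_le_one_le)
  hence \<epsilon>g': "\<epsilon> \<le> g / 32" "\<epsilon> \<le> (1 - g) / 32" using \<epsilon>g by auto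
  have h6: "6 * h = \<epsilon> * g" using R by (simp add: h_def \<epsilon>_def power2_eq_square R_def)
  have h0: "0 < h" using g \<gamma> R by (simp add: h_def R_def)
  have "\<epsilon> * g \<le> \<epsilon>" using g \<epsilon>0 by (simp add: mult_left_le)
  hence h1: "6 * h \<le> 1 / 32" using h6 \<epsilon>g' g by linarith
  have \<eta>g: "\<gamma> * g \<le> \<eta>"
  proof -
    have "z - 2 = 2 * (g / (1 - g))" using zg by (simp only: times_divide_eq_right)
    moreover have "\<eta> = \<gamma> * q" if "z - 2 = 2 * q" for q using that by (simp add: \<eta>_def)
    ultimately have "\<eta> = \<gamma> * (g / (1 - g))" by blast
    thus ?thesis using mult_left_mono[OF gw, of \<gamma>] \<gamma> by simp
  qed
  have "\<epsilon> \<le> \<gamma> * g"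
  proof -
    have "\<gamma> * g * (1 - g)\<^sup>2 \<le> \<gamma> * g" using g \<gamma> by (intro mult_left_le) (auto simp: power_le_one)
    moreover have "0 < \<gamma> * g" using g \<gamma> by simp
    ultimately show ?thesis using \<epsilon>le by linarith
  qed
  hence h\<eta>: "2 * h \<le> \<eta>" using h6 \<open>\<epsilon> * g \<le> \<epsilon>\<close> \<eta>g h0 by linarith
  have ll: "l\<^sup>2 * (1 - g)\<^sup>2 \<le> 4" and l2: "l * (1 - g) \<le> 2"
  proof -
    show l2: "l * (1 - g) \<le> 2" using lz g unfolding z2 by (simp add: field_simps)
    have "(l * (1 - g))\<^sup>2 \<le> 2\<^sup>2" using l2 l1 g by (intro power_mono) auto
    thus "l\<^sup>2 * (1 - g)\<^sup>2 \<le> 4" by (simp add: power_mult_distrib)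
  qed
  have eRl2: "\<epsilon> * R * l\<^sup>2 \<le> \<gamma> * g / 8"
    unfolding \<epsilon>R using mult_left_mono[OF ll, of "\<gamma> * g / 32"] g \<gamma> by (simp add: mult_ac)
  have c1: "4 * \<epsilon> * real r * l \<le> 1"
  proof -
    have "\<epsilon> * R * l \<le> \<epsilon> * R * l\<^sup>2" using \<epsilon>0 R l1 by (intro mult_left_mono) (auto simp: power2_eq_square)
    also have "\<dots> \<le> 1 / 8" using eRl2 mult_mono[of \<gamma> 1 g 1] g \<gamma> by simp
    finally show ?thesis by (simp add: R_def)
  qed
  have c2: "2 * \<epsilon> * real r * l\<^sup>2 \<le> \<gamma> * z"
  proof -
    have "g \<le> z" using lz l1 g by linarith
    hence "\<gamma> * g \<le> \<gamma> * z" using \<gamma> by (intro mult_left_mono) auto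
    moreover have "2 * \<epsilon> * real r * l\<^sup>2 = 2 * (\<epsilon> * R * l\<^sup>2)" by (simp add: R_def)
    ultimately show ?thesis using eRl2 mult_pos_pos[OF \<gamma>(1) g(1)] by linarith
  qed
  have c3: "\<eta> + 8 * \<epsilon> * real r * l\<^sup>2 \<le> \<gamma> * (z - 2)"
  proof -
    have "8 * \<epsilon> * real r * l\<^sup>2 = 8 * (\<epsilon> * R * l\<^sup>2)" by (simp add: R_def)
    moreover have "\<gamma> * (z - 2) = 2 * \<eta>" by (simp add: \<eta>_def)
    ultimately show ?thesis using eRl2 \<eta>g by linarith
  qed
  have \<eta>0: "0 \<le> \<eta>" using \<eta>g g \<gamma> by (meson less_imp_le mult_pos_pos order_trans)
  have "\<gamma> * (z - 2) \<le> z - 2" using \<gamma> g unfolding zg by (intro mult_left_le_one_le) auto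
  moreover have "0 < z - 2" unfolding zg using g by simp
  moreover have "\<gamma> * (z - 2) = 2 * \<eta>" by (simp add: \<eta>_def)
  ultimately have \<eta>z: "2 + \<eta> < z" by linarith
  have T: "1 \<le> (inverse l + \<epsilon>) * (z - h - (1 + h) * (inverse l + \<epsilon>))"
    using \<epsilon>g' g h0 h6 by (intro upper_fixed_point[OF l1 z_def g(1) gap \<epsilon>0]) auto
  define \<kappa> where "\<kappa> = \<epsilon> * g / (z + 3)"
  \<comment> \<open>Level 0 up to size about d (1 - h), then slope \<open>\<kappa>\<close>, the
    increment allowed by the iteration step, capped at the target. The shift by 1 ensures that a
    positive level at \<open>Suc n\<close> implies d (1 - h) < n.\<close>
  define s where "s = (\<lambda>n. min (inverse l - \<epsilon>) (\<kappa> * max 0 (real n - 1 - real d * (1 - h))))"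
  have z3: "0 < z + 3" using lz l1 by linarith
  have \<kappa>0: "0 < \<kappa>" using \<epsilon>0 g z3 by (simp add: \<kappa>_def)
  have "1 - g \<le> 2 * inverse l" using l2 l1 by (simp add: field_simps)
  moreover have "32 * \<epsilon> \<le> 1 - g" using \<epsilon>g'(2) by simp
  ultimately have sst: "0 < inverse l - \<epsilon>" using g by linarith
  have s0: "0 \<le> s n" for n using sst \<kappa>0 by (simp add: s_def)
  have s1: "real d * (1 - h) \<le> real n \<and> s (Suc n) * (z + h - s n * (1 - 2 * h)) \<le> 1" if "0 < s (Suc n)" for n
  proof
    have "0 < max 0 (real (Suc n) - 1 - real d * (1 - h))"
      using that \<kappa>0 by (simp add: s_def zero_less_mult_iff)
    thus "real d * (1 - h) \<le> real n" by simp
    have "s (Suc n) \<le> s n + \<kappa>"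
    proof -
      have "\<kappa> * max 0 (real (Suc n) - 1 - real d * (1 - h)) \<le> \<kappa> * (max 0 (real n - 1 - real d * (1 - h)) + 1)"
        using \<kappa>0 by (intro mult_left_mono) auto
      hence "\<kappa> * max 0 (real (Suc n) - 1 - real d * (1 - h)) \<le> \<kappa> * max 0 (real n - 1 - real d * (1 - h)) + \<kappa>"
        by (simp only: distrib_left mult_1_right)
      moreover have "min S A \<le> min S B + \<kappa>" if "A \<le> B + \<kappa>" for S A B :: real
        using that \<kappa>0 by auto
      ultimately show ?thesis unfolding s_def by blast
    qed
    hence "s (Suc n) \<le> s n + \<epsilon> * g / (z + 3)" by (simp only: \<kappa>_def)
    moreover have "s n \<le> inverse l - \<epsilon>" unfolding s_def by (rule min.cobounded1)
    moreover have "0 \<le> h" "h \<le> 1" "6 * h \<le> \<epsilon> * g" using h0 h1 h6 by auto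
    ultimately show "s (Suc n) * (z + h - s n * (1 - 2 * h)) \<le> 1"
      by (intro lower_iteration_step[OF l1 z_def g(1) gap \<epsilon>0] s0)
  qed
  have w1: "1 \<le> 1 / (1 - g)" using g by simp
  have Z1: "1 \<le> Z" using \<delta> by (simp add: Z_def)
  have D: "13000 * (1 / (1 - g)) * R\<^sup>2 * Z / h ^ 4 \<le> real d" using d by (simp add: R_def Z_def)
  have RZ: "1 \<le> R\<^sup>2 * Z" using R Z1 mult_mono[of 1 "R\<^sup>2" 1 Z] by simp
  hence RZ0: "0 \<le> R\<^sup>2 * Z" by linarith
  have sd: "s d = inverse l - \<epsilon>"
  proof -
    have "13000 * (1 / (1 - g)) * 1 / h\<^sup>2 \<le> 13000 * (1 / (1 - g)) * (R\<^sup>2 * Z) / h ^ 4"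
      using RZ RZ0 w1 h0 h1 g by (intro frac_le mult_left_mono) (auto intro!: power_decreasing divide_nonneg_nonneg)
    hence "13000 * (1 / (1 - g)) / h\<^sup>2 \<le> real d" using D by (simp add: mult.assoc)
    hence "13000 * (1 / (1 - g)) / h\<^sup>2 * h \<le> real d * h" using h0 by (intro mult_right_mono) auto
    hence dh: "13000 * (1 / (1 - g)) / h \<le> real d * h" using h0 by (simp add: power2_eq_square)
    have "z + 3 \<le> 5 * (1 / (1 - g))" using w1 unfolding z2 by simp
    hence "(z + 3) / (6 * h) \<le> 5 * (1 / (1 - g)) / (6 * h)" using h0 by (intro divide_right_mono) auto
    moreover have "1 / \<kappa> = (z + 3) / (6 * h)" by (simp add: \<kappa>_def h6)
    ultimately have "1 / \<kappa> \<le> 5 * (1 / (1 - g)) / (6 * h)" by simp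
    also have "\<dots> \<le> 1 / (1 - g) / h" using h0 g by (simp add: field_simps)
    finally have 1: "1 / \<kappa> \<le> 1 / (1 - g) / h" .
    have 2: "1 \<le> 1 / (1 - g) / h"
    proof -
      have "1 / 1 \<le> 1 / (1 - g) / h" using w1 h0 h1 g by (intro frac_le) auto
      thus ?thesis by simp
    qed
    \<comment> \<open>From d (1 - h) to d there are about d h steps of size \<open>\<kappa>\<close>;
      one is lost to the shift, and 1/\<kappa> of them suffice because the target is below
      1.\<close>
    have "1 / \<kappa> + 1 \<le> real d * h"
    proof -
      define P where "P = 1 / (1 - g) / h"
      have "13000 * P \<le> real d * h" using dh by (simp add: P_def)
      moreover have "1 / \<kappa> \<le> P" "1 \<le> P" using 1 2 by (auto simp: P_def)
      ultimately show ?thesis by linarith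
    qed
    hence "\<kappa> * (1 / \<kappa>) \<le> \<kappa> * (real d - 1 - real d * (1 - h))"
      using \<kappa>0 by (intro mult_left_mono) (auto simp: algebra_simps)
    hence "1 \<le> \<kappa> * (real d - 1 - real d * (1 - h))" using \<kappa>0 by simp
    also have "\<dots> \<le> \<kappa> * max 0 (real d - 1 - real d * (1 - h))" using \<kappa>0 by (intro mult_left_mono) auto
    finally have "inverse l - \<epsilon> \<le> \<kappa> * max 0 (real d - 1 - real d * (1 - h))" using il \<epsilon>0 by linarith
    thus ?thesis unfolding s_def by (rule min_absorb1)
  qed
  \<comment> \<open>The 12 comes from 3 (2 + 2 r^2) \<le> 12 r^2. The terms of the threshold are
    merged by ln (1/\<delta>) \<ge> 1 and r^2 / h^2 \<ge> 1, and 32 (1 + 32 * 12) = 12320 is rounded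
    up to 13000.\<close>
  have tail: "12 * R\<^sup>2 * (real d * exp (- (real d * h\<^sup>2 / 16))) \<le> \<delta>"
  proof (rule exp_tail_le[OF h0 _ \<delta>(1)])
    show "0 < 12 * R\<^sup>2" using R by simp
    have h21: "1 \<le> R\<^sup>2 / h\<^sup>2" using R h0 h1 by (simp add: power_mono)
    have "32 / h\<^sup>2 * (ln (1 / \<delta>) + 32 * (12 * R\<^sup>2) / h\<^sup>2) = 32 / h\<^sup>2 * (Z + 384 * (R\<^sup>2 / h\<^sup>2))" by (simp add: Z_def)
    also have "\<dots> \<le> 32 / h\<^sup>2 * (R\<^sup>2 / h\<^sup>2 * Z + 384 * (R\<^sup>2 / h\<^sup>2 * Z))"
    proof (intro mult_left_mono add_mono)
      show "Z \<le> R\<^sup>2 / h\<^sup>2 * Z" using mult_right_mono[OF h21, of Z] Z1 by simp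
      show "R\<^sup>2 / h\<^sup>2 \<le> R\<^sup>2 / h\<^sup>2 * Z" using mult_left_mono[OF Z1, of "R\<^sup>2 / h\<^sup>2"] by simp
    qed auto
    also have "\<dots> = 12320 * 1 * R\<^sup>2 * Z / h ^ 4" using h0 by (simp add: field_simps power2_eq_square power4_eq_xxxx)
    also have "\<dots> \<le> 13000 * (1 / (1 - g)) * R\<^sup>2 * Z / h ^ 4"
      using w1 Z1 h0 by (intro divide_right_mono mult_right_mono mult_mono) auto
    finally show "32 / h\<^sup>2 * (ln (1 / \<delta>) + 32 * (12 * R\<^sup>2) / h\<^sup>2) \<le> real d" using D by linarith
  qed simp
  show ?thesis
  proof (rule good_event_prob[OF \<nu> r])
    interpret nu: prob_space \<nu> using \<nu> by (simp add: uniform_stiefel_def)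
    have "sets \<nu> = sets (restrict_space (mat_borel d r) (stiefel d r))" using \<nu> by (simp add: uniform_stiefel_def)
    from sets_eq_imp_space_eq[OF this] have "space \<nu> = stiefel d r" by (auto simp: space_restrict_space stiefel_def)
    with nu.not_empty show "r \<le> d" using stiefel_le by blast
    show "0 \<le> \<delta>" using \<delta> by simp
    fix U assume U: "U \<in> stiefel d r" and meas: "{W \<in> carrier_mat d d. (W, U) \<notin> good_event d r g \<gamma>} \<in> sets (goe d)"
    have "emeasure (goe d) {W \<in> carrier_mat d d. (W, U) \<notin> good_event d r g \<gamma>} \<le>
        ennreal ((2 + 2 * (real r)\<^sup>2) * (real d * (3 * exp (- (real d * h\<^sup>2 / 16)))))"
      using h0 h1 \<epsilon>0 s1
      by (intro goe_bad_section[where s = s and h = h and \<epsilon> = \<epsilon>, OF U r g l_def z_def \<eta>0 \<eta>z h\<eta> _ c1 c2 c3 _ _ T s0 _ sd meas]) auto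
    also have "\<dots> \<le> ennreal \<delta>"
    proof (rule ennreal_leI)
      have "2 + 2 * R\<^sup>2 \<le> 4 * R\<^sup>2" using R by (simp add: one_le_power)
      hence "(2 + 2 * R\<^sup>2) * (real d * (3 * exp (- (real d * h\<^sup>2 / 16)))) \<le> 4 * R\<^sup>2 * (real d * (3 * exp (- (real d * h\<^sup>2 / 16))))"
        by (intro mult_right_mono) auto
      also have "\<dots> \<le> \<delta>" using tail by (simp add: mult_ac)
      finally show "(2 + 2 * (real r)\<^sup>2) * (real d * (3 * exp (- (real d * h\<^sup>2 / 16)))) \<le> \<delta>" by (simp add: R_def)
    qed
    finally show "emeasure (goe d) {W \<in> carrier_mat d d. (W, U) \<notin> good_event d r g \<gamma>} \<le> ennreal \<delta>" .
  qed
qed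

lemma polynomially_bounded_monomial:
  "polynomially_bounded (\<lambda>v w x y z. C * (v ^ a * w ^ b * x ^ c * y ^ e * z ^ f))"
  unfolding polynomially_bounded_def
proof (intro exI allI impI)
  let ?N = "a + b + c + e + f"
  \<comment> \<open>Coefficients of a single monomial; the condition on the innermost summation
    index is the outermost one, so that the five sums collapse one after the other.\<close>
  let ?c = "\<lambda>i j k l m. if m = f then if l = e then if k = c then if j = b then if i = a then \<bar>C\<bar> else 0 else 0 else 0 else 0 else 0"
  fix v w x y z :: real
  assume nonneg: "0 \<le> v" "0 \<le> w" "0 \<le> x" "0 \<le> y" "0 \<le> z"
  have delta: "(\<Sum>i\<le>?N. if i = t then G i else 0) = G t" if "t \<le> ?N" for t and G :: "nat \<Rightarrow> real"
    using that by simp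
  have t: "?c i j k l m * v ^ i * w ^ j * x ^ k * y ^ l * z ^ m =
      (if m = f then if l = e then if k = c then if j = b then if i = a then
        \<bar>C\<bar> * v ^ a * w ^ b * x ^ c * y ^ e * z ^ f else 0 else 0 else 0 else 0 else 0)" for i j k l m
    by simp
  have "(\<Sum>i\<le>?N. \<Sum>j\<le>?N. \<Sum>k\<le>?N. \<Sum>l\<le>?N. \<Sum>m\<le>?N. ?c i j k l m * v ^ i * w ^ j * x ^ k * y ^ l * z ^ m) =
      \<bar>C\<bar> * v ^ a * w ^ b * x ^ c * y ^ e * z ^ f"
    unfolding t by (simp only: delta le_add1 le_add2 trans_le_add1 trans_le_add2 order_refl)
  thus "\<bar>C * (v ^ a * w ^ b * x ^ c * y ^ e * z ^ f)\<bar> \<le>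
      (\<Sum>i\<le>?N. \<Sum>j\<le>?N. \<Sum>k\<le>?N. \<Sum>l\<le>?N. \<Sum>m\<le>?N. ?c i j k l m * v ^ i * w ^ j * x ^ k * y ^ l * z ^ m)"
    using nonneg by (simp add: abs_mult mult.assoc)
qed

theorem proposition2p1:
  shows "(\<forall>g. 0 < g \<and> g < 1 \<longrightarrow>
            spike g > 1 \<and>
            g = (spike g + inverse (spike g) - 2) / (spike g + inverse (spike g)) \<and>
            g = (spike g - 1)\<^sup>2 / ((spike g)\<^sup>2 + 1)) \<and>
         (\<exists>q. polynomially_bounded q \<and>
            (\<forall>(g::real) (\<gamma>::real) (\<delta>::real) (r::nat) (d::nat) (\<nu> :: real mat measure).
               0 < g \<and> g < 1 \<and> 0 < \<gamma> \<and> \<gamma> < 1/10 \<and> 0 < \<delta> \<and> \<delta> < 1/10 \<and> 1 \<le> r \<and>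
               uniform_stiefel d r \<nu> \<and>
               real d \<ge> q (inverse g) (inverse (1 - g)) (inverse \<gamma>) (real r) (ln (1 / \<delta>)) \<longrightarrow>
               measure (goe d \<Otimes>\<^sub>M \<nu>) (good_event d r g \<gamma>) \<ge> 1 - \<delta>)) \<and>
         (\<forall>(g::real) (\<gamma>::real) (r::nat) (d::nat) (W :: real mat) (U :: real mat).
            0 < g \<and> g < 1 \<and> 0 < \<gamma> \<and> \<gamma> < 1 \<and> 1 \<le> r \<and> (W, U) \<in> good_event d r g \<gamma> \<longrightarrow>
            gap r (spiked_mat (spike g) W U) = gap r (mat_abs (spiked_mat (spike g) W U)) \<and>
            gap r (spiked_mat (spike g) W U) \<ge> (1 - \<gamma>) / (1 + \<gamma>) * g)"
proof (intro conjI)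
  show "\<forall>g. 0 < g \<and> g < 1 \<longrightarrow>
            spike g > 1 \<and>
            g = (spike g + inverse (spike g) - 2) / (spike g + inverse (spike g)) \<and>
            g = (spike g - 1)\<^sup>2 / ((spike g)\<^sup>2 + 1)"
    using spike_quadratic(1) spike_identities by blast
next
  \<comment> \<open>The exponents come from r^2 ln (1/\<delta>) / ((1 - g) h^4) with 1/h = 192 r /
    (\<gamma> g^2 (1 - g)^2).\<close>
  let ?q = "\<lambda>v w x y z :: real. 13000 * 192 ^ 4 * (v ^ 8 * w ^ 9 * x ^ 4 * y ^ 6 * z ^ 1)"
  show "\<exists>q. polynomially_bounded q \<and>
            (\<forall>(g::real) (\<gamma>::real) (\<delta>::real) (r::nat) (d::nat) (\<nu> :: real mat measure).
               0 < g \<and> g < 1 \<and> 0 < \<gamma> \<and> \<gamma> < 1/10 \<and> 0 < \<delta> \<and> \<delta> < 1/10 \<and> 1 \<le> r \<and>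
               uniform_stiefel d r \<nu> \<and>
               real d \<ge> q (inverse g) (inverse (1 - g)) (inverse \<gamma>) (real r) (ln (1 / \<delta>)) \<longrightarrow>
               measure (goe d \<Otimes>\<^sub>M \<nu>) (good_event d r g \<gamma>) \<ge> 1 - \<delta>)"
  proof (intro exI[of _ ?q] conjI allI impI, rule polynomially_bounded_monomial)
    fix g \<gamma> \<delta> :: real and r d :: nat and \<nu> :: "real mat measure"
    assume *: "0 < g \<and> g < 1 \<and> 0 < \<gamma> \<and> \<gamma> < 1/10 \<and> 0 < \<delta> \<and> \<delta> < 1/10 \<and> 1 \<le> r \<and>
               uniform_stiefel d r \<nu> \<and>
               real d \<ge> ?q (inverse g) (inverse (1 - g)) (inverse \<gamma>) (real r) (ln (1 / \<delta>))"
    define h where "h = \<gamma> * g\<^sup>2 * (1 - g)\<^sup>2 / (192 * real r)"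
    \<comment> \<open>The bound \<delta> < 1/10 gives ln (1/\<delta>) \<ge> 1, which lets additive
      constants be absorbed into a multiple of ln (1/\<delta>).\<close>
    have "exp 1 \<le> 1 / \<delta>"
    proof -
      have "exp 1 \<le> (3 :: real)" by (rule exp_le)
      also have "3 \<le> 1 / \<delta>" using * by (simp add: field_simps)
      finally show ?thesis .
    qed
    hence \<delta>: "1 \<le> ln (1 / \<delta>)" using * by (subst ln_ge_iff) auto
    have "13000 * (1 / (1 - g)) * (real r)\<^sup>2 * ln (1 / \<delta>) / h ^ 4 =
        ?q (inverse g) (inverse (1 - g)) (inverse \<gamma>) (real r) (ln (1 / \<delta>))"
    proof -
      let ?h' = "192 * real r * inverse \<gamma> * (inverse g)\<^sup>2 * (inverse (1 - g))\<^sup>2"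
      have "1 / h = ?h'"
        unfolding h_def
        by (simp only: divide_inverse inverse_mult_distrib inverse_inverse_eq power_inverse mult_1 mult_ac)
      moreover have "13000 * (1 / (1 - g)) * (real r)\<^sup>2 * ln (1 / \<delta>) / h ^ 4 =
          13000 * inverse (1 - g) * (real r)\<^sup>2 * ln (1 / \<delta>) * (1 / h) ^ 4"
        by (simp add: power_divide inverse_eq_divide)
      moreover have "C * w * R\<^sup>2 * Z * (k * R * x * v\<^sup>2 * w\<^sup>2) ^ 4 = C * k ^ 4 * (v ^ 8 * w ^ 9 * x ^ 4 * R ^ 6 * Z ^ 1)"
        for C k v w x R Z :: real
      proof -
        have "(k * R * x * v\<^sup>2 * w\<^sup>2) ^ 4 = k ^ 4 * R ^ 4 * x ^ 4 * v ^ 8 * w ^ 8"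
          by (simp add: power_mult_distrib flip: power_mult)
        moreover have "w * w ^ 8 = w ^ 9" "R\<^sup>2 * R ^ 4 = R ^ 6"
          by (simp_all flip: power_Suc power_add)
        moreover have "C * w * R\<^sup>2 * Z * (k ^ 4 * R ^ 4 * x ^ 4 * v ^ 8 * w ^ 8) =
            C * k ^ 4 * (v ^ 8 * (w * w ^ 8) * x ^ 4 * (R\<^sup>2 * R ^ 4) * Z ^ 1)"
          by (simp only: mult_ac power_one_right)
        ultimately show ?thesis by simp
      qed
      ultimately show ?thesis by (simp only:)
    qed
    hence "13000 * (1 / (1 - g)) * (real r)\<^sup>2 * ln (1 / \<delta>) / h ^ 4 \<le> real d" using * by simp
    thus "measure (goe d \<Otimes>\<^sub>M \<nu>) (good_event d r g \<gamma>) \<ge> 1 - \<delta>"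
      using * \<delta> by (intro good_event_prob_explicit[OF _ _ _ _ _ _ _ _ h_def]) auto
  qed
next
  show "\<forall>(g::real) (\<gamma>::real) (r::nat) (d::nat) (W :: real mat) (U :: real mat).
            0 < g \<and> g < 1 \<and> 0 < \<gamma> \<and> \<gamma> < 1 \<and> 1 \<le> r \<and> (W, U) \<in> good_event d r g \<gamma> \<longrightarrow>
            gap r (spiked_mat (spike g) W U) = gap r (mat_abs (spiked_mat (spike g) W U)) \<and>
            gap r (spiked_mat (spike g) W U) \<ge> (1 - \<gamma>) / (1 + \<gamma>) * g"
  proof (intro allI impI)
    fix g \<gamma> :: real and r d :: nat and W U :: "real mat"
    assume *: "0 < g \<and> g < 1 \<and> 0 < \<gamma> \<and> \<gamma> < 1 \<and> 1 \<le> r \<and> (W, U) \<in> good_event d r g \<gamma>"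
    hence "U \<in> stiefel d r" by (auto simp: good_event_def)
    hence "r \<le> d" by (rule stiefel_le)
    thus "gap r (spiked_mat (spike g) W U) = gap r (mat_abs (spiked_mat (spike g) W U)) \<and>
        gap r (spiked_mat (spike g) W U) \<ge> (1 - \<gamma>) / (1 + \<gamma>) * g"
      using gap_on_good_event[of g \<gamma> r d W U] * by blast
  qed
qed

end
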